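(* The sequence $\{T_n'^a:\mathrm{ATL}_n(R^a)\to R^a\}_{n=1}^\infty$ is a Markov trace (on the tower of algebras $\{\mathrm{ATL}_n(R^a)\}_{n=1}^\infty$ with respect to the homomorphisms $\rho_n^a$).
   Context: Let $R_0^a=\mathbb{Z}[z_0,z_1,z_2,\dots]$ and $R^a=\mathbb{Z}[A^{\pm1},z_1,z_2,\dots]$, with $R_0^a$ embedded in $R^a$ via $z_0=-A^2-A^{-2}$. For $n\ge1$ let $V_n=\{0,1\}\times\{1,\dots,n\}$, ordered by $(0,1)<(0,2)<\cdots<(0,n)<(1,n)<\cdots<(1,2)<(1,1)$. A flat virtual $n$-tangle is a partition of $V_n$ into pairs; $\mathcal{E}_n$ is the set of these. An arrow flat $n$-tangle is a pair $F=(E,f)$ with $E\in\mathcal{E}_n$ and $f:E\to\mathbb{Z}$ such that, for $\alpha=\{(a,b),(c,d)\}\in E$, $f(\alpha)$ is odd if $a=c$ and even if $a\ne c$. $\mathcal{F}_n$ is the set of arrow flat $n$-tangles, and $\mathrm{ATL}_n$ is the free $R_0^a$-module with basis $\mathcal{F}_n$, with the multiplication defined as follows. Let $E,E'\in\mathcal{E}_n$. An arc of length $\ell$ in $E\sqcup E'$ is an $\ell$-tuple $\hat\alpha=(\alpha_1,\dots,\alpha_\ell)$ of elements of $E\sqcup E'$, $\alpha_i=\{(a_i,b_{i-1}),(c_i,b_i)\}$, such that: (a) if $\alpha_i\in E$ and $i<\ell$, then $c_i=1$, $\alpha_{i+1}\in E'$ and $a_{i+1}=0$; (b) if $\alpha_i\in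 E'$ and $i<\ell$, then $c_i=0$, $\alpha_{i+1}\in E$ and $a_{i+1}=1$; (c) $a_1=0$ if $\alpha_1\in E$, $a_1=1$ if $\alpha_1\in E'$, $c_\ell=0$ if $\alpha_\ell\in E$, $c_\ell=1$ if $\alpha_\ell\in E'$, and $(a_1,b_0)<(c_\ell,b_\ell)$. Its boundary is $\partial\hat\alpha=\{(a_1,b_0),(c_\ell,b_\ell)\}$. There are $n$ arcs and their boundaries form a flat virtual $n$-tangle $E*E'$. A cycle of length $2p\ge2$ in $E\sqcup E'$ is a $2p$-tuple $\hat\gamma=(\gamma_1,\dots,\gamma_{2p})$, $\gamma_i=\{(a_i,b_{i-1}),(c_i,b_i)\}$, such that $\gamma_i\in E$ and $a_i=c_i=1$ for $i$ odd, $\gamma_i\in E'$ and $a_i=c_i=0$ for $i$ even, and $b_0=b_{2p}<b_i$ for $1\le i\le 2p-1$. The parity of $\alpha=\{(a,b),(c,d)\}$ is $\varpi(\alpha)=-1$ if $a=c$ and $\varpi(\alpha)=1$ if $a\ne c$. For an arc or cycle $(\alpha_1,\dots,\alpha_\ell)$ with $\alpha_i=\{(a_i,b_{i-1}),(c_i,b_i)\}$ (also for the cycles in a closure, defined below), the cumulated parity is $\varpi^c(\alpha_i)=\prod_{j=1}^{i-1}\varpi(\alpha_j)$ if $(a_i,b_{i-1})<(c_i,b_i)$, and $\varpi^c(\alpha_i)=\prod_{j=1}^{i}\varpi(\alpha_j)$ if $(c_i,b_i)<(a_i,b_{i-1})$. Let $F=(E,f)$, $F'=(E',f')\in\mathcal{F}_n$,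 and let $f^*$ equal $f$ on $E$ and $f'$ on $E'$. For an arc $\hat\alpha$ of $E\sqcup E'$ put $g(\partial\hat\alpha)=\sum_{i=1}^\ell\varpi^c(\alpha_i)f^*(\alpha_i)$, and set $F*F'=(E*E',g)\in\mathcal{F}_n$. For a cycle $\hat\gamma$ put $h(\hat\gamma)=\sum_i\varpi^c(\gamma_i)f^*(\gamma_i)$ (an even number) and $\zeta(\hat\gamma)=|h(\hat\gamma)|/2$. If $\hat\gamma_1,\dots,\hat\gamma_m$ are the cycles of $E\sqcup E'$, then $F\,F'=z_{\zeta(\hat\gamma_1)}\cdots z_{\zeta(\hat\gamma_m)}(F*F')$. This makes $\mathrm{ATL}_n$ an associative unital algebra (unit: all pairs $\{(0,k),(1,k)\}$ labeled $0$). Set $\mathrm{ATL}_n(R^a)=R^a\otimes_{R_0^a}\mathrm{ATL}_n$. Adding the pair $\{(0,n+1),(1,n+1)\}$ with label $0$ defines a map $\mathcal{F}_n\to\mathcal{F}_{n+1}$ inducing an injective homomorphism $\mathrm{ATL}_n(R^a)\hookrightarrow\mathrm{ATL}_{n+1}(R^a)$, by which $\mathrm{ATL}_n(R^a)$ is viewed as a subalgebra of $\mathrm{ATL}_{n+1}(R^a)$. For $1\le i\le n-1$: $F_i$ has pairs $\{(0,i),(0,i+1)\}$ and $\{(1,i),(1,i+1)\}$ both labeled $1$, and $\{(0,k),(1,k)\}$ labeled $0$ for $k\ne i,i+1$; $w_i$ has pairs $\{(0,i),(1,i+1)\}$, $\{(0,i+1),(1,i)\}$, and $\{(0,k),(1,k)\}$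 for $k\ne i,i+1$, all labeled $0$. Set $S_i=-A^{-2}\,1-A^{-4}F_i$; it is invertible in $\mathrm{ATL}_n(R^a)$. (With $\mathrm{VB}_n$ the virtual braid group with its standard generators $\sigma_i,\tau_i$, the homomorphism $\rho_n^a:R^a[\mathrm{VB}_n]\to\mathrm{ATL}_n(R^a)$ sends $\sigma_i\mapsto S_i$, $\tau_i\mapsto w_i$.) Trace. For $E\in\mathcal{E}_n$, a cycle of length $\ell$ in the closure $\hat E$ is an $\ell$-tuple $\hat\gamma=(\gamma_1,\dots,\gamma_\ell)$ in $E$, $\gamma_i=\{(a_i,b_{i-1}),(c_i,b_i)\}$, such that $a_{i+1}=1$ if $c_i=0$ and $a_{i+1}=0$ if $c_i=1$, for $1\le i\le\ell-1$; and $b_0=b_\ell<b_i$ for $1\le i\le\ell-1$, $a_1=0$, $c_\ell=1$. For $F=(E,f)\in\mathcal{F}_n$ and such a cycle put $h(\hat\gamma)=\sum_{i=1}^\ell\varpi^c(\gamma_i)f(\gamma_i)$ (an even number) and $\zeta(\hat\gamma)=|h(\hat\gamma)|/2$. If $\hat\gamma_1,\dots,\hat\gamma_m$ are the cycles of $\hat E$, set $T_n'^a(F)=z_{\zeta(\hat\gamma_1)}\cdots z_{\zeta(\hat\gamma_m)}$, and extend $R^a$-linearly to $T_n'^a:\mathrm{ATL}_n(R^a)\to R^a$. A sequence of $R^a$-linear forms $\{T_n':\mathrm{ATL}_n(R^a)\to R^a\}_{n=1}^\infty$ is a Markov trace if: (a) $T_n'(xy)=T_n'(yx)$ for all $n\ge1$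 and all $x,y\in\mathrm{ATL}_n(R^a)$; (b) $T_n'(x)=T_{n+1}'(xS_n)=T_{n+1}'(xS_n^{-1})=T_{n+1}'(xw_n)$ for all $n\ge1$ and all $x\in\mathrm{ATL}_n(R^a)$; (c) $T_n'(x)=T_{n+1}'(xS_n^{-1}w_{n-1}S_n)$ for all $n\ge2$ and all $x\in\mathrm{ATL}_n(R^a)$; (d) $T_n'(x)=T_{n+1}'(xw_nw_{n-1}S_{n-1}w_nS_{n-1}^{-1}w_{n-1}w_n)$ for all $n\ge2$ and all $x\in\mathrm{ATL}_n(R^a)$. *)

theory Defs
  imports
    "HOL-Library.Poly_Mapping"
    "HOL-Library.Product_Plus"
    "HOL-Library.Disjoint_Sets"
    "HOL-Library.FuncSet"
    "HOL-Algebra.Module"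
begin

text \<open>The ring \<open>R\<^sup>a = \<int>[A\<^sup>\<plusminus>\<^sup>1, z\<^sub>1, z\<^sub>2, \<dots>]\<close>, as the monoid algebra over \<open>int\<close> of the monomials
  \<open>A\<^sup>k \<Prod>\<^sub>j z\<^bsub>j+1\<^esub>\<^bsup>m(j)\<^esup>\<close>: the pair \<open>(k, m)\<close> is the exponent, and index \<open>j\<close> stands for
  the variable \<open>z\<^bsub>j+1\<^esub>\<close>.\<close>

type_synonym Ra = "(int \<times> (nat \<Rightarrow>\<^sub>0 nat)) \<Rightarrow>\<^sub>0 int"

definition Apow :: "int \<Rightarrow> Ra" where
  "Apow k = Poly_Mapping.single (k, 0) 1"

text \<open>The element \<open>z\<^sub>0\<close> is the image of the variable \<open>z\<^sub>0\<close> under the embedding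
  \<open>\<int>[z\<^sub>0, z\<^sub>1, \<dots>] \<subseteq> R\<^sup>a\<close>.\<close>

definition zvar :: "nat \<Rightarrow> Ra" where
  "zvar k = (if k = 0 then - Apow 2 - Apow (- 2)
             else Poly_Mapping.single (0, Poly_Mapping.single (k - 1) 1) 1)"


section \<open>Flat virtual tangles and arrow flat tangles\<close>

type_synonym vertex = "nat \<times> nat"

definition Vset :: "nat \<Rightarrow> vertex set" where
  "Vset n = {0, 1} \<times> {1..n}"

text \<open>\<open>(0,1) < (0,2) < \<dots> < (0,n) < (1,n) < \<dots> < (1,2) < (1,1)\<close>\<close>

definition vless :: "vertex \<Rightarrow> vertex \<Rightarrow> bool" where
  "vless v w \<longleftrightarrow> fst v < fst w \<or>
     (fst v = fst w \<and> (if fst v = 0 then snd v < snd w else snd w < snd v))"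

definition flat_tangles :: "nat \<Rightarrow> vertex set set set" where
  "flat_tangles n = {E. partition_on (Vset n) E \<and> (\<forall>e\<in>E. card e = 2)}"

text \<open>The label function \<open>E \<rightarrow> \<int>\<close> is an extensional function, so that equality of pairs
  \<open>(E, f)\<close> is equality of arrow flat tangles.\<close>

type_synonym tangle = "vertex set set \<times> (vertex set \<Rightarrow> int)"

definition arrow_tangles :: "nat \<Rightarrow> tangle set" where
  "arrow_tangles n = {(E, f). E \<in> flat_tangles n \<and> f \<in> extensional E \<and>
     (\<forall>a b c d. {(a, b), (c, d)} \<in> E \<longrightarrow>
        (if a = c then odd (f {(a, b), (c, d)}) else even (f {(a, b), (c, d)})))}"


section \<open>Cumulated parity\<close>

text \<open>The term \<open>\<alpha>\<^sub>i = {(a\<^sub>i, b\<^bsub>i-1\<^esub>), (c\<^sub>i, b\<^sub>i)}\<close> of an arc or cycle is traversed from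
  \<open>(a\<^sub>i, b\<^bsub>i-1\<^esub>)\<close> to \<open>(c\<^sub>i, b\<^sub>i)\<close>. It is represented by the ordered pair of these vertices, and
  positions in a list are counted from 0.\<close>

type_synonym oriented = "vertex \<times> vertex"

definition und :: "oriented \<Rightarrow> vertex set" where
  "und s = {fst s, snd s}"

definition parity :: "oriented \<Rightarrow> int" where
  "parity s = (if fst (fst s) = fst (snd s) then - 1 else 1)"

definition cum_parity :: "oriented list \<Rightarrow> nat \<Rightarrow> int" where
  "cum_parity ss i =
     (if vless (fst (ss ! i)) (snd (ss ! i)) then (\<Prod>j<i. parity (ss ! j))
      else (\<Prod>j\<le>i. parity (ss ! j)))"


section \<open>Arcs and cycles in the disjoint union of two flat tangles\<close>

text \<open>The tag records whether a term lies in \<open>E\<close> or in \<open>E'\<close>; the same pair may occur in both.\<close>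

datatype factor = First | Second

type_synonym tagged = "factor \<times> oriented"

definition tag :: "tagged \<Rightarrow> factor" where "tag t = fst t"
definition src :: "tagged \<Rightarrow> vertex" where "src t = fst (snd t)"
definition dst :: "tagged \<Rightarrow> vertex" where "dst t = snd (snd t)"

definition path_in :: "vertex set set \<Rightarrow> vertex set set \<Rightarrow> tagged list \<Rightarrow> bool" where
  "path_in E E' ts \<longleftrightarrow> ts \<noteq> [] \<and>
     (\<forall>t\<in>set ts. und (snd t) \<in> (case tag t of First \<Rightarrow> E | Second \<Rightarrow> E')) \<and>
     (\<forall>i. Suc i < length ts \<longrightarrow> snd (dst (ts ! i)) = snd (src (ts ! Suc i)))"

definition is_arc :: "vertex set set \<Rightarrow> vertex set set \<Rightarrow> tagged list \<Rightarrow> bool" where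
  "is_arc E E' ts \<longleftrightarrow> path_in E E' ts \<and>
     (\<forall>i. Suc i < length ts \<longrightarrow> tag (ts ! i) = First \<longrightarrow>
        fst (dst (ts ! i)) = 1 \<and> tag (ts ! Suc i) = Second \<and> fst (src (ts ! Suc i)) = 0) \<and>
     (\<forall>i. Suc i < length ts \<longrightarrow> tag (ts ! i) = Second \<longrightarrow>
        fst (dst (ts ! i)) = 0 \<and> tag (ts ! Suc i) = First \<and> fst (src (ts ! Suc i)) = 1) \<and>
     fst (src (hd ts)) = (case tag (hd ts) of First \<Rightarrow> 0 | Second \<Rightarrow> 1) \<and>
     fst (dst (last ts)) = (case tag (last ts) of First \<Rightarrow> 0 | Second \<Rightarrow> 1) \<and>
     vless (src (hd ts)) (dst (last ts))"

definition boundary :: "tagged list \<Rightarrow> vertex set" where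
  "boundary ts = {src (hd ts), dst (last ts)}"

definition is_cycle :: "vertex set set \<Rightarrow> vertex set set \<Rightarrow> tagged list \<Rightarrow> bool" where
  "is_cycle E E' ts \<longleftrightarrow> path_in E E' ts \<and> even (length ts) \<and>
     (\<forall>i<length ts. even i \<longrightarrow>
        tag (ts ! i) = First \<and> fst (src (ts ! i)) = 1 \<and> fst (dst (ts ! i)) = 1) \<and>
     (\<forall>i<length ts. odd i \<longrightarrow>
        tag (ts ! i) = Second \<and> fst (src (ts ! i)) = 0 \<and> fst (dst (ts ! i)) = 0) \<and>
     snd (dst (last ts)) = snd (src (hd ts)) \<and>
     (\<forall>i. 1 \<le> i \<and> i < length ts \<longrightarrow> snd (src (hd ts)) < snd (src (ts ! i)))"

text \<open>The sum \<open>\<Sum>\<^sub>i \<varpi>\<^sup>c(\<alpha>\<^sub>i) f\<^sup>*(\<alpha>\<^sub>i)\<close>, giving \<open>g\<close> on arcs and \<open>h\<close> on cycles.\<close>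

definition path_label ::
    "(vertex set \<Rightarrow> int) \<Rightarrow> (vertex set \<Rightarrow> int) \<Rightarrow> tagged list \<Rightarrow> int" where
  "path_label f f' ts =
     (\<Sum>i<length ts. cum_parity (map snd ts) i *
        (case tag (ts ! i) of First \<Rightarrow> f (und (snd (ts ! i))) | Second \<Rightarrow> f' (und (snd (ts ! i)))))"

definition flat_star :: "vertex set set \<Rightarrow> vertex set set \<Rightarrow> vertex set set" where
  "flat_star E E' = boundary ` {ts. is_arc E E' ts}"

definition tangle_star :: "tangle \<Rightarrow> tangle \<Rightarrow> tangle" where
  "tangle_star F F' = (case (F, F') of ((E, f), (E', f')) \<Rightarrow>
     (flat_star E E',
      \<lambda>e\<in>flat_star E E'. path_label f f' (THE ts. is_arc E E' ts \<and> boundary ts = e)))"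

definition loop_factor :: "tangle \<Rightarrow> tangle \<Rightarrow> Ra" where
  "loop_factor F F' = (case (F, F') of ((E, f), (E', f')) \<Rightarrow>
     (\<Prod>ts\<in>{ts. is_cycle E E' ts}. zvar (nat (\<bar>path_label f f' ts\<bar> div 2))))"


section \<open>The algebras \<open>ATL\<^sub>n(R\<^sup>a)\<close>\<close>

text \<open>The scalar extension to \<open>R\<^sup>a\<close> of the free \<open>R\<^sub>0\<^sup>a\<close>-module with basis \<open>\<F>\<^sub>n\<close> is the free
  \<open>R\<^sup>a\<close>-module with the same basis: the finitely supported functions \<open>\<F>\<^sub>n \<rightarrow> R\<^sup>a\<close>.\<close>

type_synonym atl = "tangle \<Rightarrow>\<^sub>0 Ra"

definition through :: "nat \<Rightarrow> vertex set" where
  "through k = {(0, k), (1, k)}"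

definition tangle_one :: "nat \<Rightarrow> tangle" where
  "tangle_one n = (through ` {1..n}, \<lambda>e\<in>through ` {1..n}. 0)"

definition ATL :: "nat \<Rightarrow> (Ra, atl) module" where
  "ATL n =
     \<lparr>carrier = {x. Poly_Mapping.keys x \<subseteq> arrow_tangles n},
      monoid.mult = (\<lambda>x y. \<Sum>F\<in>Poly_Mapping.keys x. \<Sum>F'\<in>Poly_Mapping.keys y.
        Poly_Mapping.single (tangle_star F F')
          (Poly_Mapping.lookup x F * Poly_Mapping.lookup y F' * loop_factor F F')),
      one = Poly_Mapping.single (tangle_one n) 1,
      zero = 0,
      add = (+),
      smult = (\<lambda>c. Poly_Mapping.map ((*) c))\<rparr>"

definition tangle_incl :: "nat \<Rightarrow> tangle \<Rightarrow> tangle" where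
  "tangle_incl n F =
     (insert (through (n + 1)) (fst F), (snd F)(through (n + 1) := 0))"

text \<open>The inclusion of \<open>ATL\<^sub>n(R\<^sup>a)\<close> into \<open>ATL\<^bsub>n+1\<^esub>(R\<^sup>a)\<close>.\<close>

definition incl :: "nat \<Rightarrow> atl \<Rightarrow> atl" where
  "incl n x = (\<Sum>F\<in>Poly_Mapping.keys x.
     Poly_Mapping.single (tangle_incl n F) (Poly_Mapping.lookup x F))"

definition F_tangle :: "nat \<Rightarrow> nat \<Rightarrow> tangle" where
  "F_tangle n i =
     (let H = {{(0, i), (0, i + 1)}, {(1, i), (1, i + 1)}};
          E = H \<union> through ` ({1..n} - {i, i + 1})
      in (E, \<lambda>e\<in>E. if e \<in> H then 1 else 0))"

definition w_tangle :: "nat \<Rightarrow> nat \<Rightarrow> tangle" where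
  "w_tangle n i =
     (let E = {{(0, i), (1, i + 1)}, {(0, i + 1), (1, i)}} \<union> through ` ({1..n} - {i, i + 1})
      in (E, \<lambda>e\<in>E. 0))"

text \<open>In the following elements the first argument \<open>n\<close> is the index of the algebra \<open>ATL\<^sub>n(R\<^sup>a)\<close>
  and the second the index \<open>i\<close> of the generator.\<close>

definition gen_F :: "nat \<Rightarrow> nat \<Rightarrow> atl" where
  "gen_F n i = Poly_Mapping.single (F_tangle n i) 1"

definition gen_w :: "nat \<Rightarrow> nat \<Rightarrow> atl" where
  "gen_w n i = Poly_Mapping.single (w_tangle n i) 1"

definition gen_S :: "nat \<Rightarrow> nat \<Rightarrow> atl" where
  "gen_S n i = (- Apow (- 2)) \<odot>\<^bsub>ATL n\<^esub> \<one>\<^bsub>ATL n\<^esub> \<oplus>\<^bsub>ATL n\<^esub> (- Apow (- 4)) \<odot>\<^bsub>ATL n\<^esub> gen_F n i"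

abbreviation gen_S_inv :: "nat \<Rightarrow> nat \<Rightarrow> atl" where
  "gen_S_inv n i \<equiv> inv\<^bsub>ATL n\<^esub> (gen_S n i)"


section \<open>The trace\<close>

definition is_closure_cycle :: "vertex set set \<Rightarrow> oriented list \<Rightarrow> bool" where
  "is_closure_cycle E ss \<longleftrightarrow> ss \<noteq> [] \<and> (\<forall>s\<in>set ss. und s \<in> E) \<and>
     (\<forall>i. Suc i < length ss \<longrightarrow>
        snd (snd (ss ! i)) = snd (fst (ss ! Suc i)) \<and>
        (fst (snd (ss ! i)) = 0 \<longrightarrow> fst (fst (ss ! Suc i)) = 1) \<and>
        (fst (snd (ss ! i)) = 1 \<longrightarrow> fst (fst (ss ! Suc i)) = 0)) \<and>
     snd (snd (last ss)) = snd (fst (hd ss)) \<and>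
     (\<forall>i. 1 \<le> i \<and> i < length ss \<longrightarrow> snd (fst (hd ss)) < snd (fst (ss ! i))) \<and>
     fst (fst (hd ss)) = 0 \<and> fst (snd (last ss)) = 1"

definition closure_label :: "(vertex set \<Rightarrow> int) \<Rightarrow> oriented list \<Rightarrow> int" where
  "closure_label f ss = (\<Sum>i<length ss. cum_parity ss i * f (und (ss ! i)))"

definition tangle_trace :: "tangle \<Rightarrow> Ra" where
  "tangle_trace F = (case F of (E, f) \<Rightarrow>
     (\<Prod>ss\<in>{ss. is_closure_cycle E ss}. zvar (nat (\<bar>closure_label f ss\<bar> div 2))))"

definition ATL_trace :: "nat \<Rightarrow> atl \<Rightarrow> Ra" where
  "ATL_trace n = (\<lambda>x\<in>carrier (ATL n).
     \<Sum>F\<in>Poly_Mapping.keys x. Poly_Mapping.lookup x F * tangle_trace F)"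


section \<open>Markov traces\<close>

definition linear_form :: "nat \<Rightarrow> (atl \<Rightarrow> Ra) \<Rightarrow> bool" where
  "linear_form n T \<longleftrightarrow>
     (\<forall>x\<in>carrier (ATL n). \<forall>y\<in>carrier (ATL n). T (x \<oplus>\<^bsub>ATL n\<^esub> y) = T x + T y) \<and>
     (\<forall>c. \<forall>x\<in>carrier (ATL n). T (c \<odot>\<^bsub>ATL n\<^esub> x) = c * T x)"

definition markov_trace :: "(nat \<Rightarrow> atl \<Rightarrow> Ra) \<Rightarrow> bool" where
  "markov_trace T \<longleftrightarrow>
     (\<forall>n\<ge>1. linear_form n (T n)) \<and>
     (\<forall>n\<ge>1. \<forall>x\<in>carrier (ATL n). \<forall>y\<in>carrier (ATL n).
        T n (x \<otimes>\<^bsub>ATL n\<^esub> y) = T n (y \<otimes>\<^bsub>ATL n\<^esub> x)) \<and>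
     (\<forall>n\<ge>1. \<forall>x\<in>carrier (ATL n).
        T n x = T (n + 1) (incl n x \<otimes>\<^bsub>ATL (n + 1)\<^esub> gen_S (n + 1) n) \<and>
        T n x = T (n + 1) (incl n x \<otimes>\<^bsub>ATL (n + 1)\<^esub> gen_S_inv (n + 1) n) \<and>
        T n x = T (n + 1) (incl n x \<otimes>\<^bsub>ATL (n + 1)\<^esub> gen_w (n + 1) n)) \<and>
     (\<forall>n\<ge>2. \<forall>x\<in>carrier (ATL n).
        T n x = T (n + 1)
          (incl n x \<otimes>\<^bsub>ATL (n + 1)\<^esub> gen_S_inv (n + 1) n
             \<otimes>\<^bsub>ATL (n + 1)\<^esub> gen_w (n + 1) (n - 1)
             \<otimes>\<^bsub>ATL (n + 1)\<^esub> gen_S (n + 1) n)) \<and>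
     (\<forall>n\<ge>2. \<forall>x\<in>carrier (ATL n).
        T n x = T (n + 1)
          (incl n x \<otimes>\<^bsub>ATL (n + 1)\<^esub> gen_w (n + 1) n
             \<otimes>\<^bsub>ATL (n + 1)\<^esub> gen_w (n + 1) (n - 1)
             \<otimes>\<^bsub>ATL (n + 1)\<^esub> gen_S (n + 1) (n - 1)
             \<otimes>\<^bsub>ATL (n + 1)\<^esub> gen_w (n + 1) n
             \<otimes>\<^bsub>ATL (n + 1)\<^esub> gen_S_inv (n + 1) (n - 1)
             \<otimes>\<^bsub>ATL (n + 1)\<^esub> gen_w (n + 1) (n - 1)
             \<otimes>\<^bsub>ATL (n + 1)\<^esub> gen_w (n + 1) n))"

end

theory Submission
  imports Defs
begin

text \<open>
  The sign conventions disappear once every strand is weighted by its label, with a sign chosen so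
  that reversing the traversal negates the weight: a tangle becomes a graph with integer gains, the
  label of an arc is the gain of a path, and \<open>|h|\<close> of a cycle is the non-negative generator of the
  group of gains of closed walks in its component. The loops removed from a product and the loops of
  a closure are then exactly the components of the glued graph without free ends, and the rest of
  the product is the restriction of the gain relation to the free ends. Gluing in several steps or
  at once gives the same components and the same gains, whence associativity, and the closure of a
  product is a cyclic gluing that does not distinguish the factors, whence the trace property. The
  Markov moves reduce to \<open>F\<^sub>n F\<^sub>n = z\<^sub>0 F\<^sub>n\<close>, \<open>F\<^sub>n w\<^bsub>n-1\<^esub> F\<^sub>n = F\<^sub>n\<close>, relations of the symmetric group, and
  the traces of \<open>x\<close>, \<open>x F\<^sub>n\<close> and \<open>x w\<^sub>n\<close> for \<open>x\<close> in the smaller algebra, because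
  \<open>z\<^sub>0 + A\<^sup>2 + A\<^bsup>-2\<^esup> = 0\<close>.
\<close>

section \<open>Gain graphs\<close>

text \<open>The definitions describe arcs and loops by lists whose starting point and direction are
  dictated by the vertex order. Such lists do not survive gluing: a strand of a product is itself an
  arc of two tangles, and a loop running through it acquires another base point, direction and
  length. Matching lists with lists would mean rotating, reversing and concatenating them at every
  step. The relation \<open>conn\<close> records only which points are joined and with which gain.
  Moving the base point of a closed walk conjugates its gain in an abelian group and reversal
  negates it, so exactly the absolute value survives, and this is all that the index of
  \<open>z\<close> depends on. Associativity is more than background: the inverse of S is taken with
  the general monoid operation, whose value can be computed, and the words in (c) and (d) regrouped,
  only after \<open>ATL n\<close> is known to be a monoid. Moves (c) and (d) each contain one S and
  one inverse of S. Expanding both gives four terms with coefficients 1, A^2, A^-2 and 1; three of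
  them have traces proportional to the trace of x w_{n-1} and cancel, and the fourth gives back the
  trace of x.\<close>

text \<open>Walks may traverse edges backwards, so \<open>conn G\<close> is a groupoid graded by \<open>int\<close>. The gains of
  the closed walks at a vertex form a subgroup, and \<open>holonomy\<close> is its non-negative generator.\<close>

inductive conn :: "('a \<times> 'a \<times> int) set \<Rightarrow> 'a \<Rightarrow> 'a \<Rightarrow> int \<Rightarrow> bool" for G where
  conn_refl: "conn G x x 0"
| conn_fwd: "conn G x y s \<Longrightarrow> (y, z, g) \<in> G \<Longrightarrow> conn G x z (s + g)"
| conn_bwd: "conn G x y s \<Longrightarrow> (z, y, g) \<in> G \<Longrightarrow> conn G x z (s - g)"

definition component :: "('a \<times> 'a \<times> int) set \<Rightarrow> 'a \<Rightarrow> 'a set" where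
  "component G x = {y. \<exists>s. conn G x y s}"

definition holonomy :: "('a \<times> 'a \<times> int) set \<Rightarrow> 'a set \<Rightarrow> int" where
  "holonomy G K = Gcd {s. \<exists>x\<in>K. conn G x x s}"

text \<open>The argument is always a holonomy or an absolute value, so \<open>nat\<close> never
  truncates.\<close>

definition loop_val :: "int \<Rightarrow> Ra" where
  "loop_val h = zvar (nat (h div 2))"

text \<open>\<open>X\<close> restricts to the relevant points, because any point of the type without
  edges is a component of its own. Components that meet \<open>B\<close> are open strands and
  contribute nothing.\<close>

definition loop_prod :: "('a \<times> 'a \<times> int) set \<Rightarrow> 'a set \<Rightarrow> 'a set \<Rightarrow> Ra" where
  "loop_prod G X B = (\<Prod>K\<in>{K \<in> component G ` X. K \<inter> B = {}}. loop_val (holonomy G K))"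

lemma conn_edge: "(x, y, g) \<in> G \<Longrightarrow> conn G x y g"
  using conn_fwd[OF conn_refl] by force

lemma conn_edge': "(y, x, g) \<in> G \<Longrightarrow> conn G x y (- g)"
  using conn_bwd[OF conn_refl] by force

lemma conn_trans: "conn G y z t \<Longrightarrow> conn G x y s \<Longrightarrow> conn G x z (s + t)"
proof (induction rule: conn.induct)
  case (conn_fwd y u t z g)
  then show ?case using conn.conn_fwd[of G x u "s + t" z g] by (simp add: add.assoc)
next
  case (conn_bwd y u t z g)
  then show ?case using conn.conn_bwd[of G x u "s + t" z g] by (simp add: algebra_simps)
qed simp

lemma conn_sym: "conn G x y s \<Longrightarrow> conn G y x (- s)"
proof (induction rule: conn.induct)
  case (conn_fwd x y s z g)
  then show ?case using conn_trans[OF conn_fwd.IH conn_edge'[OF conn_fwd.hyps(2)]] by (simp add: algebra_simps)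
next
  case (conn_bwd x y s z g)
  then show ?case using conn_trans[OF conn_bwd.IH conn_edge[OF conn_bwd.hyps(2)]] by (simp add: algebra_simps)
qed (use conn_refl in force)

lemma conn_mono: "conn G x y s \<Longrightarrow> G \<subseteq> H \<Longrightarrow> conn H x y s"
  by (induction rule: conn.induct) (auto intro: conn.intros)

text \<open>The potential \<open>\<delta>\<close> is a gauge transformation: its contributions
  telescope along a walk, so only the two ends remain.\<close>

lemma conn_map:
  assumes "conn G x y s" and "\<And>u v g. (u, v, g) \<in> G \<Longrightarrow> conn H (\<phi> u) (\<phi> v) (g + \<delta> v - \<delta> u)"
  shows "conn H (\<phi> x) (\<phi> y) (s + \<delta> y - \<delta> x)"
  using assms(1)
proof (induction rule: conn.induct)
  case (conn_refl x)
  then show ?case using conn.conn_refl by force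
next
  case (conn_fwd x y s z g)
  from conn_trans[OF assms(2)[OF conn_fwd.hyps(2)] conn_fwd.IH] show ?case
    by (simp add: algebra_simps)
next
  case (conn_bwd x y s z g)
  from conn_trans[OF conn_sym[OF assms(2)[OF conn_bwd.hyps(2)]] conn_bwd.IH] show ?case
    by (simp add: algebra_simps)
qed

lemma conn_closed:
  assumes "conn G x y s" "x \<in> X" "\<And>u v g. (u, v, g) \<in> G \<Longrightarrow> u \<in> X \<longleftrightarrow> v \<in> X"
  shows "y \<in> X"
  using assms(1,2) by (induction rule: conn.induct) (use assms(3) in blast)+

text \<open>Substitution principle: \<open>H\<close> may have further points, but on the image of
  \<open>X\<close> it induces the same gain relation as \<open>G\<close>, and the surrounding edges
  \<open>D\<close> attach only there. Cut at its edges from \<open>D'\<close>, a walk in the larger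
  graph falls into stretches of \<open>H\<close> whose ends lie in that image.\<close>

lemma conn_subst:
  assumes iff: "\<And>x x' s. x \<in> X \<Longrightarrow> x' \<in> X \<Longrightarrow> conn G x x' s \<longleftrightarrow> conn H (\<phi> x) (\<phi> x') s"
    and D: "\<And>x x' g. (x, x', g) \<in> D \<Longrightarrow> x \<in> X \<and> x' \<in> X"
    and D': "D' = (\<lambda>(x, x', g). (\<phi> x, \<phi> x', g)) ` D"
    and G: "\<And>u v g. (u, v, g) \<in> G \<Longrightarrow> u \<in> X \<and> v \<in> X"
    and x: "x \<in> X" "x' \<in> X"
  shows "conn (G \<union> D) x x' s \<longleftrightarrow> conn (H \<union> D') (\<phi> x) (\<phi> x') s"
proof
  assume "conn (G \<union> D) x x' s"
  moreover have "conn (H \<union> D') (\<phi> u) (\<phi> v) (g + 0 - 0)" if "(u, v, g) \<in> G \<union> D" for u v g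
  proof (cases "(u, v, g) \<in> D")
    case True
    then have "(\<phi> u, \<phi> v, g) \<in> D'" unfolding D' by force
    then show ?thesis by (simp add: conn_edge)
  next
    case False
    then have "conn H (\<phi> u) (\<phi> v) g" using that iff[of u v g] G by (auto intro: conn_edge)
    then show ?thesis by (auto intro: conn_mono)
  qed
  ultimately show "conn (H \<union> D') (\<phi> x) (\<phi> x') s"
    using conn_map[of "G \<union> D" x x' s "H \<union> D'" \<phi> "\<lambda>_. 0"] by simp
next
  \<comment> \<open>Invariant: everything up to the last edge from \<open>D'\<close> has been
    lifted; the pending stretch in \<open>H\<close> is lifted only when the next such edge shows
    that it ends in the image of \<open>X\<close>.\<close>
  have aux: "\<exists>u\<in>X. \<exists>s1 s2. conn (G \<union> D) x u s1 \<and> conn H (\<phi> u) y s2 \<and> s = s1 + s2"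
    if "conn (H \<union> D') (\<phi> x) y s" for y s
    using that
  proof (induction "\<phi> x" y s rule: conn.induct)
    case conn_refl
    then show ?case
      using x(1) by (intro bexI[of _ x] exI[of _ 0] conjI conn.conn_refl) auto
  next
    case (conn_fwd y s z g)
    then obtain u s1 s2 where u: "u \<in> X" "conn (G \<union> D) x u s1" "conn H (\<phi> u) y s2" "s = s1 + s2"
      by auto
    show ?case
    proof (cases "(y, z, g) \<in> H")
      case True
      then show ?thesis using u conn.conn_fwd[OF u(3) True] by (metis add.assoc)
    next
      case False
      then obtain v v' where v: "(v, v', g) \<in> D" "y = \<phi> v" "z = \<phi> v'"
        using conn_fwd by (auto simp: D')
      then have "conn G u v s2" using iff D u by blast
      then have "conn (G \<union> D) x v' (s1 + s2 + g)"
        using conn_trans[OF conn_mono[of G u v s2 "G \<union> D"] u(2)] conn.conn_fwd[of "G \<union> D"] v(1) by blast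
      then show ?thesis using D[OF v(1)] v u conn.conn_refl[of H "\<phi> v'"] by force
    qed
  next
    case (conn_bwd y s z g)
    then obtain u s1 s2 where u: "u \<in> X" "conn (G \<union> D) x u s1" "conn H (\<phi> u) y s2" "s = s1 + s2"
      by auto
    show ?case
    proof (cases "(z, y, g) \<in> H")
      case True
      then show ?thesis using u conn.conn_bwd[OF u(3) True] by (metis add_diff_eq)
    next
      case False
      then obtain v v' where v: "(v', v, g) \<in> D" "y = \<phi> v" "z = \<phi> v'"
        using conn_bwd by (auto simp: D')
      then have "conn G u v s2" using iff D u by blast
      then have "conn (G \<union> D) x v' (s1 + s2 - g)"
        using conn_trans[OF conn_mono[of G u v s2 "G \<union> D"] u(2)] conn.conn_bwd[of "G \<union> D"] v(1) by blast
      then show ?thesis using D[OF v(1)] v u conn.conn_refl[of H "\<phi> v'"] by force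
    qed
  qed
  assume "conn (H \<union> D') (\<phi> x) (\<phi> x') s"
  from aux[OF this] obtain u s1 s2 where u: "u \<in> X" "conn (G \<union> D) x u s1"
    "conn H (\<phi> u) (\<phi> x') s2" "s = s1 + s2" by auto
  then have "conn G u x' s2" using iff x by blast
  then show "conn (G \<union> D) x x' s"
    using conn_trans[OF conn_mono[of G u x' s2 "G \<union> D"] u(2)] u(4) by blast
qed

text \<open>A retraction \<open>\<psi>\<close> up to the potential \<open>\<delta>\<close> shows that a gain-preserving map is full.\<close>

lemma conn_retract:
  assumes G: "\<And>u v g. (u, v, g) \<in> G \<Longrightarrow> conn H (\<phi> u) (\<phi> v) g"
    and H: "\<And>u v g. (u, v, g) \<in> H \<Longrightarrow> conn G (\<psi> u) (\<psi> v) (g + \<delta> v - \<delta> u)"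
    and x: "\<psi> (\<phi> x) = x" "\<psi> (\<phi> x') = x'" "\<delta> (\<phi> x) = 0" "\<delta> (\<phi> x') = 0"
  shows "conn G x x' s \<longleftrightarrow> conn H (\<phi> x) (\<phi> x') s"
proof
  assume "conn G x x' s"
  then show "conn H (\<phi> x) (\<phi> x') s"
    using conn_map[of G x x' s H \<phi> "\<lambda>_. 0"] G by simp
next
  assume "conn H (\<phi> x) (\<phi> x') s"
  from conn_map[of H _ _ s G \<psi> \<delta>, OF this H] show "conn G x x' s"
    by (simp add: x)
qed

lemma component_refl: "x \<in> component G x"
  unfolding component_def using conn_refl by fast

lemma component_cong: "conn G x y s \<Longrightarrow> component G x = component G y"
proof -
  assume xy: "conn G x y s"
  have "conn G y z (- s + t)" if "conn G x z t" for z t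
    using conn_trans[OF that conn_sym[OF xy]] .
  moreover have "conn G x z (s + t)" if "conn G y z t" for z t
    using conn_trans[OF that xy] .
  ultimately show ?thesis unfolding component_def by blast
qed

lemma component_eq_iff: "component G x = component G y \<longleftrightarrow> (\<exists>s. conn G x y s)"
proof
  assume "component G x = component G y"
  then have "y \<in> component G x" using component_refl[of y G] by simp
  then show "\<exists>s. conn G x y s" by (simp add: component_def)
next
  assume "\<exists>s. conn G x y s"
  then obtain s where "conn G x y s" ..
  then show "component G x = component G y" by (rule component_cong)
qed

lemma component_eqI: "y \<in> component G x \<Longrightarrow> component G y = component G x"
proof -
  assume "y \<in> component G x"
  then obtain s where "conn G x y s" unfolding component_def mem_Collect_eq ..
  then show "component G y = component G x" using component_cong by metis
qed

text \<open>Moving a closed walk to another base point conjugates it, which does not change the gain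
  in a commutative group, so one base point sees every gain of the component.\<close>

lemma holonomy_component: "holonomy G (component G x) = Gcd {s. conn G x x s}"
proof -
  have "conn G x x s" if "y \<in> component G x" "conn G y y s" for y s
  proof -
    from that(1) obtain t where t: "conn G x y t" by (auto simp: component_def)
    from conn_trans[OF conn_sym[OF t] conn_trans[OF that(2) t]] show ?thesis by simp
  qed
  then have "{s. \<exists>y\<in>component G x. conn G y y s} = {s. conn G x x s}"
    using component_refl by fast
  then show ?thesis by (simp add: holonomy_def)
qed

section \<open>Loop products under change of graph\<close>

lemma loop_prod_cong:
  assumes "\<And>K. K \<in> component G ` X \<and> K \<inter> B = {} \<longleftrightarrow> K \<in> component H ` X \<and> K \<inter> B = {}"
    and "\<And>x s. x \<in> X \<Longrightarrow> component G x \<inter> B = {} \<Longrightarrow> conn G x x s \<longleftrightarrow> conn H x x s"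
  shows "loop_prod G X B = loop_prod H X B"
  unfolding loop_prod_def
proof (rule prod.cong)
  show eq: "{K \<in> component G ` X. K \<inter> B = {}} = {K \<in> component H ` X. K \<inter> B = {}}"
    using assms(1) by blast
  fix K assume K: "K \<in> {K \<in> component H ` X. K \<inter> B = {}}"
  then have "K \<in> {K \<in> component G ` X. K \<inter> B = {}}" by (simp only: eq)
  then obtain x where x: "x \<in> X" "K = component G x" "K \<inter> B = {}" by auto
  from K obtain x' where x': "K = component H x'" by auto
  have "K = component H x" using x x' component_refl[of x G] component_eqI[of x H x'] by simp
  then have "holonomy G K = Gcd {s. conn G x x s}" "holonomy H K = Gcd {s. conn H x x s}"
    using x(2) holonomy_component by metis+
  then show "loop_val (holonomy G K) = loop_val (holonomy H K)"
    using x assms(2)[of x] by simp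
qed

text \<open>A walk can use a new edge only after it has reached \<open>B\<close>, which never
  happens in a component disjoint from \<open>B\<close>.\<close>

lemma loop_prod_add_edges:
  assumes "\<And>u v g. (u, v, g) \<in> D \<Longrightarrow> u \<in> B \<and> v \<in> B"
  shows "loop_prod (G \<union> D) X B = loop_prod G X B"
proof -
  have mono: "conn G x y s \<Longrightarrow> conn (G \<union> D) x y s" for x y s by (auto intro: conn_mono)
  have aux: "conn G x y s" if "conn (G \<union> D) x y s" "component G x \<inter> B = {}" for x y s
    using that
  proof (induction rule: conn.induct)
    case (conn_fwd x y s z g)
    then have "y \<notin> B" by (auto simp: component_def)
    then show ?case using conn_fwd assms by (auto intro: conn.conn_fwd)
  next
    case (conn_bwd x y s z g)
    then have "y \<notin> B" by (auto simp: component_def)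
    then show ?case using conn_bwd assms by (auto intro: conn.conn_bwd)
  qed (rule conn_refl)
  have iff: "conn (G \<union> D) x y s \<longleftrightarrow> conn G x y s" if "component G x \<inter> B = {}" for x y s
    using aux mono that by blast
  have comp: "component (G \<union> D) x = component G x" if "component G x \<inter> B = {}" for x
    using iff that by (simp add: component_def)
  have sub: "component G x \<subseteq> component (G \<union> D) x" for x
    using mono by (auto simp: component_def)
  have comp': "component (G \<union> D) x = component G x" if "component (G \<union> D) x \<inter> B = {}" for x
    using that comp[of x] sub[of x] by blast
  show ?thesis
  proof (rule loop_prod_cong)
    show "K \<in> component (G \<union> D) ` X \<and> K \<inter> B = {} \<longleftrightarrow> K \<in> component G ` X \<and> K \<inter> B = {}" for K
      using comp comp' by (smt (verit, best) image_iff)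
    show "conn (G \<union> D) x x s \<longleftrightarrow> conn G x x s" if "component (G \<union> D) x \<inter> B = {}" for x s
      using iff comp' that by metis
  qed
qed

text \<open>A component of \<open>H\<close> avoiding the image of \<open>B\<close> either avoids the
  image of \<open>X\<close> as well, being a loop closed inside \<open>H\<close>, or meets it and
  corresponds to exactly one component of \<open>G\<close>, with the same holonomy. This
  multiplicativity is the common source of associativity and of the formula for the trace of a
  product.\<close>

lemma loop_prod_full:
  assumes iff: "\<And>x x' s. x \<in> X \<Longrightarrow> x' \<in> X \<Longrightarrow> conn G x x' s \<longleftrightarrow> conn H (\<phi> x) (\<phi> x') s"
    and X: "\<phi> ` X \<subseteq> Y" and B: "B \<subseteq> X" and fin: "finite Y"
    and G: "\<And>u v g. (u, v, g) \<in> G \<Longrightarrow> u \<in> X \<and> v \<in> X"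
  shows "loop_prod H Y (\<phi> ` B) = loop_prod H Y (\<phi> ` X) * loop_prod G X B"
proof -
  define P where "P = {K \<in> component H ` Y. K \<inter> \<phi> ` X = {}}"
  define Q where "Q = {K \<in> (\<lambda>x. component H (\<phi> x)) ` X. K \<inter> \<phi> ` B = {}}"
  define R where "R = {K \<in> component G ` X. K \<inter> B = {}}"
  \<comment> \<open>The inverse of the passage from components of \<open>G\<close> to components of
    \<open>H\<close>: any point of \<open>X\<close> lying over the component may be chosen, since by
    \<open>iff\<close> all choices are joined in \<open>G\<close>.\<close>
  define \<kappa> where "\<kappa> L = component G (SOME x. x \<in> X \<and> \<phi> x \<in> L)" for L
  have "{K \<in> component H ` Y. K \<inter> \<phi> ` B = {}} = P \<union> Q"
  proof
    show "{K \<in> component H ` Y. K \<inter> \<phi> ` B = {}} \<subseteq> P \<union> Q"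
    proof
      fix K assume K: "K \<in> {K \<in> component H ` Y. K \<inter> \<phi> ` B = {}}"
      then obtain y where y: "y \<in> Y" "K = component H y" by blast
      show "K \<in> P \<union> Q"
      proof (cases "K \<inter> \<phi> ` X = {}")
        case True
        then show ?thesis using K by (auto simp: P_def)
      next
        case False
        then obtain x where "x \<in> X" "\<phi> x \<in> K" by blast
        then show ?thesis using K y component_eqI[of "\<phi> x" H y] by (auto simp: Q_def)
      qed
    qed
    show "P \<union> Q \<subseteq> {K \<in> component H ` Y. K \<inter> \<phi> ` B = {}}"
      using X B by (auto simp: P_def Q_def)
  qed
  moreover have "finite P"
    using fin unfolding P_def by simp
  moreover have "finite Q"
  proof (rule finite_subset)
    show "Q \<subseteq> component H ` (\<phi> ` X)" unfolding Q_def by auto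
    show "finite (component H ` (\<phi> ` X))" using finite_subset[OF X fin] by simp
  qed
  moreover have "P \<inter> Q = {}"
    using component_refl unfolding P_def Q_def by fast
  ultimately have split: "loop_prod H Y (\<phi> ` B) = loop_prod H Y (\<phi> ` X) * (\<Prod>K\<in>Q. loop_val (holonomy H K))"
    unfolding loop_prod_def P_def[symmetric] by (simp add: prod.union_disjoint)
  have \<kappa>: "\<kappa> (component H (\<phi> x)) = component G x" if "x \<in> X" for x
  proof -
    let ?u = "SOME u. u \<in> X \<and> \<phi> u \<in> component H (\<phi> x)"
    have u: "?u \<in> X \<and> \<phi> ?u \<in> component H (\<phi> x)"
      by (rule someI[of _ x]) (use that component_refl in fast)
    from u obtain s where "conn H (\<phi> x) (\<phi> ?u) s" unfolding component_def by blast
    then have "conn G x ?u s" using iff that u by blast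
    then show ?thesis unfolding \<kappa>_def using component_cong by metis
  qed
  have meets: "component H (\<phi> x) \<inter> \<phi> ` B = {} \<longleftrightarrow> component G x \<inter> B = {}" if "x \<in> X" for x
    using iff[OF that] B unfolding component_def by blast
  have bij: "bij_betw \<kappa> Q R"
  proof (rule bij_betw_imageI)
    show "inj_on \<kappa> Q"
    proof (rule inj_onI)
      fix K L assume "K \<in> Q" "L \<in> Q" and eq: "\<kappa> K = \<kappa> L"
      then obtain x y where xy: "x \<in> X" "y \<in> X" "K = component H (\<phi> x)" "L = component H (\<phi> y)"
        by (auto simp: Q_def)
      then have "component G x = component G y" using eq \<kappa> by simp
      then have "\<exists>s. conn G x y s" by (simp add: component_eq_iff)
      then show "K = L" using xy iff component_cong by metis
    qed
    have "Q = (\<lambda>x. component H (\<phi> x)) ` {x \<in> X. component G x \<inter> B = {}}"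
      using meets unfolding Q_def by blast
    moreover have "R = component G ` {x \<in> X. component G x \<inter> B = {}}"
      unfolding R_def by blast
    ultimately show "\<kappa> ` Q = R"
      using \<kappa> by (simp add: image_image)
  qed
  have "(\<Prod>K\<in>Q. loop_val (holonomy H K)) = (\<Prod>K\<in>Q. loop_val (holonomy G (\<kappa> K)))"
    by (rule prod.cong) (auto simp: Q_def \<kappa> holonomy_component iff)
  also have "\<dots> = (\<Prod>K\<in>R. loop_val (holonomy G K))"
    by (rule prod.reindex_bij_betw[OF bij])
  finally show ?thesis using split by (simp add: loop_prod_def R_def)
qed

lemma loop_prod_eq_1:
  assumes "\<And>x. x \<in> X \<Longrightarrow> \<exists>b\<in>B. \<exists>s. conn G x b s"
  shows "loop_prod G X B = 1"
proof -
  have "{K \<in> component G ` X. K \<inter> B = {}} = {}"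
    using assms unfolding component_def by blast
  then show ?thesis unfolding loop_prod_def by (simp only: prod.empty)
qed

text \<open>The case of \<open>loop_prod_full\<close> with trivial first factor: no component of
  \<open>H\<close> is invisible from \<open>X\<close>.\<close>

lemma loop_prod_equiv:
  assumes "\<And>x x' s. x \<in> X \<Longrightarrow> x' \<in> X \<Longrightarrow> conn G x x' s \<longleftrightarrow> conn H (\<phi> x) (\<phi> x') s"
    and "\<phi> ` X \<subseteq> Y" "finite Y"
    and "\<And>u v g. (u, v, g) \<in> G \<Longrightarrow> u \<in> X \<and> v \<in> X"
    and "\<And>y. y \<in> Y \<Longrightarrow> \<exists>x\<in>X. \<exists>s. conn H y (\<phi> x) s"
    and B: "B \<subseteq> X"
  shows "loop_prod H Y (\<phi> ` B) = loop_prod G X B"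
proof -
  have "loop_prod H Y (\<phi> ` B) = loop_prod H Y (\<phi> ` X) * loop_prod G X B"
    by (rule loop_prod_full) (use assms in auto)
  also have "loop_prod H Y (\<phi> ` X) = 1"
    by (rule loop_prod_eq_1) (use assms in auto)
  finally show ?thesis by simp
qed

section \<open>Strands glued end to end\<close>

text \<open>Each point \<open>x\<close> of \<open>X\<close> is joined to \<open>m x\<close> by a strand of gain \<open>w x\<close>, and the points of \<open>C\<close> are
  glued in pairs by \<open>c\<close>; the points of \<open>X - C\<close> are free ends.\<close>

locale strand_system =
  fixes X :: "'a set" and m c :: "'a \<Rightarrow> 'a" and w :: "'a \<Rightarrow> int" and C :: "'a set"
  assumes finite_X: "finite X"
    and m_in: "x \<in> X \<Longrightarrow> m x \<in> X"
    and m_m: "x \<in> X \<Longrightarrow> m (m x) = x"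
    and m_neq: "x \<in> X \<Longrightarrow> m x \<noteq> x"
    and w_m: "x \<in> X \<Longrightarrow> w (m x) = - w x"
    and C_sub: "C \<subseteq> X"
    and c_in: "x \<in> C \<Longrightarrow> c x \<in> C"
    and c_c: "x \<in> C \<Longrightarrow> c (c x) = x"
    and c_neq: "x \<in> C \<Longrightarrow> c x \<noteq> x"
begin

definition graph :: "('a \<times> 'a \<times> int) set" where
  "graph = {(x, m x, w x) | x. x \<in> X} \<union> {(x, c x, 0) | x. x \<in> C}"

text \<open>One step follows a strand and then crosses the gluing at its far end. The value is
  meaningful only while \<open>alive\<close> holds, as \<open>c\<close> is arbitrary off
  \<open>C\<close>.\<close>

definition walk :: "'a \<Rightarrow> nat \<Rightarrow> 'a" where
  "walk x i = ((\<lambda>y. c (m y)) ^^ i) x"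

definition gain :: "'a \<Rightarrow> nat \<Rightarrow> int" where
  "gain x i = (\<Sum>j<i. w (walk x j))"

definition alive :: "'a \<Rightarrow> nat \<Rightarrow> bool" where
  "alive x i \<longleftrightarrow> x \<in> X \<and> (\<forall>j<i. m (walk x j) \<in> C)"

lemma walk_0 [simp]: "walk x 0 = x"
  by (simp add: walk_def)

lemma walk_Suc: "walk x (Suc i) = c (m (walk x i))"
  by (simp add: walk_def)

lemma gain_0 [simp]: "gain x 0 = 0"
  by (simp add: gain_def)

lemma gain_Suc: "gain x (Suc i) = gain x i + w (walk x i)"
  by (simp add: gain_def)

lemma alive_mono: "alive x i \<Longrightarrow> j \<le> i \<Longrightarrow> alive x j"
  by (simp add: alive_def)

lemma walk_in: "alive x i \<Longrightarrow> walk x i \<in> X"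
  by (cases i) (use c_in C_sub in \<open>auto simp: alive_def walk_Suc\<close>)

lemma walk_in_C: "alive x i \<Longrightarrow> 0 < i \<Longrightarrow> walk x i \<in> C"
  by (cases i) (use c_in C_sub in \<open>auto simp: alive_def walk_Suc\<close>)

lemma m_inj: "x \<in> X \<Longrightarrow> y \<in> X \<Longrightarrow> m x = m y \<Longrightarrow> x = y"
  using m_m by metis

lemma c_inj: "x \<in> C \<Longrightarrow> y \<in> C \<Longrightarrow> c x = c y \<Longrightarrow> x = y"
  using c_c by metis

text \<open>Peeling one strand off both ends of such a coincidence gives a shorter one, and the
  process would stop at a fixed point of \<open>m\<close> or of \<open>c\<close>. This is what keeps
  the two directions of traversal apart.\<close>

lemma walk_not_reversed:
  assumes "alive x j" "i \<le> j"
  shows "walk x j \<noteq> m (walk x i)"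
  using assms
proof (induction "j - i" arbitrary: i j rule: less_induct)
  case less
  show ?case
  proof
    assume eq: "walk x j = m (walk x i)"
    have i: "alive x i" and X: "walk x i \<in> X"
      using less.prems alive_mono walk_in by blast+
    then have "j \<noteq> i" using eq m_neq by metis
    then obtain j' where j': "j = Suc j'" "i \<le> j'" using less.prems(2) by (cases j) auto
    have "alive x j'" and aj: "alive x (Suc i)" using less.prems(1) j' by (auto intro: alive_mono)
    then have X': "walk x j' \<in> X" and C: "m (walk x j') \<in> C" "m (walk x i) \<in> C"
      using walk_in less.prems(1) j' by (auto simp: alive_def)
    have "c (m (walk x j')) = m (walk x i)" using eq j' by (simp add: walk_Suc)
    then have *: "m (walk x j') = walk x (Suc i)" using C c_c by (metis walk_Suc)
    show False
    proof (cases "j' = i")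
      case True
      then show False using * C(2) c_neq[OF C(2)] by (simp add: walk_Suc)
    next
      case False
      then have "Suc i \<le> j'" using j' by simp
      moreover have "walk x j' = m (walk x (Suc i))" using * X' m_m by metis
      ultimately show False using less.hyps[of j' "Suc i"] \<open>alive x j'\<close> j' by simp
    qed
  qed
qed

text \<open>Each step is injective, so a coincidence can be pushed back to the beginning of the
  walk.\<close>

lemma walk_shift:
  assumes "alive x (j + k)" "walk x j = walk x (j + k)"
  shows "walk x k = x"
  using assms
proof (induction j)
  case (Suc j)
  have a: "m (walk x j) \<in> C" "m (walk x (j + k)) \<in> C" using Suc.prems by (auto simp: alive_def)
  have "walk x j \<in> X" "walk x (j + k) \<in> X"
    using Suc.prems walk_in[of x] alive_mono[of x "Suc j + k"] by auto
  then have "walk x j = walk x (j + k)"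
    using Suc.prems a c_inj m_inj by (simp add: walk_Suc)
  then show ?case using Suc alive_mono[of x "Suc j + k" "j + k"] by simp
qed simp

lemma walk_returns:
  assumes "\<And>i. alive x i"
  obtains l where "0 < l" "walk x l = x"
proof -
  have "range (walk x) \<subseteq> X" using assms walk_in by blast
  then have "\<not> inj (walk x)" using finite_X finite_subset finite_imageD infinite_UNIV_nat by blast
  then obtain i j where ij: "i < j" "walk x i = walk x j"
    by (metis injI linorder_neq_iff)
  then have "walk x (j - i) = x" using walk_shift[of x i "j - i"] assms by simp
  then show thesis using ij that[of "j - i"] by simp
qed

text \<open>An endless walk would return to \<open>x\<close> by finiteness, but every later point of
  a walk lies in \<open>C\<close>.\<close>

lemma walk_exits:
  assumes "x \<in> X - C"
  obtains l where "alive x l" "m (walk x l) \<in> X - C"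
proof (cases "\<forall>i. alive x i")
  case True
  then obtain l where "0 < l" "walk x l = x" using walk_returns by blast
  then have "x \<in> C" using walk_in_C[of x l] True by simp
  then show ?thesis using assms by simp
next
  case False
  define i where "i = (LEAST i. \<not> alive x i)"
  have i: "\<not> alive x i" using False unfolding i_def by (metis LeastI)
  have "i \<noteq> 0" using i assms by (auto simp: alive_def)
  then obtain l where l: "i = Suc l" by (cases i) auto
  have "alive x l" using not_less_Least[of l "\<lambda>i. \<not> alive x i"] l i_def by auto
  moreover have "m (walk x l) \<notin> C" using i l \<open>alive x l\<close> by (auto simp: alive_def less_Suc_eq)
  ultimately show ?thesis using that walk_in m_in by blast
qed

lemma graph_mem: "(u, v, g) \<in> graph \<longleftrightarrow> u \<in> X \<and> v = m u \<and> g = w u \<or> u \<in> C \<and> v = c u \<and> g = 0"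
  by (auto simp: graph_def)

lemma graph_in: "(u, v, g) \<in> graph \<Longrightarrow> u \<in> X \<and> v \<in> X"
  using m_in c_in C_sub by (auto simp: graph_mem)

lemma conn_in: "conn graph x y s \<Longrightarrow> x \<in> X \<Longrightarrow> y \<in> X"
  by (rule conn_closed) (use graph_in in blast)+

lemma component_sub: "x \<in> X \<Longrightarrow> component graph x \<subseteq> X"
  using conn_in by (auto simp: component_def)

lemma conn_m: "x \<in> X \<Longrightarrow> conn graph x (m x) (w x)"
  by (rule conn_edge) (simp add: graph_mem)

lemma conn_c: "x \<in> C \<Longrightarrow> conn graph x (c x) 0"
  by (rule conn_edge) (simp add: graph_mem)

text \<open>The graph contains the reverse of each edge with the opposite gain, because
  \<open>m\<close> and \<open>c\<close> are involutions. Backward steps are therefore forward steps,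
  and the induction principle below needs only two kinds of move.\<close>

lemma conn_cases:
  assumes "(u, v, g) \<in> graph \<and> h = g \<or> (v, u, g) \<in> graph \<and> h = - g"
  shows "u \<in> X \<and> v = m u \<and> h = w u \<or> u \<in> C \<and> v = c u \<and> h = 0"
  using assms m_m c_c w_m m_in c_in by (auto simp: graph_mem)

lemma conn_graph_induct [consumes 1, case_names refl m c]:
  assumes "conn graph x y s" "P x 0"
    and "\<And>y s. conn graph x y s \<Longrightarrow> P y s \<Longrightarrow> y \<in> X \<Longrightarrow> P (m y) (s + w y)"
    and "\<And>y s. conn graph x y s \<Longrightarrow> P y s \<Longrightarrow> y \<in> C \<Longrightarrow> P (c y) s"
  shows "P y s"
  using assms(1)
proof (induction x\<equiv>x y s rule: conn.induct)
  case conn_refl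
  then show ?case using assms(2) by simp
next
  case (conn_fwd y s z g)
  then show ?case using conn_cases[of y z g g] assms(3)[of y s] assms(4)[of y s] by auto
next
  case (conn_bwd y s z g)
  then have "y \<in> X \<and> z = m y \<and> s - g = s + w y \<or> y \<in> C \<and> z = c y \<and> s - g = s"
    using conn_cases[of y z g "- g"] by auto
  then show ?case using conn_bwd assms(3)[of y s] assms(4)[of y s] by metis
qed

lemma conn_walk: "alive x i \<Longrightarrow> conn graph x (walk x i) (gain x i)"
proof (induction i)
  case 0
  then show ?case using conn_refl by simp
next
  case (Suc i)
  then have a: "alive x i" and C: "m (walk x i) \<in> C" by (auto simp: alive_def)
  from conn_trans[OF conn_m[OF walk_in[OF a]] Suc.IH[OF a]]
  have "conn graph x (m (walk x i)) (gain x (Suc i))" by (simp add: gain_Suc)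
  from conn_trans[OF conn_c[OF C] this] show ?case by (simp add: walk_Suc)
qed

lemma conn_walk_m: "alive x i \<Longrightarrow> conn graph x (m (walk x i)) (gain x (Suc i))"
  using conn_trans[OF conn_m[OF walk_in] conn_walk, of x i] by (simp add: gain_Suc)

text \<open>Whatever is joined to a free end is a point of its walk or the mate of one, with the
  gain fixed by the position. Of these points only the two extremes are free.\<close>

lemma conn_arc:
  assumes x: "x \<in> X - C" and l: "alive x l" "m (walk x l) \<in> X - C"
    and "conn graph x y s" "y \<in> X - C"
  shows "y = x \<and> s = 0 \<or> y = m (walk x l) \<and> s = gain x (Suc l)"
proof -
  have "\<exists>i\<le>l. y = walk x i \<and> s = gain x i \<or> y = m (walk x i) \<and> s = gain x (Suc i)"
    using assms(4)
  proof (induction rule: conn_graph_induct)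
    case refl
    then show ?case by (intro exI[of _ 0]) simp
  next
    case (m y s)
    then obtain i where i: "i \<le> l" "y = walk x i \<and> s = gain x i \<or> y = m (walk x i) \<and> s = gain x (Suc i)"
      by blast
    then have "walk x i \<in> X" using l alive_mono walk_in by blast
    then show ?case using i m_m w_m by (intro exI[of _ i]) (auto simp: gain_Suc)
  next
    case (c y s)
    then obtain i where i: "i \<le> l" "y = walk x i \<and> s = gain x i \<or> y = m (walk x i) \<and> s = gain x (Suc i)"
      by blast
    from i(2) show ?case
    proof
      assume y: "y = walk x i \<and> s = gain x i"
      then have "i \<noteq> 0" using c x by (cases i) auto
      then obtain j where j: "i = Suc j" by (cases i) auto
      then have "m (walk x j) \<in> C" using l i by (auto simp: alive_def)
      then have "c y = m (walk x j)" using y j c_c by (simp add: walk_Suc)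
      then show ?case using j i y by (intro exI[of _ j]) simp
    next
      assume y: "y = m (walk x i) \<and> s = gain x (Suc i)"
      then have "i \<noteq> l" using c l by auto
      then show ?case using y i by (intro exI[of _ "Suc i"]) (simp add: walk_Suc)
    qed
  qed
  then obtain i where i: "i \<le> l" "y = walk x i \<and> s = gain x i \<or> y = m (walk x i) \<and> s = gain x (Suc i)"
    by blast
  from i(2) show ?thesis
  proof
    assume "y = walk x i \<and> s = gain x i"
    moreover from this have "i = 0" using walk_in_C alive_mono[OF l(1)] i assms(5) by fastforce
    ultimately show ?thesis by simp
  next
    assume y: "y = m (walk x i) \<and> s = gain x (Suc i)"
    then have "i = l" using l assms(5) i(1) by (auto simp: alive_def) (metis le_neq_implies_less)
    then show ?thesis using y by simp
  qed
qed

text \<open>On a closed loop the position determines the gain only up to full turns;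
  \<open>k\<close> counts them with sign.\<close>

lemma conn_cycle:
  assumes l: "alive x l" "0 < l" "walk x l = x" and "conn graph x y s"
  shows "\<exists>i<l. \<exists>k. y = walk x i \<and> s = gain x i + k * gain x l \<or>
                   y = m (walk x i) \<and> s = gain x (Suc i) + k * gain x l"
  using assms(4)
proof (induction rule: conn_graph_induct)
  case refl
  then show ?case using l(2) by (intro exI[of _ 0] conjI) auto
next
  case (m y s)
  then obtain i k where i: "i < l" "y = walk x i \<and> s = gain x i + k * gain x l \<or>
      y = m (walk x i) \<and> s = gain x (Suc i) + k * gain x l"
    by blast
  then have "walk x i \<in> X" using l(1) alive_mono[of x l i] walk_in by simp
  then show ?case using i m_m w_m
    by (intro exI[of _ i] conjI exI[of _ k]) (auto simp: gain_Suc)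
next
  case (c y s)
  then obtain i k where i: "i < l" and cases: "y = walk x i \<and> s = gain x i + k * gain x l \<or>
      y = m (walk x i) \<and> s = gain x (Suc i) + k * gain x l"
    by blast
  from cases show ?case
  proof
    assume y: "y = walk x i \<and> s = gain x i + k * gain x l"
    show ?case
    proof (cases i)
      case (Suc j)
      then have "m (walk x j) \<in> C" using l(1) i by (auto simp: alive_def)
      then have "c y = m (walk x j)" using y Suc c_c by (simp add: walk_Suc)
      then show ?thesis using Suc i y by (intro exI[of _ j] conjI exI[of _ k]) auto
    next
      case 0
      \<comment> \<open>The move goes back across the starting point, so that one full turn is
        subtracted.\<close>
      obtain j where j: "l = Suc j" using l(2) by (cases l) auto
      then have "m (walk x j) \<in> C" using l(1) by (auto simp: alive_def)
      moreover have "y = c (m (walk x j))" using y l(3) 0 j by (simp add: walk_Suc)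
      ultimately have "c y = m (walk x j)" using c_c by simp
      then show ?thesis using y 0 j
        by (intro exI[of _ j] conjI exI[of _ "k - 1"]) (auto simp: algebra_simps)
    qed
  next
    assume y: "y = m (walk x i) \<and> s = gain x (Suc i) + k * gain x l"
    show ?case
    proof (cases "Suc i = l")
      case True
      then have "c y = x" using y l(3) by (simp flip: walk_Suc)
      then show ?thesis using y True l(2)
        by (intro exI[of _ 0] conjI exI[of _ "k + 1"]) (auto simp: algebra_simps)
    next
      case False
      then show ?thesis using y i
        by (intro exI[of _ "Suc i"] conjI exI[of _ k]) (auto simp: walk_Suc)
    qed
  qed
qed

text \<open>By \<open>conn_cycle\<close> a closed walk at \<open>x\<close> has made full turns,
  unless \<open>x\<close> were the mate of a point of its own walk, and that is excluded by
  \<open>walk_not_reversed\<close>.\<close>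

lemma holonomy_cycle:
  assumes l: "alive x l" "0 < l" "walk x l = x" and first: "\<And>i. 0 < i \<Longrightarrow> i < l \<Longrightarrow> walk x i \<noteq> x"
  shows "holonomy graph (component graph x) = \<bar>gain x l\<bar>"
proof -
  have "gain x l dvd s" if s: "conn graph x x s" for s
  proof -
    obtain i k where i: "i < l" and cases: "x = walk x i \<and> s = gain x i + k * gain x l \<or>
        x = m (walk x i) \<and> s = gain x (Suc i) + k * gain x l"
      using conn_cycle[OF l s] by blast
    from cases show ?thesis
    proof
      assume x: "x = walk x i \<and> s = gain x i + k * gain x l"
      then have "i = 0" using first[of i] i by (metis gr0I)
      then show ?thesis using x by simp
    next
      assume x: "x = m (walk x i) \<and> s = gain x (Suc i) + k * gain x l"
      have "walk x i \<in> X" using l(1) alive_mono[of x l i] walk_in i by simp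
      then have "walk x i = m (walk x 0)" using x m_m by (metis walk_0)
      then show ?thesis using walk_not_reversed[of x i 0] alive_mono[OF l(1)] i by simp
    qed
  qed
  moreover have "conn graph x x (gain x l)" using conn_walk[OF l(1)] l(3) by simp
  ultimately have "Gcd {s. conn graph x x s} = normalize (gain x l)"
    by (intro Gcd_eqI) auto
  then show ?thesis by (simp add: holonomy_component)
qed

lemma closed_component_returns:
  assumes "x \<in> X" "component graph x \<inter> (X - C) = {}"
  obtains l where "alive x l" "0 < l" "walk x l = x" "\<And>i. 0 < i \<Longrightarrow> i < l \<Longrightarrow> walk x i \<noteq> x"
proof -
  have alive: "alive x i" for i
  proof (induction i)
    case (Suc i)
    have "m (walk x i) \<in> component graph x"
      using conn_walk_m[OF Suc] by (auto simp: component_def)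
    then have "m (walk x i) \<in> C" using assms component_sub by blast
    then show ?case using Suc by (auto simp: alive_def less_Suc_eq)
  qed (simp add: alive_def assms)
  then obtain l where l: "0 < l" "walk x l = x" using walk_returns by blast
  define k where "k = (LEAST l. 0 < l \<and> walk x l = x)"
  have "0 < k \<and> walk x k = x" unfolding k_def by (rule LeastI[of _ l]) (use l in simp)
  moreover have "walk x i \<noteq> x" if "0 < i" "i < k" for i
    using not_less_Least[of i "\<lambda>l. 0 < l \<and> walk x l = x"] that by (auto simp: k_def)
  ultimately show thesis using that alive by blast
qed

end

text \<open>Each closed loop contains exactly two points of minimal key, glued to each other, and exactly
  one of them is a starting point.\<close>

locale based_strand_system = strand_system +
  fixes key :: "'a \<Rightarrow> nat" and start :: "'a \<Rightarrow> bool"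
  assumes key_c: "x \<in> C \<Longrightarrow> key (c x) = key x"
    and start_c: "x \<in> C \<Longrightarrow> start (c x) \<longleftrightarrow> \<not> start x"
    and key_inj: "x \<in> C \<Longrightarrow> y \<in> C \<Longrightarrow> key x = key y \<Longrightarrow> y = x \<or> y = c x"
begin

text \<open>The pattern shared by \<open>is_cycle\<close> and \<open>is_closure_cycle\<close>: a
  loop is recorded by its prescribed starting point and its length.\<close>

definition based_cycles :: "('a \<times> nat) set" where
  "based_cycles = {(x, l). x \<in> C \<and> start x \<and> 0 < l \<and> alive x l \<and> walk x l = x \<and>
     (\<forall>i. 0 < i \<longrightarrow> i < l \<longrightarrow> key x < key (walk x i))}"

lemma based_cycleD:
  assumes "(x, l) \<in> based_cycles"
  shows "x \<in> C" "start x" "0 < l" "alive x l" "walk x l = x"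
    "\<And>i. 0 < i \<Longrightarrow> i < l \<Longrightarrow> key x < key (walk x i)"
  using assms by (auto simp: based_cycles_def)

lemma based_cycle_first:
  assumes "(x, l) \<in> based_cycles" "0 < i" "i < l"
  shows "walk x i \<noteq> x"
  using based_cycleD(6)[OF assms] by auto

text \<open>The bound on the walk also bounds the mates: gluing preserves keys, so a mate has the
  key of the next point of the walk.\<close>

lemma based_cycle_key_min:
  assumes "(x, l) \<in> based_cycles" "y \<in> component graph x"
  shows "y \<in> C \<and> key x \<le> key y"
proof -
  note l = based_cycleD(1,3,4,5)[OF assms(1)] and key = based_cycleD(6)[OF assms(1)]
  have key': "walk x i \<in> C \<and> key x \<le> key (walk x i)" if "i \<le> l" for i
  proof (cases "i = 0 \<or> i = l")
    case False
    then have "0 < i" "i < l" using that by auto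
    then show ?thesis using key[of i] walk_in_C[of x i] alive_mono[OF l(3), of i] by simp
  qed (use l in auto)
  obtain s where "conn graph x y s" using assms(2) by (auto simp: component_def)
  from conn_cycle[OF l(3,2,4) this] obtain i where i: "i < l" "y = walk x i \<or> y = m (walk x i)" by blast
  have "m (walk x i) \<in> C" using l(3) i(1) by (simp add: alive_def)
  moreover have "key (m (walk x i)) = key (walk x (Suc i))" using calculation key_c by (simp add: walk_Suc)
  ultimately show ?thesis using i key'[of i] key'[of "Suc i"] by auto
qed

text \<open>In a closed component the minimal key belongs to a single glued pair, one member of
  which is a start, and the first return to that member fixes the length.\<close>

lemma bij_based_cycles:
  "bij_betw (\<lambda>(x, l). component graph x) based_cycles {K \<in> component graph ` X. K \<inter> (X - C) = {}}"
proof (rule bij_betw_imageI)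
  show "inj_on (\<lambda>(x, l). component graph x) based_cycles"
  proof (rule inj_onI, clarify)
    fix x l x' l'
    assume x: "(x, l) \<in> based_cycles" and x': "(x', l') \<in> based_cycles"
      and eq: "component graph x = component graph x'"
    have "key x = key x'"
      using based_cycle_key_min[OF x, of x'] based_cycle_key_min[OF x', of x] eq
        component_refl[of x graph] component_refl[of x' graph] by simp
    then have xx: "x = x'" using x x' key_inj[of x x'] start_c[of x] based_cycleD(1,2) by metis
    have "\<not> l < l'" using based_cycleD[OF x] based_cycle_first[OF x', of l] xx by blast
    moreover have "\<not> l' < l" using based_cycleD[OF x'] based_cycle_first[OF x, of l'] xx by blast
    ultimately show "x = x' \<and> l = l'" using xx by simp
  qed
  show "(\<lambda>(x, l). component graph x) ` based_cycles = {K \<in> component graph ` X. K \<inter> (X - C) = {}}"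
  proof (intro equalityI subsetI)
    fix K assume "K \<in> (\<lambda>(x, l). component graph x) ` based_cycles"
    then obtain x l where x: "(x, l) \<in> based_cycles" "K = component graph x" by auto
    then have "x \<in> X" using C_sub based_cycleD(1) by blast
    then show "K \<in> {K \<in> component graph ` X. K \<inter> (X - C) = {}}"
      using x based_cycle_key_min by blast
  next
    fix K assume "K \<in> {K \<in> component graph ` X. K \<inter> (X - C) = {}}"
    then obtain y where y: "y \<in> X" "K = component graph y" and K: "K \<inter> (X - C) = {}" by blast
    have KC: "K \<subseteq> C" using component_sub y K by blast
    define k where "k = (LEAST k. \<exists>z\<in>K. key z = k)"
    have "\<exists>z\<in>K. key z = key y" using y component_refl by fast
    then have "\<exists>z\<in>K. key z = k" unfolding k_def by (rule LeastI)
    then obtain z where z: "z \<in> K" "key z = k" by blast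
    have min: "k \<le> key u" if "u \<in> K" for u
      unfolding k_def by (rule Least_le) (use that in blast)
    have "c z \<in> component graph z" using conn_c z KC by (auto simp: component_def)
    then have "c z \<in> K" using z y component_eqI by metis
    moreover have "key (c z) = k" "start (c z) \<longleftrightarrow> \<not> start z" using z KC key_c start_c by auto
    ultimately obtain x where x: "x \<in> K" "key x = k" "start x" using z by metis
    have Kx: "K = component graph x" using x y component_eqI by metis
    have "x \<in> X" using KC C_sub x by blast
    then obtain l where l: "alive x l" "0 < l" "walk x l = x"
      and first: "\<And>i. 0 < i \<Longrightarrow> i < l \<Longrightarrow> walk x i \<noteq> x"
      using closed_component_returns K Kx by metis
    have "key x < key (walk x i)" if i: "0 < i" "i < l" for i
    proof (rule ccontr)
      assume nless: "\<not> key x < key (walk x i)"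
      have alive: "alive x i" using alive_mono[OF l(1)] i by simp
      have "walk x i \<in> K" using Kx conn_walk[OF alive] by (auto simp: component_def)
      then have "key x = key (walk x i)" "walk x i \<in> C" using min[of "walk x i"] x nless KC by auto
      \<comment> \<open>The minimal key could be met again only at \<open>c x\<close>, but then the
        walk would have arrived at \<open>x\<close> in the reverse direction.\<close>
      then have "walk x i = c x" using key_inj[of x "walk x i"] first[OF i] KC x by blast
      moreover obtain j where j: "i = Suc j" using i by (cases i) auto
      moreover have "m (walk x j) \<in> C" using alive j by (simp add: alive_def)
      ultimately have "m (walk x j) = x" using c_inj x KC by (simp add: walk_Suc subset_iff)
      moreover have "walk x j \<in> X" "alive x j" using alive j alive_mono[of x i j] walk_in by auto
      ultimately have "walk x j = m (walk x 0)" using m_m by (metis walk_0)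
      then show False using walk_not_reversed[of x j 0] \<open>alive x j\<close> by simp
    qed
    then have "(x, l) \<in> based_cycles" using x l KC by (auto simp: based_cycles_def)
    then show "K \<in> (\<lambda>(x, l). component graph x) ` based_cycles" using Kx by force
  qed
qed

lemma prod_based_cycles:
  "(\<Prod>(x, l)\<in>based_cycles. loop_val \<bar>gain x l\<bar>) = loop_prod graph X (X - C)"
proof -
  have hol: "holonomy graph (component graph x) = \<bar>gain x l\<bar>" if "(x, l) \<in> based_cycles" for x l
  proof (rule holonomy_cycle)
    show "walk x i \<noteq> x" if "0 < i" "i < l" for i
      using based_cycle_first[OF \<open>(x, l) \<in> based_cycles\<close> that] .
  qed (use based_cycleD[OF that] in auto)
  have "(\<Prod>(x, l)\<in>based_cycles. loop_val \<bar>gain x l\<bar>) =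
      (\<Prod>p\<in>based_cycles. loop_val (holonomy graph ((\<lambda>(x, l). component graph x) p)))"
    by (rule prod.cong) (auto simp: hol)
  also have "\<dots> = loop_prod graph X (X - C)"
    unfolding loop_prod_def by (rule prod.reindex_bij_betw[OF bij_based_cycles])
  finally show ?thesis .
qed

end

section \<open>Arrow tangles as gain graphs\<close>

text \<open>Cumulated parities only record whether a strand is traversed in the same vertical direction as
  the first one. Counting upward passages negatively absorbs them into an antisymmetric weight \<open>wt\<close>.\<close>

definition vsgn :: "vertex \<Rightarrow> int" where
  "vsgn x = (if fst x = 0 then 1 else - 1)"

text \<open>The two cases mirror those of \<open>cum_parity\<close>: for a strand traversed against
  the order its own parity is included, and this turns the sign of the source into minus the sign of
  the target. The result is antisymmetric by construction.\<close>

definition osgn :: "vertex \<Rightarrow> vertex \<Rightarrow> int" where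
  "osgn x y = (if vless x y then vsgn x else - vsgn y)"

definition mate :: "tangle \<Rightarrow> vertex \<Rightarrow> vertex" where
  "mate F x = (THE y. {x, y} \<in> fst F)"

definition wt :: "tangle \<Rightarrow> vertex \<Rightarrow> int" where
  "wt F x = osgn x (mate F x) * snd F {x, mate F x}"

definition flipv :: "vertex \<Rightarrow> vertex" where
  "flipv x = (1 - fst x, snd x)"

lemma vsgn_sq [simp]: "vsgn x * vsgn x = 1" "vsgn x * (vsgn x * a) = a"
  by (auto simp: vsgn_def)

lemma finite_Vset: "finite (Vset n)"
  by (simp add: Vset_def)

lemma Vset_cases: "x \<in> Vset n \<Longrightarrow> fst x = 0 \<or> fst x = 1"
  by (auto simp: Vset_def)

lemma mem_Vset: "(a, k) \<in> Vset n \<longleftrightarrow> (a = 0 \<or> a = 1) \<and> 1 \<le> k \<and> k \<le> n"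
  by (auto simp: Vset_def)

lemma vless_total: "x \<in> Vset n \<Longrightarrow> y \<in> Vset n \<Longrightarrow> x \<noteq> y \<Longrightarrow> vless x y \<longleftrightarrow> \<not> vless y x"
  by (cases x; cases y) (auto simp: vless_def Vset_def)

lemma flipv_in: "x \<in> Vset n \<Longrightarrow> flipv x \<in> Vset n"
  by (auto simp: Vset_def flipv_def)

lemma flipv_flipv: "x \<in> Vset n \<Longrightarrow> flipv (flipv x) = x"
  by (auto simp: Vset_def flipv_def)

lemma flipv_neq: "flipv x \<noteq> x"
proof -
  have "1 - fst x \<noteq> fst x" by presburger
  then show ?thesis by (metis flipv_def fst_conv)
qed

lemma osgn_swap: "x \<in> Vset n \<Longrightarrow> y \<in> Vset n \<Longrightarrow> x \<noteq> y \<Longrightarrow> osgn y x = - osgn x y"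
  using vless_total[of x n y] by (auto simp: osgn_def)

lemma odd_osgn [simp]: "odd (osgn x y)"
  by (simp add: osgn_def vsgn_def)

lemma arrow_tanglesD:
  assumes "F \<in> arrow_tangles n"
  shows "partition_on (Vset n) (fst F)" "\<And>e. e \<in> fst F \<Longrightarrow> card e = 2"
    "snd F \<in> extensional (fst F)"
    "\<And>x y. {x, y} \<in> fst F \<Longrightarrow> even (snd F {x, y}) \<longleftrightarrow> fst x \<noteq> fst y"
  using assms by (auto simp: arrow_tangles_def flat_tangles_def split: if_splits) metis+

lemma tangle_edge_unique:
  assumes "F \<in> arrow_tangles n" "{x, y} \<in> fst F" "{x, z} \<in> fst F"
  shows "y = z"
proof -
  have "{x, y} = {x, z}"
    using partition_onD2[OF arrow_tanglesD(1)[OF assms(1)]] assms(2,3) by (auto dest: disjointD)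
  then show ?thesis by (auto simp: doubleton_eq_iff)
qed

lemma tangle_edge_in:
  assumes "F \<in> arrow_tangles n" "{x, y} \<in> fst F"
  shows "x \<in> Vset n" "y \<in> Vset n" "x \<noteq> y"
proof -
  have "{x, y} \<subseteq> Vset n" using partition_onD1[OF arrow_tanglesD(1)[OF assms(1)]] assms(2) by blast
  moreover have "card {x, y} = 2" using arrow_tanglesD(2)[OF assms] .
  ultimately show "x \<in> Vset n" "y \<in> Vset n" "x \<noteq> y" by (auto simp: card_insert_if split: if_splits)
qed

lemma mate_eqI: "F \<in> arrow_tangles n \<Longrightarrow> {x, y} \<in> fst F \<Longrightarrow> mate F x = y"
  unfolding mate_def using tangle_edge_unique by (blast intro: the_equality)

lemma mate_edge:
  assumes "F \<in> arrow_tangles n" "x \<in> Vset n"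
  shows "{x, mate F x} \<in> fst F"
proof -
  obtain e where e: "e \<in> fst F" "x \<in> e"
    using partition_onD1[OF arrow_tanglesD(1)[OF assms(1)]] assms(2) by blast
  then obtain y where "e = {x, y}"
    using arrow_tanglesD(2)[OF assms(1) e(1)] by (auto simp: card_2_iff)
  then show ?thesis using e mate_eqI[OF assms(1)] by metis
qed

lemma mate_in: "F \<in> arrow_tangles n \<Longrightarrow> x \<in> Vset n \<Longrightarrow> mate F x \<in> Vset n"
  using mate_edge tangle_edge_in by blast

lemma mate_neq: "F \<in> arrow_tangles n \<Longrightarrow> x \<in> Vset n \<Longrightarrow> mate F x \<noteq> x"
  using mate_edge tangle_edge_in by metis

lemma mate_mate: "F \<in> arrow_tangles n \<Longrightarrow> x \<in> Vset n \<Longrightarrow> mate F (mate F x) = x"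
  using mate_edge mate_eqI by (metis insert_commute)

lemma wt_mate:
  assumes "F \<in> arrow_tangles n" "x \<in> Vset n"
  shows "wt F (mate F x) = - wt F x"
  using osgn_swap[OF assms(2) mate_in[OF assms]] mate_neq[OF assms] mate_mate[OF assms]
  by (simp add: wt_def insert_commute)

lemma even_wt: "F \<in> arrow_tangles n \<Longrightarrow> x \<in> Vset n \<Longrightarrow> even (wt F x) \<longleftrightarrow> fst x \<noteq> fst (mate F x)"
  using arrow_tanglesD(4) mate_edge by (simp add: wt_def)

lemma osgn_sq [simp]: "osgn x y * (osgn x y * a) = a"
  by (auto simp: osgn_def vsgn_def)

lemma tangle_edges:
  assumes "F \<in> arrow_tangles n"
  shows "fst F = {{x, mate F x} | x. x \<in> Vset n}"
proof -
  have "\<exists>x. e = {x, mate F x} \<and> x \<in> Vset n" if "e \<in> fst F" for e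
  proof -
    from arrow_tanglesD(2)[OF assms that] obtain x y where "e = {x, y}" by (auto simp: card_2_iff)
    then show ?thesis using \<open>e \<in> fst F\<close> mate_eqI[OF assms] tangle_edge_in(1)[OF assms] by metis
  qed
  then show ?thesis using mate_edge[OF assms] by blast
qed

text \<open>Signs are invertible, so labels can be recovered from weights; off the strands both
  label functions are extensional.\<close>

lemma tangle_eqI:
  assumes F: "F \<in> arrow_tangles n" and G: "G \<in> arrow_tangles n"
    and eq: "\<And>x. x \<in> Vset n \<Longrightarrow> mate F x = mate G x \<and> wt F x = wt G x"
  shows "F = G"
proof (rule prod_eqI)
  show fst: "fst F = fst G"
    unfolding tangle_edges[OF F] tangle_edges[OF G] by (rule Collect_cong) (use eq in metis)
  have "snd F e = snd G e" if "e \<in> fst F" for e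
  proof -
    from that obtain x where x: "e = {x, mate F x}" "x \<in> Vset n" using tangle_edges[OF F] by auto
    have "osgn x (mate F x) * snd F e = osgn x (mate F x) * snd G e"
      using eq[OF x(2)] x(1) unfolding wt_def by metis
    then show ?thesis by (metis osgn_sq)
  qed
  then show "snd F = snd G"
    using arrow_tanglesD(3)[OF F] arrow_tanglesD(3)[OF G] fst by (metis extensionalityI)
qed

text \<open>An arrow tangle amounts to a fixed point free involution with an antisymmetric weight of
  the right parity. The label has to be compared only from the smaller end of a strand, since
  antisymmetry supplies the other end.\<close>

lemma tangleI:
  assumes e: "\<And>x. x \<in> Vset n \<Longrightarrow> e x \<in> Vset n" "\<And>x. x \<in> Vset n \<Longrightarrow> e (e x) = x"
      "\<And>x. x \<in> Vset n \<Longrightarrow> e x \<noteq> x"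
    and s: "\<And>x. x \<in> Vset n \<Longrightarrow> s (e x) = - s x"
      "\<And>x. x \<in> Vset n \<Longrightarrow> even (s x) \<longleftrightarrow> fst x \<noteq> fst (e x)"
    and E: "fst F = {{x, e x} | x. x \<in> Vset n}" and ext: "snd F \<in> extensional (fst F)"
    and f: "\<And>x. x \<in> Vset n \<Longrightarrow> vless x (e x) \<Longrightarrow> snd F {x, e x} = vsgn x * s x"
  shows "F \<in> arrow_tangles n" and "x \<in> Vset n \<Longrightarrow> mate F x = e x" and "x \<in> Vset n \<Longrightarrow> wt F x = s x"
proof -
  have part: "partition_on (Vset n) (fst F)"
  proof (rule partition_onI)
    show "\<Union> (fst F) = Vset n" using e(1) unfolding E by blast
    show "disjnt p q" if pq: "p \<in> fst F" "q \<in> fst F" "p \<noteq> q" for p q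
    proof -
      obtain x y where xy: "p = {x, e x}" "q = {y, e y}" "x \<in> Vset n" "y \<in> Vset n"
        using pq(1,2) unfolding E by auto
      have "\<not> (x = y \<or> x = e y \<or> e x = y \<or> e x = e y)"
        using xy pq(3) e(2) by (metis insert_commute)
      then show ?thesis using xy by (auto simp: disjnt_def)
    qed
    show "{} \<notin> fst F" using E by blast
  qed
  have card: "card p = 2" if "p \<in> fst F" for p
  proof -
    from that obtain x where "p = {x, e x}" "x \<in> Vset n" unfolding E by blast
    then show ?thesis using e(3)[of x] by simp
  qed
  have f': "osgn x (e x) * snd F {x, e x} = s x" if x: "x \<in> Vset n" for x
  proof (cases "vless x (e x)")
    case True
    then show ?thesis using f[OF x True] by (simp add: osgn_def)
  next
    case False
    then have "vless (e x) x" using vless_total[OF x e(1)[OF x]] e(3)[OF x] by auto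
    then have "snd F {x, e x} = - vsgn (e x) * s x"
      using f[OF e(1)[OF x]] e(2)[OF x] s(1)[OF x] by (simp add: insert_commute)
    then show ?thesis using False by (simp add: osgn_def)
  qed
  have ev: "even (snd F {x, e x}) \<longleftrightarrow> fst x \<noteq> fst (e x)" if "x \<in> Vset n" for x
    using f'[OF that] s(2)[OF that] by (metis even_mult_iff odd_osgn)
  have par: "even (snd F {x, y}) \<longleftrightarrow> fst x \<noteq> fst y" if xy: "{x, y} \<in> fst F" for x y
  proof -
    obtain z where "{x, y} = {z, e z}" "z \<in> Vset n" using xy E by auto
    then have "x \<in> Vset n \<and> y = e x" using e(1,2)[of z] by (auto simp: doubleton_eq_iff)
    then show ?thesis using ev[of x] by auto
  qed
  show F: "F \<in> arrow_tangles n"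
    using part card ext par unfolding arrow_tangles_def flat_tangles_def
    by (cases F) (auto split: if_splits)
  show mate: "mate F x = e x" if "x \<in> Vset n" for x
    using mate_eqI[OF F, of x "e x"] that E by blast
  show "x \<in> Vset n \<Longrightarrow> wt F x = s x" using mate f' by (simp add: wt_def)
qed

definition tangle_graph :: "nat \<Rightarrow> tangle \<Rightarrow> (vertex \<times> vertex \<times> int) set" where
  "tangle_graph n F = {(x, mate F x, wt F x) | x. x \<in> Vset n}"

lemma mem_tangle_graph: "(u, v, g) \<in> tangle_graph n F \<longleftrightarrow> u \<in> Vset n \<and> v = mate F u \<and> g = wt F u"
  unfolding tangle_graph_def by blast

lemma conn_tangle_graph:
  assumes F: "F \<in> arrow_tangles n" and x: "x \<in> Vset n"
  shows "conn (tangle_graph n F) x y s \<longleftrightarrow> y = x \<and> s = 0 \<or> y = mate F x \<and> s = wt F x"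
proof
  assume "conn (tangle_graph n F) x y s"
  then show "y = x \<and> s = 0 \<or> y = mate F x \<and> s = wt F x"
    using x
  proof (induction rule: conn.induct)
    case (conn_fwd x y s z g)
    then show ?case by (auto simp: mem_tangle_graph mate_mate[OF F] wt_mate[OF F])
  next
    case (conn_bwd x y s z g)
    then have "y \<in> Vset n" "z = mate F y" "g = - wt F y"
      by (auto simp: mem_tangle_graph mate_mate[OF F] wt_mate[OF F] mate_in[OF F])
    then show ?case using conn_bwd by (auto simp: mate_mate[OF F] wt_mate[OF F])
  qed simp
next
  assume "y = x \<and> s = 0 \<or> y = mate F x \<and> s = wt F x"
  then show "conn (tangle_graph n F) x y s"
    using x by (auto simp: mem_tangle_graph intro: conn_refl conn_edge)
qed

lemma tangle_graph_in: "F \<in> arrow_tangles n \<Longrightarrow> (u, v, g) \<in> tangle_graph n F \<Longrightarrow> u \<in> Vset n \<and> v \<in> Vset n"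
  using mate_in by (simp add: mem_tangle_graph)

text \<open>The parity of a strand is minus the product of the signs of its two levels, and each
  gluing reverses the sign, so a product of consecutive parities telescopes to the signs of its
  first and its last source.\<close>

lemma cum_parity_eq:
  assumes level: "\<And>j. j < length ss \<Longrightarrow> fst (fst (ss ! j)) \<in> {0, 1} \<and> fst (snd (ss ! j)) \<in> {0, 1}"
    and turn: "\<And>j. Suc j < length ss \<Longrightarrow> fst (fst (ss ! Suc j)) \<noteq> fst (snd (ss ! j))"
    and i: "i < length ss"
  shows "cum_parity ss i = vsgn (fst (ss ! 0)) * osgn (fst (ss ! i)) (snd (ss ! i))"
proof -
  have par: "parity (ss ! j) = - vsgn (fst (ss ! j)) * vsgn (snd (ss ! j))" if "j < length ss" for j
    using level[OF that] by (auto simp: parity_def vsgn_def)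
  have prod: "(\<Prod>j<k. parity (ss ! j)) = vsgn (fst (ss ! 0)) * vsgn (fst (ss ! k))" if "k < length ss" for k
    using that
  proof (induction k)
    case (Suc k)
    have "vsgn (fst (ss ! Suc k)) = - vsgn (snd (ss ! k))"
      using turn[OF Suc.prems] level[of k] level[of "Suc k"] Suc.prems by (auto simp: vsgn_def)
    then show ?case using Suc par[of k] by (simp add: algebra_simps)
  qed simp
  have "{..i} = insert i {..<i}" by auto
  then show ?thesis using prod[OF i] par[OF i]
    by (simp add: cum_parity_def osgn_def algebra_simps)
qed

section \<open>The trace as a loop product\<close>

definition closure_graph :: "nat \<Rightarrow> tangle \<Rightarrow> (vertex \<times> vertex \<times> int) set" where
  "closure_graph n F = tangle_graph n F \<union> {(x, flipv x, 0) | x. x \<in> Vset n}"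

locale tangle_closure =
  fixes n :: nat and F :: tangle
  assumes F: "F \<in> arrow_tangles n"
begin

text \<open>All vertices are glued, so there are no free ends. Key and start express that a closure
  cycle leaves level 0 at its least index.\<close>

sublocale based_strand_system "Vset n" "mate F" flipv "wt F" "Vset n" snd "\<lambda>x. fst x = 0"
proof
  show "y = x \<or> y = flipv x" if "x \<in> Vset n" "y \<in> Vset n" "snd x = snd y" for x y
    using that by (auto simp: flipv_def Vset_def)
qed (use F finite_Vset mate_in mate_mate mate_neq wt_mate flipv_in flipv_flipv flipv_neq in
  \<open>auto simp: flipv_def Vset_def\<close>)

lemma graph_eq: "graph = closure_graph n F"
  by (auto simp: graph_def closure_graph_def tangle_graph_def)

lemma alive_iff: "alive x i \<longleftrightarrow> x \<in> Vset n"
proof -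
  have "mate F (walk x j) \<in> Vset n" if "x \<in> Vset n" for j
    using that by (induction j) (auto simp: walk_Suc intro: mate_in[OF F] flipv_in)
  then show ?thesis by (auto simp: alive_def)
qed

definition cycle_list :: "vertex \<Rightarrow> nat \<Rightarrow> oriented list" where
  "cycle_list x l = map (\<lambda>i. (walk x i, mate F (walk x i))) [0..<l]"

lemma cycle_list_nth: "i < l \<Longrightarrow> cycle_list x l ! i = (walk x i, mate F (walk x i))"
  and length_cycle_list [simp]: "length (cycle_list x l) = l"
  by (auto simp: cycle_list_def)

lemma walk_in_V: "x \<in> Vset n \<Longrightarrow> walk x i \<in> Vset n"
  using walk_in alive_iff by blast

lemma is_closure_cycle_cycle_list:
  assumes "(x, l) \<in> based_cycles"
  shows "is_closure_cycle (fst F) (cycle_list x l)"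
proof -
  note d = based_cycleD[OF assms]
  have ne: "cycle_list x l \<noteq> []" using d(3) by (metis length_cycle_list less_irrefl list.size(3))
  have w: "walk x i \<in> Vset n" "mate F (walk x i) \<in> Vset n" for i
    using d(1) walk_in_V mate_in[OF F] by auto
  have hd: "hd (cycle_list x l) = (x, mate F x)"
    using ne d(3) by (simp add: hd_conv_nth cycle_list_nth)
  have "flipv (mate F (walk x (l - 1))) = x"
    using d(3,5) walk_Suc[of x "l - 1"] by simp
  then have lst: "snd (last (cycle_list x l)) = flipv x"
    using ne d(3) w flipv_flipv by (metis cycle_list_nth diff_less last_conv_nth length_cycle_list
        snd_conv zero_less_one)
  show ?thesis
    unfolding is_closure_cycle_def
  proof (intro conjI allI impI ballI)
    show "und s \<in> fst F" if "s \<in> set (cycle_list x l)" for s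
    proof -
      from that obtain i where "s = (walk x i, mate F (walk x i))" unfolding cycle_list_def by auto
      then show ?thesis using mate_edge[OF F w(1)] by (simp add: und_def)
    qed
    fix i assume i: "Suc i < length (cycle_list x l)"
    then have "fst (cycle_list x l ! Suc i) = flipv (snd (cycle_list x l ! i))"
      by (simp add: cycle_list_nth walk_Suc)
    then show "snd (snd (cycle_list x l ! i)) = snd (fst (cycle_list x l ! Suc i))"
      "fst (snd (cycle_list x l ! i)) = 0 \<Longrightarrow> fst (fst (cycle_list x l ! Suc i)) = 1"
      "fst (snd (cycle_list x l ! i)) = 1 \<Longrightarrow> fst (fst (cycle_list x l ! Suc i)) = 0"
      by (simp_all add: flipv_def)
  next
    show "snd (fst (hd (cycle_list x l))) < snd (fst (cycle_list x l ! i))"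
      if "1 \<le> i \<and> i < length (cycle_list x l)" for i
      using that d(6) hd by (simp add: cycle_list_nth)
  qed (use ne hd lst d(2) in \<open>auto simp: flipv_def\<close>)
qed

lemma closure_cycle_is_cycle_list:
  assumes ss: "is_closure_cycle (fst F) ss"
  shows "ss = cycle_list (fst (hd ss)) (length ss)" "(fst (hd ss), length ss) \<in> based_cycles"
proof -
  define x where "x = fst (hd ss)"
  note c = ss[unfolded is_closure_cycle_def]
  have ne: "ss \<noteq> []" using c by blast
  have edge: "mate F (fst (ss ! i)) = snd (ss ! i)" "fst (ss ! i) \<in> Vset n" "snd (ss ! i) \<in> Vset n"
    if "i < length ss" for i
  proof -
    have "{fst (ss ! i), snd (ss ! i)} \<in> fst F" using c that by (auto simp: und_def)
    then show "mate F (fst (ss ! i)) = snd (ss ! i)" "fst (ss ! i) \<in> Vset n" "snd (ss ! i) \<in> Vset n"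
      using mate_eqI[OF F] tangle_edge_in[OF F] by auto
  qed
  have nth: "fst (ss ! i) = walk x i" if "i < length ss" for i
    using that
  proof (induction i)
    case 0
    then show ?case using ne by (simp add: x_def hd_conv_nth)
  next
    case (Suc i)
    then have "fst (ss ! Suc i) = flipv (snd (ss ! i))"
      using c Vset_cases[OF edge(3), of i] by (auto simp: flipv_def prod_eq_iff)
    then show ?case using Suc edge(1)[of i] by (simp add: walk_Suc)
  qed
  show "ss = cycle_list (fst (hd ss)) (length ss)"
    unfolding x_def[symmetric]
  proof (rule nth_equalityI)
    show "ss ! i = cycle_list x (length ss) ! i" if "i < length ss" for i
      using nth[OF that] edge(1)[OF that] that by (metis cycle_list_nth prod.collapse)
  qed simp
  obtain k where k: "length ss = Suc k" using ne by (cases ss) auto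
  have x: "x \<in> Vset n" using edge(2)[of 0] nth[of 0] k by simp
  have "last ss = ss ! k" using ne k by (simp add: last_conv_nth)
  then have "walk x (length ss) = flipv (snd (last ss))" using k edge(1)[of k] nth[of k] by (simp add: walk_Suc)
  also have "\<dots> = x" using c by (simp add: x_def flipv_def prod_eq_iff)
  finally have "walk x (length ss) = x" .
  moreover have "snd x < snd (walk x i)" if "0 < i" "i < length ss" for i
  proof -
    have "snd (fst (hd ss)) < snd (fst (ss ! i))" using c that by (metis Suc_leI One_nat_def)
    then show ?thesis using nth[OF that(2)] by (simp add: x_def)
  qed
  moreover have "fst x = 0" using c by (simp add: x_def)
  ultimately show "(fst (hd ss), length ss) \<in> based_cycles"
    using x k unfolding x_def[symmetric] based_cycles_def by (simp add: alive_iff)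
qed

text \<open>No sign is left over, because the cycle starts at level 0, where \<open>vsgn\<close> is
  1.\<close>

lemma closure_label_cycle_list:
  assumes "(x, l) \<in> based_cycles"
  shows "closure_label (snd F) (cycle_list x l) = gain x l"
proof -
  note d = based_cycleD[OF assms]
  have w: "walk x i \<in> Vset n" "mate F (walk x i) \<in> Vset n" for i
    using d(1) walk_in_V mate_in[OF F] by auto
  have "cum_parity (cycle_list x l) i = osgn (walk x i) (mate F (walk x i))" if i: "i < l" for i
  proof -
    have "cum_parity (cycle_list x l) i =
        vsgn (fst (cycle_list x l ! 0)) * osgn (fst (cycle_list x l ! i)) (snd (cycle_list x l ! i))"
    proof (rule cum_parity_eq)
      show "fst (fst (cycle_list x l ! j)) \<in> {0, 1} \<and> fst (snd (cycle_list x l ! j)) \<in> {0, 1}"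
        if "j < length (cycle_list x l)" for j
        using that Vset_cases[OF w(1)] Vset_cases[OF w(2)] by (auto simp: cycle_list_nth)
      show "fst (fst (cycle_list x l ! Suc j)) \<noteq> fst (snd (cycle_list x l ! j))"
        if "Suc j < length (cycle_list x l)" for j
        using that Vset_cases[OF w(2), of j] by (auto simp: cycle_list_nth walk_Suc flipv_def)
    qed (use i in simp)
    then show ?thesis using i d(2,3) by (simp add: cycle_list_nth vsgn_def)
  qed
  then show ?thesis
    unfolding closure_label_def gain_def
    by (simp add: cycle_list_nth wt_def und_def)
qed

lemma tangle_trace_eq: "tangle_trace F = loop_prod (closure_graph n F) (Vset n) {}"
proof -
  have eq: "{ss. is_closure_cycle (fst F) ss} = (\<lambda>(x, l). cycle_list x l) ` based_cycles"
  proof (intro equalityI subsetI)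
    fix ss assume "ss \<in> {ss. is_closure_cycle (fst F) ss}"
    then have ss: "is_closure_cycle (fst F) ss" by simp
    show "ss \<in> (\<lambda>(x, l). cycle_list x l) ` based_cycles"
      using closure_cycle_is_cycle_list[OF ss] by (intro image_eqI[of _ _ "(fst (hd ss), length ss)"]) auto
  qed (use is_closure_cycle_cycle_list in auto)
  have inj: "inj_on (\<lambda>(x, l). cycle_list x l) based_cycles"
  proof (rule inj_onI, clarify)
    fix x l x' l' assume a: "(x, l) \<in> based_cycles" "cycle_list x l = cycle_list x' l'"
    then have "l = l'" by (metis length_cycle_list)
    moreover have "x = x'" using a(2) based_cycleD(3)[OF a(1)] calculation
      by (metis cycle_list_nth fst_conv walk_0)
    ultimately show "x = x' \<and> l = l'" by simp
  qed
  have "tangle_trace F = (\<Prod>p\<in>based_cycles. zvar (nat (\<bar>closure_label (snd F) ((\<lambda>(x, l). cycle_list x l) p)\<bar> div 2)))"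
    unfolding tangle_trace_def case_prod_beta eq prod.reindex[OF inj] by simp
  also have "\<dots> = (\<Prod>(x, l)\<in>based_cycles. loop_val \<bar>gain x l\<bar>)"
    by (rule prod.cong) (auto simp: closure_label_cycle_list loop_val_def)
  finally show ?thesis using prod_based_cycles by (simp add: graph_eq)
qed

end

section \<open>The product as a gluing\<close>

definition pick :: "tangle \<Rightarrow> tangle \<Rightarrow> factor \<Rightarrow> tangle" where
  "pick F F' t = (case t of First \<Rightarrow> F | Second \<Rightarrow> F')"

definition other :: "factor \<Rightarrow> factor" where
  "other t = (case t of First \<Rightarrow> Second | Second \<Rightarrow> First)"

definition mate2 :: "tangle \<Rightarrow> tangle \<Rightarrow> factor \<times> vertex \<Rightarrow> factor \<times> vertex" where
  "mate2 F F' x = (fst x, mate (pick F F' (fst x)) (snd x))"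

definition wt2 :: "tangle \<Rightarrow> tangle \<Rightarrow> factor \<times> vertex \<Rightarrow> int" where
  "wt2 F F' x = wt (pick F F' (fst x)) (snd x)"

definition flip2 :: "factor \<times> vertex \<Rightarrow> factor \<times> vertex" where
  "flip2 x = (other (fst x), flipv (snd x))"

text \<open>The level of each factor that remains a boundary of the product; the opposite level is
  glued to the other factor.\<close>

definition outer :: "factor \<Rightarrow> nat" where
  "outer t = (case t of First \<Rightarrow> 0 | Second \<Rightarrow> 1)"

definition interior :: "nat \<Rightarrow> (factor \<times> vertex) set" where
  "interior n = {x. snd x \<in> Vset n \<and> fst (snd x) \<noteq> outer (fst x)}"

text \<open>Identifies the vertices of the product with the free ends of the glued graph, see
  \<open>emb_image\<close>.\<close>

definition emb :: "vertex \<Rightarrow> factor \<times> vertex" where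
  "emb x = (if fst x = 0 then First else Second, x)"

definition glue_graph :: "nat \<Rightarrow> tangle \<Rightarrow> tangle \<Rightarrow> ((factor \<times> vertex) \<times> (factor \<times> vertex) \<times> int) set" where
  "glue_graph n F F' = {(x, mate2 F F' x, wt2 F F' x) | x. snd x \<in> Vset n} \<union>
     {(x, flip2 x, 0) | x. x \<in> interior n}"

lemma pick_simps [simp]: "pick F F' First = F" "pick F F' Second = F'"
  by (simp_all add: pick_def)

lemma other_simps [simp]: "other First = Second" "other Second = First" "other (other t) = t" "other t \<noteq> t"
  by (simp_all add: other_def split: factor.split)

lemma outer_simps [simp]: "outer First = 0" "outer Second = 1"
  by (simp_all add: outer_def)

lemma snd_emb [simp]: "snd (emb x) = x"
  by (simp add: emb_def)

lemma emb_snd: "snd x \<in> Vset n \<Longrightarrow> x \<notin> interior n \<Longrightarrow> emb (snd x) = x"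
  by (cases x; cases "fst x") (auto simp: emb_def interior_def Vset_def)

lemma emb_notin: "x \<in> Vset n \<Longrightarrow> emb x \<notin> interior n"
  by (auto simp: emb_def interior_def Vset_def)

lemma emb_image: "emb ` Vset n = UNIV \<times> Vset n - interior n"
proof (intro equalityI subsetI)
  fix x assume "x \<in> UNIV \<times> Vset n - interior n"
  then show "x \<in> emb ` Vset n" using emb_snd[of x n] by (metis DiffE SigmaE image_eqI snd_conv)
qed (use emb_notin in \<open>auto simp: emb_def\<close>)

lemma flip2_level: "fst (snd (flip2 x)) = 1 - fst (snd x)"
  by (simp add: flip2_def flipv_def)

lemma flip2_interior: "x \<in> interior n \<Longrightarrow> flip2 x \<in> interior n"
  by (cases x; cases "fst x") (auto simp: interior_def flip2_def flipv_def Vset_def)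

locale tangle_pair =
  fixes n :: nat and F F' :: tangle
  assumes F: "F \<in> arrow_tangles n" and F': "F' \<in> arrow_tangles n"
begin

lemma pick_in: "pick F F' t \<in> arrow_tangles n"
  using F F' by (cases t) auto

text \<open>Key and start reproduce the convention of \<open>is_cycle\<close> that a loop begins in
  the first factor at its least index.\<close>

sublocale based_strand_system "UNIV \<times> Vset n" "mate2 F F'" flip2 "wt2 F F'" "interior n"
  "\<lambda>x. snd (snd x)" "\<lambda>x. fst x = First"
proof
  have "(UNIV :: factor set) = {First, Second}" using factor.exhaust by blast
  then have "finite (UNIV :: factor set)" by (metis finite.emptyI finite_insert)
  then show "finite (UNIV \<times> Vset n :: (factor \<times> vertex) set)" using finite_Vset by simp
  fix x :: "factor \<times> vertex" assume "x \<in> UNIV \<times> Vset n"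
  then have x: "snd x \<in> Vset n" by auto
  show "mate2 F F' x \<in> UNIV \<times> Vset n" "mate2 F F' (mate2 F F' x) = x" "mate2 F F' x \<noteq> x"
    "wt2 F F' (mate2 F F' x) = - wt2 F F' x"
    using mate_in[OF pick_in x] mate_mate[OF pick_in x] mate_neq[OF pick_in x] wt_mate[OF pick_in x]
    by (auto simp: mate2_def wt2_def prod_eq_iff)
next
  show "interior n \<subseteq> UNIV \<times> Vset n" by (auto simp: interior_def)
  fix x assume x: "x \<in> interior n"
  show "flip2 x \<in> interior n" using x by (rule flip2_interior)
  have V: "snd x \<in> Vset n" using x by (simp add: interior_def)
  show "flip2 (flip2 x) = x" using flipv_flipv[OF V] by (simp add: flip2_def)
  show "flip2 x \<noteq> x" using flipv_neq by (metis flip2_def snd_conv)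
  show "snd (snd (flip2 x)) = snd (snd x)" by (simp add: flip2_def flipv_def)
  show "(fst (flip2 x) = First) \<longleftrightarrow> \<not> (fst x = First)" by (cases "fst x") (auto simp: flip2_def)
  fix y assume y: "y \<in> interior n" and key: "snd (snd x) = snd (snd y)"
  show "y = x \<or> y = flip2 x"
    using x y key by (cases x; cases y; cases "fst x"; cases "fst y")
      (auto simp: interior_def flip2_def flipv_def Vset_def)
qed

lemma graph_eq: "graph = glue_graph n F F'"
  by (auto simp: graph_def glue_graph_def)

definition step :: "factor \<times> vertex \<Rightarrow> tagged" where
  "step y = (fst y, snd y, snd (mate2 F F' y))"

definition path_list :: "factor \<times> vertex \<Rightarrow> nat \<Rightarrow> tagged list" where
  "path_list x l = map (\<lambda>i. step (walk x i)) [0..<l]"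

lemma path_list_nth: "i < l \<Longrightarrow> path_list x l ! i = step (walk x i)"
  and length_path_list [simp]: "length (path_list x l) = l"
  by (auto simp: path_list_def)

lemma path_list_eq_Nil [simp]: "path_list x l = [] \<longleftrightarrow> l = 0"
  by (simp add: path_list_def)

lemma hd_path_list: "0 < l \<Longrightarrow> hd (path_list x l) = step x"
  by (simp add: hd_conv_nth path_list_nth)

lemma last_path_list: "last (path_list x (Suc l)) = step (walk x l)"
  by (simp add: last_conv_nth path_list_nth)

lemma step_simps [simp]: "tag (step y) = fst y" "src (step y) = snd y" "dst (step y) = snd (mate2 F F' y)"
  "snd (step y) = (snd y, snd (mate2 F F' y))"
  by (simp_all add: step_def tag_def src_def dst_def)

lemma fst_mate2 [simp]: "fst (mate2 F F' y) = fst y"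
  by (simp add: mate2_def)

lemma und_step: "snd y \<in> Vset n \<Longrightarrow> und (snd (step y)) \<in> fst (pick F F' (fst y))"
  using mate_edge[OF pick_in] by (simp add: und_def mate2_def)

lemma snd_walk_in: "alive x i \<Longrightarrow> snd (walk x i) \<in> Vset n" "alive x i \<Longrightarrow> snd (mate2 F F' (walk x i)) \<in> Vset n"
  using walk_in[of x i] m_in[of "walk x i"] by (simp_all add: mem_Times_iff)

lemma path_in_eq:
  "path_in (fst F) (fst F') ts \<longleftrightarrow> ts \<noteq> [] \<and> (\<forall>t\<in>set ts. und (snd t) \<in> fst (pick F F' (tag t))) \<and>
     (\<forall>i. Suc i < length ts \<longrightarrow> snd (dst (ts ! i)) = snd (src (ts ! Suc i)))"
proof -
  have "(case t of First \<Rightarrow> fst F | Second \<Rightarrow> fst F') = fst (pick F F' t)" for t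
    by (cases t) auto
  then show ?thesis unfolding path_in_def by simp
qed

lemma path_in_path_list:
  assumes "alive x l"
  shows "path_in (fst F) (fst F') (path_list x (Suc l))"
  unfolding path_in_eq
proof (intro conjI ballI allI impI)
  fix t assume "t \<in> set (path_list x (Suc l))"
  then obtain i where "i \<le> l" "t = step (walk x i)"
    unfolding path_list_def set_map set_upt using less_Suc_eq_le by auto
  then show "und (snd t) \<in> fst (pick F F' (tag t))"
    using und_step snd_walk_in(1)[OF alive_mono[OF assms]] by simp
next
  show "snd (dst (path_list x (Suc l) ! i)) = snd (src (path_list x (Suc l) ! Suc i))"
    if "Suc i < length (path_list x (Suc l))" for i
    using that by (simp add: path_list_nth walk_Suc flip2_def flipv_def)
qed simp

text \<open>Mates are unique, so a list of strands linked by gluings must follow the walk from its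
  first source. Arcs and cycles differ only in how they supply \<open>link\<close>.\<close>

lemma path_list_eq:
  assumes "ts \<noteq> []" "\<forall>t\<in>set ts. und (snd t) \<in> fst (pick F F' (tag t))"
    and link: "\<And>i. Suc i < length ts \<Longrightarrow> (tag (ts ! Suc i), src (ts ! Suc i)) = flip2 (tag (ts ! i), dst (ts ! i))"
  shows "ts = path_list (tag (hd ts), src (hd ts)) (length ts)"
proof (rule nth_equalityI)
  define x where "x = (tag (hd ts), src (hd ts))"
  have edge: "mate2 F F' (tag (ts ! i), src (ts ! i)) = (tag (ts ! i), dst (ts ! i))" if "i < length ts" for i
  proof -
    have "{src (ts ! i), dst (ts ! i)} \<in> fst (pick F F' (tag (ts ! i)))"
      using assms(2) that by (auto simp: und_def src_def dst_def)
    then show ?thesis using mate_eqI[OF pick_in] by (simp add: mate2_def)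
  qed
  have walk: "(tag (ts ! i), src (ts ! i)) = walk x i" if "i < length ts" for i
    using that
  proof (induction i)
    case 0
    then show ?case using assms(1) by (simp add: x_def hd_conv_nth)
  next
    case (Suc i)
    then show ?case using link[of i] edge[of i] by (simp add: walk_Suc)
  qed
  show "ts ! i = path_list (tag (hd ts), src (hd ts)) (length ts) ! i" if "i < length ts" for i
  proof -
    have "ts ! i = step (tag (ts ! i), src (ts ! i))"
      using edge[OF that] by (simp add: step_def tag_def src_def dst_def)
    then show ?thesis using walk[OF that] that by (simp add: path_list_nth flip: x_def)
  qed
qed simp

text \<open>The sign of the starting level remains. For an arc it is the sign that relates label and
  weight at the smaller end; for a cycle it disappears in the absolute value.\<close>

lemma path_label_path_list:
  assumes "alive x l"
  shows "path_label (snd F) (snd F') (path_list x (Suc l)) = vsgn (snd x) * gain x (Suc l)"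
proof -
  let ?ts = "path_list x (Suc l)" and ?m = "mate2 F F'"
  have w: "snd (walk x i) \<in> Vset n" "snd (?m (walk x i)) \<in> Vset n" if "i \<le> l" for i
    using snd_walk_in alive_mono[OF assms that] by auto
  have cp: "cum_parity (map snd ?ts) i = vsgn (snd x) * osgn (snd (walk x i)) (snd (?m (walk x i)))"
    if i: "i < Suc l" for i
  proof -
    have nth: "map snd ?ts ! j = (snd (walk x j), snd (?m (walk x j)))" if "j < Suc l" for j
      using that by (simp add: path_list_nth)
    have "cum_parity (map snd ?ts) i =
        vsgn (fst (map snd ?ts ! 0)) * osgn (fst (map snd ?ts ! i)) (snd (map snd ?ts ! i))"
    proof (rule cum_parity_eq)
      show "fst (fst (map snd ?ts ! j)) \<in> {0, 1} \<and> fst (snd (map snd ?ts ! j)) \<in> {0, 1}"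
        if "j < length (map snd ?ts)" for j
        using that nth[of j] Vset_cases[OF w(1), of j] Vset_cases[OF w(2), of j] by auto
      show "fst (fst (map snd ?ts ! Suc j)) \<noteq> fst (snd (map snd ?ts ! j))"
        if "Suc j < length (map snd ?ts)" for j
        using that nth[of j] nth[of "Suc j"] Vset_cases[OF w(2), of j]
        by (auto simp: walk_Suc flip2_def flipv_def)
    qed (use i in simp)
    then show ?thesis using nth[of 0] nth[OF i] by simp
  qed
  have "cum_parity (map snd ?ts) i * (case tag (?ts ! i) of First \<Rightarrow> snd F (und (snd (?ts ! i)))
      | Second \<Rightarrow> snd F' (und (snd (?ts ! i)))) = vsgn (snd x) * wt2 F F' (walk x i)" if "i < Suc l" for i
    using cp[OF that] that
    by (cases "fst (walk x i)") (simp_all add: path_list_nth wt2_def wt_def mate2_def und_def mult.assoc)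
  then have "path_label (snd F) (snd F') ?ts = (\<Sum>i<Suc l. vsgn (snd x) * wt2 F F' (walk x i))"
    unfolding path_label_def length_path_list by (intro sum.cong) auto
  then show ?thesis unfolding gain_def sum_distrib_left .
qed

lemma is_cycle_path_list:
  assumes "(x, l) \<in> based_cycles"
  shows "is_cycle (fst F) (fst F') (path_list x l)"
proof -
  note d = based_cycleD[OF assms]
  obtain k where k: "l = Suc k" using d(3) by (cases l) auto
  have int: "walk x i \<in> interior n" "mate2 F F' (walk x i) \<in> interior n" if "i < l" for i
    using walk_in_C[of x i] alive_mono[OF d(4), of i] d(1,4) that by (cases i; auto simp: alive_def)+
  have par: "fst (walk x i) = (if even i then First else Second)" for i
    using d(2) by (induction i) (auto simp: walk_Suc flip2_def)
  have lev: "fst (src (path_list x l ! i)) = (if even i then 1 else 0)"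
    "fst (dst (path_list x l ! i)) = (if even i then 1 else 0)" if "i < l" for i
    using int[OF that] par[of i] that
    by (auto simp: path_list_nth interior_def Vset_def split: if_splits)
  \<comment> \<open>The last strand ends at the point glued to \<open>x\<close>, hence lies in the
    second factor; as the factors alternate, the length is even.\<close>
  have "flip2 (mate2 F F' (walk x k)) = x" using d(5) k by (simp add: walk_Suc)
  moreover have "flip2 (flip2 (mate2 F F' (walk x k))) = mate2 F F' (walk x k)" using c_c int(2)[of k] k by blast
  ultimately have last: "mate2 F F' (walk x k) = flip2 x" by simp
  then have "fst (walk x k) = Second" using d(2) by (metis fst_conv fst_mate2 flip2_def other_simps(1))
  then have "even l" using par[of k] k by (auto split: if_splits)
  show ?thesis
    unfolding is_cycle_def
  proof (intro conjI allI impI)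
    show "path_in (fst F) (fst F') (path_list x l)"
      unfolding k by (rule path_in_path_list) (use d(4) k alive_mono in auto)
    show "tag (path_list x l ! i) = First" if "i < length (path_list x l)" "even i" for i
      using that par[of i] by (simp add: path_list_nth)
    show "tag (path_list x l ! i) = Second" if "i < length (path_list x l)" "odd i" for i
      using that par[of i] by (simp add: path_list_nth)
    show "snd (dst (last (path_list x l))) = snd (src (hd (path_list x l)))"
      using last d(3) unfolding k by (simp add: last_path_list hd_path_list flip2_def flipv_def)
    show "snd (src (hd (path_list x l))) < snd (src (path_list x l ! i))"
      if "1 \<le> i \<and> i < length (path_list x l)" for i
      using that d(3,6) by (simp add: hd_path_list path_list_nth)
  qed (use lev \<open>even l\<close> in auto)
qed

lemma cycle_is_path_list:
  assumes ts: "is_cycle (fst F) (fst F') ts"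
  shows "ts = path_list (tag (hd ts), src (hd ts)) (length ts)"
    "((tag (hd ts), src (hd ts)), length ts) \<in> based_cycles"
proof -
  have path: "path_in (fst F) (fst F') ts" and even: "even (length ts)"
    and ev: "\<And>i. i < length ts \<Longrightarrow> even i \<Longrightarrow> tag (ts ! i) = First \<and> fst (src (ts ! i)) = 1 \<and> fst (dst (ts ! i)) = 1"
    and od: "\<And>i. i < length ts \<Longrightarrow> odd i \<Longrightarrow> tag (ts ! i) = Second \<and> fst (src (ts ! i)) = 0 \<and> fst (dst (ts ! i)) = 0"
    and closed: "snd (dst (last ts)) = snd (src (hd ts))"
    and min: "\<And>i. 1 \<le> i \<Longrightarrow> i < length ts \<Longrightarrow> snd (src (hd ts)) < snd (src (ts ! i))"
    using ts unfolding is_cycle_def by blast+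
  define x where "x = (tag (hd ts), src (hd ts))"
  have ne: "ts \<noteq> []" and edges: "\<forall>t\<in>set ts. und (snd t) \<in> fst (pick F F' (tag t))"
    and link: "\<And>i. Suc i < length ts \<Longrightarrow> snd (dst (ts ! i)) = snd (src (ts ! Suc i))"
    using path unfolding path_in_eq by blast+
  have link': "(tag (ts ! Suc i), src (ts ! Suc i)) = flip2 (tag (ts ! i), dst (ts ! i))"
    if "Suc i < length ts" for i
    using that link[of i] ev[of i] od[of i] ev[of "Suc i"] od[of "Suc i"]
    by (cases "even i") (auto simp: flip2_def flipv_def prod_eq_iff)
  have list: "ts = path_list x (length ts)"
    unfolding x_def by (rule path_list_eq[OF ne edges link'])
  then show "ts = path_list (tag (hd ts), src (hd ts)) (length ts)" by (simp add: x_def)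
  have nth: "ts ! i = step (walk x i)" if "i < length ts" for i
    using list path_list_nth[OF that] by metis
  obtain k where k: "length ts = Suc k" using ne by (cases ts) auto
  have V: "snd (walk x i) \<in> Vset n" "mate2 F F' (walk x i) \<in> interior n" if "i < length ts" for i
  proof -
    have "{src (ts ! i), dst (ts ! i)} \<in> fst (pick F F' (tag (ts ! i)))"
      using edges that by (auto simp: und_def src_def dst_def)
    from tangle_edge_in[OF pick_in this] have "snd (walk x i) \<in> Vset n" "snd (mate2 F F' (walk x i)) \<in> Vset n"
      using nth[OF that] by auto
    then show "snd (walk x i) \<in> Vset n" "mate2 F F' (walk x i) \<in> interior n"
      using ev[OF that] od[OF that] nth[OF that] by (cases "even i"; auto simp: interior_def)+
  qed
  have x: "fst x = First" "fst (snd x) = 1" "snd x \<in> Vset n"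
    using ev[of 0] V(1)[of 0] nth[of 0] k by auto
  have "alive x (length ts)"
    using V(2) x(3) by (auto simp: alive_def mem_Times_iff)
  moreover have "x \<in> interior n" using x by (simp add: interior_def)
  moreover have "walk x (length ts) = x"
  proof -
    have "odd k" using even k by simp
    then have "tag (ts ! k) = Second" "fst (dst (ts ! k)) = 0" using od[of k] k by auto
    moreover have "last ts = ts ! k" using ne k by (simp add: last_conv_nth)
    ultimately have "fst (walk x k) = Second" "fst (snd (mate2 F F' (walk x k))) = 0"
      "snd (snd (mate2 F F' (walk x k))) = snd (snd x)"
      using nth[of k] k closed by (auto simp: x_def)
    then have "flip2 (mate2 F F' (walk x k)) = x"
      using x(1,2) by (simp add: flip2_def flipv_def prod_eq_iff)
    then show ?thesis using k by (simp add: walk_Suc)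
  qed
  moreover have "snd (snd x) < snd (snd (walk x i))" if "0 < i" "i < length ts" for i
    using min[of i] that nth[OF that(2)] by (simp add: x_def Suc_leI)
  ultimately show "((tag (hd ts), src (hd ts)), length ts) \<in> based_cycles"
    using x(1) k unfolding x_def[symmetric] based_cycles_def by simp
qed

lemma loop_factor_eq: "loop_factor F F' = loop_prod (glue_graph n F F') (UNIV \<times> Vset n) (emb ` Vset n)"
proof -
  have eq: "{ts. is_cycle (fst F) (fst F') ts} = (\<lambda>(x, l). path_list x l) ` based_cycles"
  proof (intro equalityI subsetI)
    fix ts assume "ts \<in> {ts. is_cycle (fst F) (fst F') ts}"
    then have ts: "is_cycle (fst F) (fst F') ts" by simp
    show "ts \<in> (\<lambda>(x, l). path_list x l) ` based_cycles"
      using cycle_is_path_list[OF ts]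
      by (intro image_eqI[of _ _ "((tag (hd ts), src (hd ts)), length ts)"]) auto
  qed (use is_cycle_path_list in auto)
  have inj: "inj_on (\<lambda>(x, l). path_list x l) based_cycles"
  proof (rule inj_onI, clarsimp simp del: split_paired_All)
    fix t a b l t' a' b' l'
    assume a: "((t, a, b), l) \<in> based_cycles" "path_list (t, a, b) l = path_list (t', a', b') l'"
    then have "l = l'" by (metis length_path_list)
    moreover have "step (t, a, b) = step (t', a', b')" using a(2) based_cycleD(3)[OF a(1)] calculation
      by (metis hd_path_list)
    ultimately show "t = t' \<and> a = a' \<and> b = b' \<and> l = l'" by (simp add: step_def)
  qed
  have lab: "\<bar>path_label (snd F) (snd F') (path_list x l)\<bar> = \<bar>gain x l\<bar>" if "(x, l) \<in> based_cycles" for x l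
  proof -
    note d = based_cycleD[OF that]
    obtain k where "l = Suc k" using d(3) by (cases l) auto
    then show ?thesis using path_label_path_list[of x k] alive_mono[OF d(4), of k]
      by (simp add: abs_mult vsgn_def)
  qed
  have "loop_factor F F' =
      (\<Prod>p\<in>based_cycles. zvar (nat (\<bar>path_label (snd F) (snd F') ((\<lambda>(x, l). path_list x l) p)\<bar> div 2)))"
    unfolding loop_factor_def case_prod_beta fst_conv snd_conv eq prod.reindex[OF inj, unfolded case_prod_beta] by simp
  also have "\<dots> = (\<Prod>(x, l)\<in>based_cycles. loop_val \<bar>gain x l\<bar>)"
    by (rule prod.cong) (auto simp: lab loop_val_def)
  finally show ?thesis using prod_based_cycles by (simp add: graph_eq emb_image)
qed

text \<open>The choice is unambiguous: by \<open>arc_length_unique\<close> the walk can leave the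
  interior at one time only.\<close>

definition arc_length :: "vertex \<Rightarrow> nat" where
  "arc_length x = (SOME l. alive (emb x) l \<and> mate2 F F' (walk (emb x) l) \<notin> interior n)"

definition arc_end :: "vertex \<Rightarrow> vertex" where
  "arc_end x = snd (mate2 F F' (walk (emb x) (arc_length x)))"

definition arc_gain :: "vertex \<Rightarrow> int" where
  "arc_gain x = gain (emb x) (Suc (arc_length x))"

definition arc_list :: "vertex \<Rightarrow> tagged list" where
  "arc_list x = path_list (emb x) (Suc (arc_length x))"

context
  fixes x :: vertex
  assumes x: "x \<in> Vset n"
begin

lemma emb_free: "emb x \<in> UNIV \<times> Vset n - interior n"
  using x emb_image by blast

lemma arc_length_props:
  "alive (emb x) (arc_length x)" "mate2 F F' (walk (emb x) (arc_length x)) \<notin> interior n"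
proof -
  obtain l where "alive (emb x) l \<and> mate2 F F' (walk (emb x) l) \<notin> interior n"
    using walk_exits[OF emb_free] by blast
  then have "alive (emb x) (arc_length x) \<and> mate2 F F' (walk (emb x) (arc_length x)) \<notin> interior n"
    unfolding arc_length_def by (rule someI)
  then show "alive (emb x) (arc_length x)" "mate2 F F' (walk (emb x) (arc_length x)) \<notin> interior n"
    by auto
qed

lemma arc_length_unique:
  assumes "alive (emb x) l" "mate2 F F' (walk (emb x) l) \<notin> interior n"
  shows "l = arc_length x"
  using arc_length_props assms unfolding alive_def by (metis linorder_neqE_nat)

lemma arc_end_in: "arc_end x \<in> Vset n"
  unfolding arc_end_def using snd_walk_in(2) arc_length_props(1) .

lemma emb_arc_end: "emb (arc_end x) = mate2 F F' (walk (emb x) (arc_length x))"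
  using emb_snd arc_end_in arc_length_props(2) unfolding arc_end_def .

lemma arc_end_neq: "arc_end x \<noteq> x"
proof
  assume "arc_end x = x"
  then have "mate2 F F' (walk (emb x) (arc_length x)) = walk (emb x) 0"
    using emb_arc_end by simp
  then have "walk (emb x) (arc_length x) = mate2 F F' (walk (emb x) 0)"
    using m_m[OF walk_in[OF arc_length_props(1)]] by simp
  then show False using walk_not_reversed[OF arc_length_props(1), of 0] by simp
qed

lemma conn_emb_iff:
  assumes "y \<in> Vset n"
  shows "conn (glue_graph n F F') (emb x) (emb y) s \<longleftrightarrow> y = x \<and> s = 0 \<or> y = arc_end x \<and> s = arc_gain x"
proof
  assume conn: "conn (glue_graph n F F') (emb x) (emb y) s"
  have "emb y \<in> UNIV \<times> Vset n - interior n" using assms emb_image by blast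
  moreover have "emb (arc_end x) \<in> UNIV \<times> Vset n - interior n" using arc_end_in emb_image by blast
  ultimately have "emb y = emb x \<and> s = 0 \<or> emb y = emb (arc_end x) \<and> s = arc_gain x"
    using conn_arc[OF emb_free arc_length_props(1), of "emb y" s] conn
    by (simp add: emb_arc_end graph_eq arc_gain_def)
  then show "y = x \<and> s = 0 \<or> y = arc_end x \<and> s = arc_gain x" by (metis snd_emb)
next
  assume "y = x \<and> s = 0 \<or> y = arc_end x \<and> s = arc_gain x"
  then show "conn (glue_graph n F F') (emb x) (emb y) s"
    using conn_walk_m[OF arc_length_props(1)] conn_refl
    by (auto simp: graph_eq emb_arc_end arc_gain_def)
qed

text \<open>A strand has odd weight exactly when it keeps the level, and every gluing changes the
  level, so along the walk the gain is even exactly at points on the starting level. The last strand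
  is not followed by a gluing, which turns equality of levels into inequality.\<close>

lemma even_arc_gain: "even (arc_gain x) \<longleftrightarrow> fst x \<noteq> fst (arc_end x)"
proof -
  have ev: "even (wt2 F F' (walk (emb x) i)) \<longleftrightarrow> fst (snd (walk (emb x) i)) \<noteq> fst (snd (mate2 F F' (walk (emb x) i)))"
    if "i \<le> arc_length x" for i
    using even_wt[OF pick_in snd_walk_in(1)] alive_mono[OF arc_length_props(1) that]
    by (simp add: wt2_def mate2_def)
  have lev: "fst (snd (walk (emb x) i)) \<in> {0, 1}" "fst (snd (mate2 F F' (walk (emb x) i))) \<in> {0, 1}"
    if "i \<le> arc_length x" for i
    using Vset_cases[OF snd_walk_in(1)] Vset_cases[OF snd_walk_in(2)]
      alive_mono[OF arc_length_props(1) that] by auto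
  have flip: "even (g + w) \<longleftrightarrow> 1 - b = c" if "a \<in> {0, 1}" "b \<in> {0, 1}" "c \<in> {0, 1}"
    "even g \<longleftrightarrow> a = c" "even w \<longleftrightarrow> a \<noteq> b" for a b c :: nat and g w :: int
    using that by auto
  have x01: "fst x \<in> {0, 1}" using Vset_cases[OF x] by simp
  have "even (gain (emb x) i) \<longleftrightarrow> fst (snd (walk (emb x) i)) = fst x" if "i \<le> arc_length x" for i
    using that
  proof (induction i)
    case (Suc i)
    have "even (gain (emb x) i + wt2 F F' (walk (emb x) i)) \<longleftrightarrow>
        1 - fst (snd (mate2 F F' (walk (emb x) i))) = fst x"
      by (rule flip) (use Suc lev[of i] ev[of i] x01 in auto)
    then show ?case unfolding gain_Suc walk_Suc flip2_level .
  qed simp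
  then have "even (arc_gain x) \<longleftrightarrow> 1 - fst (arc_end x) = fst x"
    unfolding arc_gain_def gain_Suc arc_end_def
    by (intro flip) (use lev[of "arc_length x"] ev[of "arc_length x"] x01 in auto)
  then show ?thesis using x01 lev(2)[of "arc_length x"] by (auto simp: arc_end_def)
qed

end

text \<open>Symmetry of \<open>conn\<close> takes the place of reversing the list of
  strands.\<close>

lemma arc_end_end:
  assumes "x \<in> Vset n"
  shows "arc_end (arc_end x) = x" "arc_gain (arc_end x) = - arc_gain x"
proof -
  note y = arc_end_in[OF assms]
  have "conn (glue_graph n F F') (emb (arc_end x)) (emb x) (- arc_gain x)"
    by (rule conn_sym) (simp add: conn_emb_iff[OF assms y])
  then show "arc_end (arc_end x) = x" "arc_gain (arc_end x) = - arc_gain x"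
    using conn_emb_iff[OF y assms] arc_end_neq[OF assms] by auto
qed

text \<open>The order condition on the ends selects one of the two traversals of an arc, so that the
  lists are indexed by the smaller ends.\<close>

lemma is_arc_iff:
  "is_arc (fst F) (fst F') ts \<longleftrightarrow> (\<exists>x\<in>Vset n. vless x (arc_end x) \<and> ts = arc_list x)"
proof
  assume ts: "is_arc (fst F) (fst F') ts"
  have outer: "(case t of First \<Rightarrow> 0 | Second \<Rightarrow> 1) = outer t" for t by (simp add: outer_def)
  have path: "path_in (fst F) (fst F') ts"
    and a: "\<And>i. Suc i < length ts \<Longrightarrow> tag (ts ! i) = First \<Longrightarrow>
        fst (dst (ts ! i)) = 1 \<and> tag (ts ! Suc i) = Second \<and> fst (src (ts ! Suc i)) = 0"
    and b: "\<And>i. Suc i < length ts \<Longrightarrow> tag (ts ! i) = Second \<Longrightarrow>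
        fst (dst (ts ! i)) = 0 \<and> tag (ts ! Suc i) = First \<and> fst (src (ts ! Suc i)) = 1"
    and s: "fst (src (hd ts)) = outer (tag (hd ts))" and e: "fst (dst (last ts)) = outer (tag (last ts))"
    and less: "vless (src (hd ts)) (dst (last ts))"
    using ts unfolding is_arc_def outer by blast+
  define y where "y = (tag (hd ts), src (hd ts))"
  define x where "x = src (hd ts)"
  have ne: "ts \<noteq> []" and edges: "\<forall>t\<in>set ts. und (snd t) \<in> fst (pick F F' (tag t))"
    and link: "\<And>i. Suc i < length ts \<Longrightarrow> snd (dst (ts ! i)) = snd (src (ts ! Suc i))"
    using path unfolding path_in_eq by blast+
  have link': "(tag (ts ! Suc i), src (ts ! Suc i)) = flip2 (tag (ts ! i), dst (ts ! i))"
    if "Suc i < length ts" for i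
    using that link[of i] a[of i] b[of i]
    by (cases "tag (ts ! i)") (auto simp: flip2_def flipv_def prod_eq_iff)
  have list: "ts = path_list y (length ts)"
    unfolding y_def by (rule path_list_eq[OF ne edges link'])
  have nth: "ts ! i = step (walk y i)" if "i < length ts" for i
    using list path_list_nth[OF that] by metis
  obtain l where l: "length ts = Suc l" using ne by (cases ts) auto
  have V: "snd (walk y i) \<in> Vset n" "snd (mate2 F F' (walk y i)) \<in> Vset n" if "i < length ts" for i
  proof -
    have "{src (ts ! i), dst (ts ! i)} \<in> fst (pick F F' (tag (ts ! i)))"
      using edges that by (auto simp: und_def src_def dst_def)
    from tangle_edge_in[OF pick_in this] show "snd (walk y i) \<in> Vset n" "snd (mate2 F F' (walk y i)) \<in> Vset n"
      using nth[OF that] by auto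
  qed
  have x: "x \<in> Vset n" using V(1)[of 0] l by (simp add: y_def x_def)
  have "y \<notin> interior n" using s by (simp add: interior_def y_def)
  then have y: "y = emb x" using emb_snd[of y n] x by (simp add: y_def x_def)
  have int: "mate2 F F' (walk y i) \<in> interior n" if "i < l" for i
    using a[of i] b[of i] nth[of i] V(2)[of i] that l
    by (cases "tag (ts ! i)") (auto simp: interior_def)
  have alive: "alive (emb x) l" using int x by (auto simp: alive_def mem_Times_iff y)
  have last: "last ts = step (walk y l)" using ne nth[of l] l by (simp add: last_conv_nth)
  then have "mate2 F F' (walk (emb x) l) \<notin> interior n" using e y by (simp add: interior_def)
  then have len: "l = arc_length x" using arc_length_unique[OF x alive] by simp
  then have "ts = arc_list x" using list l y by (simp add: arc_list_def)
  moreover have "vless x (arc_end x)" using less last y len by (simp add: x_def[symmetric] arc_end_def)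
  ultimately show "\<exists>x\<in>Vset n. vless x (arc_end x) \<and> ts = arc_list x" using x by blast
next
  assume "\<exists>x\<in>Vset n. vless x (arc_end x) \<and> ts = arc_list x"
  then obtain x where x: "x \<in> Vset n" and less: "vless x (arc_end x)" and ts: "ts = arc_list x" by blast
  note al = arc_length_props[OF x]
  have outer: "(case t of First \<Rightarrow> 0 | Second \<Rightarrow> 1) = outer t" for t by (simp add: outer_def)
  have nth: "ts ! i = step (walk (emb x) i)" if "i \<le> arc_length x" for i
    using that by (simp add: ts arc_list_def path_list_nth)
  have hd: "hd ts = step (emb x)" and last: "last ts = step (walk (emb x) (arc_length x))"
    unfolding ts arc_list_def by (simp_all add: hd_path_list last_path_list)
  have int: "mate2 F F' (walk (emb x) i) \<in> interior n" if "i < arc_length x" for i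
    using al(1) that by (simp add: alive_def)
  have len: "length ts = Suc (arc_length x)" by (simp add: ts arc_list_def)
  have turn: "fst (dst (ts ! i)) = 1 - outer (tag (ts ! i)) \<and> tag (ts ! Suc i) = other (tag (ts ! i)) \<and>
      fst (src (ts ! Suc i)) = outer (tag (ts ! i))" if i: "Suc i < length ts" for i
  proof -
    have i': "i < arc_length x" using i len by simp
    have "fst (snd (mate2 F F' (walk (emb x) i))) = 1 - outer (fst (walk (emb x) i))"
      using int[OF i'] by (cases "fst (walk (emb x) i)") (auto simp: interior_def Vset_def)
    then show ?thesis using nth[of i] nth[of "Suc i"] i'
      by (cases "fst (walk (emb x) i)") (simp_all add: walk_Suc flip2_def flipv_def)
  qed
  show "is_arc (fst F) (fst F') ts"
    unfolding is_arc_def outer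
  proof (intro conjI allI impI)
    show "path_in (fst F) (fst F') ts"
      unfolding ts arc_list_def by (rule path_in_path_list[OF al(1)])
    show "fst (src (hd ts)) = outer (tag (hd ts))"
      using x unfolding hd by (auto simp: emb_def Vset_def)
    show "fst (dst (last ts)) = outer (tag (last ts))"
      unfolding last using al(2) snd_walk_in(2)[OF al(1)] by (simp add: interior_def)
    show "vless (src (hd ts)) (dst (last ts))"
      unfolding hd last using less by (simp add: arc_end_def)
  qed (use turn in auto)
qed

lemma boundary_arc_list: "x \<in> Vset n \<Longrightarrow> boundary (arc_list x) = {x, arc_end x}"
  by (simp add: boundary_def arc_list_def hd_path_list last_path_list arc_end_def)

lemma flat_star_eq: "flat_star (fst F) (fst F') = {{x, arc_end x} | x. x \<in> Vset n}"
proof (intro equalityI subsetI)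
  fix e assume "e \<in> flat_star (fst F) (fst F')"
  then obtain ts where ts: "is_arc (fst F) (fst F') ts" "e = boundary ts" unfolding flat_star_def by blast
  then obtain x where "x \<in> Vset n" "ts = arc_list x" using is_arc_iff by blast
  then show "e \<in> {{x, arc_end x} | x. x \<in> Vset n}" using ts(2) boundary_arc_list by blast
next
  fix e assume "e \<in> {{x, arc_end x} | x. x \<in> Vset n}"
  then obtain x where x: "e = {x, arc_end x}" "x \<in> Vset n" by blast
  have "\<exists>y\<in>Vset n. vless y (arc_end y) \<and> e = {y, arc_end y}"
  proof (cases "vless x (arc_end x)")
    case False
    then have "vless (arc_end x) x"
      using vless_total[OF x(2) arc_end_in[OF x(2)]] arc_end_neq[OF x(2)] by auto
    then show ?thesis using x arc_end_in[OF x(2)] arc_end_end[OF x(2)]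
      by (intro bexI[of _ "arc_end x"]) auto
  qed (use x in blast)
  then obtain y where y: "y \<in> Vset n" "vless y (arc_end y)" "e = {y, arc_end y}" by blast
  then have "is_arc (fst F) (fst F') (arc_list y)" using is_arc_iff by blast
  then show "e \<in> flat_star (fst F) (fst F')"
    unfolding flat_star_def using boundary_arc_list[OF y(1)] y(3) by (metis image_eqI mem_Collect_eq)
qed

lemma the_arc:
  assumes x: "x \<in> Vset n" "vless x (arc_end x)"
  shows "(THE ts. is_arc (fst F) (fst F') ts \<and> boundary ts = {x, arc_end x}) = arc_list x"
proof (rule the_equality)
  show "is_arc (fst F) (fst F') (arc_list x) \<and> boundary (arc_list x) = {x, arc_end x}"
    using x is_arc_iff boundary_arc_list by blast
  fix ts assume ts: "is_arc (fst F) (fst F') ts \<and> boundary ts = {x, arc_end x}"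
  then obtain y where y: "y \<in> Vset n" "vless y (arc_end y)" "ts = arc_list y" using is_arc_iff by blast
  then have eq: "{y, arc_end y} = {x, arc_end x}" using ts boundary_arc_list by simp
  have "y = x"
  proof (rule ccontr)
    assume "y \<noteq> x"
    then have "y = arc_end x" "arc_end y = x" using eq by (auto simp: doubleton_eq_iff)
    then show False using y x vless_total[OF x(1) y(1)] \<open>y \<noteq> x\<close> by simp
  qed
  then show "ts = arc_list x" using y by simp
qed

text \<open>The last contact with lists of strands: from here on \<open>tangle_star\<close> is
  handled only through \<open>mate\<close>, \<open>wt\<close> and \<open>conn\<close>.\<close>

lemma star_props:
  shows star_in: "tangle_star F F' \<in> arrow_tangles n"
    and mate_star: "x \<in> Vset n \<Longrightarrow> mate (tangle_star F F') x = arc_end x"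
    and wt_star: "x \<in> Vset n \<Longrightarrow> wt (tangle_star F F') x = arc_gain x"
proof -
  have fst: "fst (tangle_star F F') = {{x, arc_end x} | x. x \<in> Vset n}"
    unfolding tangle_star_def case_prod_beta by (simp add: flat_star_eq)
  have ext: "snd (tangle_star F F') \<in> extensional (fst (tangle_star F F'))"
    unfolding tangle_star_def case_prod_beta by simp
  have lab: "snd (tangle_star F F') {x, arc_end x} = vsgn x * arc_gain x"
    if x: "x \<in> Vset n" "vless x (arc_end x)" for x
  proof -
    have "{x, arc_end x} \<in> flat_star (fst F) (fst F')" unfolding flat_star_eq using x by blast
    then have "snd (tangle_star F F') {x, arc_end x} = path_label (snd F) (snd F') (arc_list x)"
      unfolding tangle_star_def case_prod_beta using the_arc[OF x] by simp
    then show ?thesis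
      using path_label_path_list[OF arc_length_props(1)[OF x(1)]] by (simp add: arc_list_def arc_gain_def)
  qed
  note I = tangleI[OF arc_end_in arc_end_end(1) arc_end_neq arc_end_end(2) even_arc_gain fst ext lab]
  show "tangle_star F F' \<in> arrow_tangles n" by (rule I(1))
  show "x \<in> Vset n \<Longrightarrow> mate (tangle_star F F') x = arc_end x" by (rule I(2))
  show "x \<in> Vset n \<Longrightarrow> wt (tangle_star F F') x = arc_gain x" by (rule I(3))
qed

lemma conn_star:
  assumes "x \<in> Vset n" "y \<in> Vset n"
  shows "conn (tangle_graph n (tangle_star F F')) x y s \<longleftrightarrow> conn (glue_graph n F F') (emb x) (emb y) s"
  using conn_tangle_graph[OF star_in assms(1)] conn_emb_iff[OF assms] mate_star[OF assms(1)] wt_star[OF assms(1)]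
  by auto

end

section \<open>Replacing a product by its two factors inside a larger graph\<close>

definition map_edges :: "('a \<Rightarrow> 'b) \<Rightarrow> ('a \<times> 'a \<times> int) set \<Rightarrow> ('b \<times> 'b \<times> int) set" where
  "map_edges \<phi> G = (\<lambda>(x, y, g). (\<phi> x, \<phi> y, g)) ` G"

lemma map_edgesI: "(x, y, g) \<in> G \<Longrightarrow> (\<phi> x, \<phi> y, g) \<in> map_edges \<phi> G"
  unfolding map_edges_def by force

lemma conn_map_edges:
  assumes "inj \<phi>"
  shows "conn (map_edges \<phi> G) (\<phi> x) (\<phi> y) s \<longleftrightarrow> conn G x y s"
proof -
  have "conn G x y s \<longleftrightarrow> conn (map_edges \<phi> G) (\<phi> x) (\<phi> y) s"
  proof (rule conn_retract[where \<psi> = "inv_into UNIV \<phi>" and \<delta> = "\<lambda>_. 0"])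
    show "conn (map_edges \<phi> G) (\<phi> u) (\<phi> v) g" if "(u, v, g) \<in> G" for u v g
      using map_edgesI[OF that] by (rule conn_edge)
    show "conn G (inv_into UNIV \<phi> u) (inv_into UNIV \<phi> v) (g + 0 - 0)" if "(u, v, g) \<in> map_edges \<phi> G" for u v g
      using that by (auto simp: map_edges_def inv_f_f[OF assms] intro: conn_edge)
  qed (simp_all add: inv_f_f[OF assms])
  then show ?thesis by simp
qed

lemma conn_isolated:
  assumes "conn G x y s" "\<And>u v g. (u, v, g) \<in> G \<Longrightarrow> u \<noteq> x \<and> v \<noteq> x"
  shows "y = x \<and> s = 0"
  using assms(1)
proof (induction x\<equiv>x y s rule: conn.induct)
  case (conn_fwd y s z g)
  then show ?case using assms(2)[of y z g] by auto
next
  case (conn_bwd y s z g)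
  then show ?case using assms(2)[of z y g] by auto
qed simp

lemma glue_graph_in:
  assumes "F \<in> arrow_tangles n" "F' \<in> arrow_tangles n" "(u, v, g) \<in> glue_graph n F F'"
  shows "u \<in> UNIV \<times> Vset n \<and> v \<in> UNIV \<times> Vset n"
proof -
  interpret tangle_pair n F F' using assms by unfold_locales
  show ?thesis using graph_in assms(3) unfolding graph_eq .
qed

lemma finite_factor_Vset: "finite (UNIV \<times> Vset n :: (factor \<times> vertex) set)"
proof -
  have "(UNIV :: factor set) = {First, Second}" using factor.exhaust by blast
  then have "finite (UNIV :: factor set)" by (metis finite.emptyI finite_insert)
  then show ?thesis using finite_Vset by simp
qed

text \<open>The points \<open>X\<close> with the edges \<open>D\<close> are the surroundings of a
  product. \<open>\<kappa>\<close> places the product in this coarse picture, \<open>\<iota>\<close>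
  places its two glued factors in the refined one, and \<open>\<phi>\<close> translates coarse
  points into refined ones. The abstract maps let one argument serve the closure as well as both
  bracketings of a triple product.\<close>

locale star_context = tangle_pair +
  fixes \<iota> :: "factor \<times> vertex \<Rightarrow> 'b" and \<kappa> :: "vertex \<Rightarrow> 'c" and \<phi> :: "'c \<Rightarrow> 'b"
    and X :: "'c set" and D :: "('c \<times> 'c \<times> int) set"
  assumes inj_\<iota>: "inj \<iota>" and inj_\<kappa>: "inj \<kappa>" and inj_\<phi>: "inj_on \<phi> X"
    and fin: "finite X" and \<kappa>_in: "a \<in> Vset n \<Longrightarrow> \<kappa> a \<in> X"
    and \<phi>_\<kappa>: "a \<in> Vset n \<Longrightarrow> \<phi> (\<kappa> a) = \<iota> (emb a)"
    and \<phi>_out: "x \<in> X \<Longrightarrow> x \<notin> \<kappa> ` Vset n \<Longrightarrow> \<phi> x \<notin> \<iota> ` (UNIV \<times> Vset n)"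
    and D_in: "(u, v, g) \<in> D \<Longrightarrow> u \<in> X \<and> v \<in> X"
begin

lemma local_edges_in: "(u, v, g) \<in> map_edges \<kappa> (tangle_graph n (tangle_star F F')) \<Longrightarrow>
    u \<in> \<kappa> ` Vset n \<and> v \<in> \<kappa> ` Vset n"
  using tangle_graph_in[OF star_in] unfolding map_edges_def by force

lemma glued_edges_in: "(u, v, g) \<in> map_edges \<iota> (glue_graph n F F') \<Longrightarrow>
    u \<in> \<iota> ` (UNIV \<times> Vset n) \<and> v \<in> \<iota> ` (UNIV \<times> Vset n)"
  using glue_graph_in[OF F F'] unfolding map_edges_def by force

text \<open>Points off the product are isolated in both graphs, so the content is
  \<open>conn_star\<close>.\<close>

lemma conn_local:
  assumes "x \<in> X" "x' \<in> X"
  shows "conn (map_edges \<kappa> (tangle_graph n (tangle_star F F'))) x x' s \<longleftrightarrow>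
    conn (map_edges \<iota> (glue_graph n F F')) (\<phi> x) (\<phi> x') s" (is "conn ?G x x' s \<longleftrightarrow> conn ?H _ _ s")
proof -
  have iso: "conn ?G u v t \<longleftrightarrow> v = u \<and> t = 0" "conn ?H (\<phi> u) (\<phi> v) t \<longleftrightarrow> v = u \<and> t = 0"
    if "u \<in> X" "v \<in> X" "u \<notin> \<kappa> ` Vset n" for u v t
  proof -
    have "v = u \<and> t = 0" if "conn ?G u v t"
      by (rule conn_isolated[OF that]) (use local_edges_in \<open>u \<notin> \<kappa> ` Vset n\<close> in blast)
    then show "conn ?G u v t \<longleftrightarrow> v = u \<and> t = 0" using conn_refl[of ?G u] by auto
    have "\<phi> v = \<phi> u \<and> t = 0" if "conn ?H (\<phi> u) (\<phi> v) t"
      by (rule conn_isolated[OF that]) (use glued_edges_in \<phi>_out[OF \<open>u \<in> X\<close> \<open>u \<notin> \<kappa> ` Vset n\<close>] in blast)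
    then show "conn ?H (\<phi> u) (\<phi> v) t \<longleftrightarrow> v = u \<and> t = 0"
      using conn_refl[of ?H "\<phi> u"] inj_onD[OF inj_\<phi>] that by auto
  qed
  show ?thesis
  proof (cases "x \<in> \<kappa> ` Vset n")
    case x: True
    show ?thesis
    proof (cases "x' \<in> \<kappa> ` Vset n")
      case True
      then obtain a b where ab: "x = \<kappa> a" "x' = \<kappa> b" "a \<in> Vset n" "b \<in> Vset n" using x by blast
      then show ?thesis
        using conn_map_edges[OF inj_\<kappa>] conn_map_edges[OF inj_\<iota>] conn_star \<phi>_\<kappa> by simp
    next
      case False
      have "conn ?G x x' s \<longleftrightarrow> conn ?G x' x (- s)" "conn ?H (\<phi> x) (\<phi> x') s \<longleftrightarrow> conn ?H (\<phi> x') (\<phi> x) (- s)"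
        using conn_sym by force+
      then show ?thesis using iso[OF assms(2,1) False] by simp
    qed
  qed (use iso assms in simp)
qed

lemma conn_context:
  assumes "x \<in> X" "x' \<in> X"
  shows "conn (map_edges \<kappa> (tangle_graph n (tangle_star F F')) \<union> D) x x' s \<longleftrightarrow>
    conn (map_edges \<iota> (glue_graph n F F') \<union> map_edges \<phi> D) (\<phi> x) (\<phi> x') s"
proof (rule conn_subst[where X = X])
  show "u \<in> X \<and> v \<in> X" if "(u, v, g) \<in> map_edges \<kappa> (tangle_graph n (tangle_star F F'))" for u v g
    using local_edges_in[OF that] \<kappa>_in by blast
qed (use conn_local D_in assms in \<open>auto simp: map_edges_def\<close>)

text \<open>A loop of the refined picture either runs between the two factors without meeting the
  image of \<open>X\<close>, and is counted by \<open>loop_factor\<close>, or meets it and is a loop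
  of the coarse picture.\<close>

lemma loop_prod_context:
  assumes "B \<subseteq> X"
  shows "loop_prod (map_edges \<iota> (glue_graph n F F') \<union> map_edges \<phi> D) (\<iota> ` (UNIV \<times> Vset n) \<union> \<phi> ` X) (\<phi> ` B) =
    loop_factor F F' * loop_prod (map_edges \<kappa> (tangle_graph n (tangle_star F F')) \<union> D) X B"
    (is "loop_prod (?H \<union> ?D) ?Y _ = _ * loop_prod ?G X B")
proof -
  let ?Z = "UNIV \<times> Vset n :: (factor \<times> vertex) set"
  have "loop_prod (?H \<union> ?D) ?Y (\<phi> ` B) = loop_prod (?H \<union> ?D) ?Y (\<phi> ` X) * loop_prod ?G X B"
  proof (rule loop_prod_full)
    show "conn ?G x x' s \<longleftrightarrow> conn (?H \<union> ?D) (\<phi> x) (\<phi> x') s" if "x \<in> X" "x' \<in> X" for x x' s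
      using conn_context[OF that] .
    show "u \<in> X \<and> v \<in> X" if "(u, v, g) \<in> ?G" for u v g
      using that local_edges_in[of u v g] \<kappa>_in D_in[of u v g] by blast
    show "finite ?Y" using fin finite_factor_Vset by simp
  qed (use assms in auto)
  \<comment> \<open>The surrounding edges join only points of the image of \<open>X\<close>, so
    deleting them does not affect the loops that stay away from it.\<close>
  also have "loop_prod (?H \<union> ?D) ?Y (\<phi> ` X) = loop_prod ?H ?Y (\<phi> ` X)"
    by (rule loop_prod_add_edges) (use D_in in \<open>auto simp: map_edges_def\<close>)
  also have "\<dots> = loop_prod ?H (\<iota> ` ?Z) (\<iota> ` emb ` Vset n)"
  proof -
    have emb: "\<iota> ` emb ` Vset n \<subseteq> \<phi> ` X" using \<phi>_\<kappa> \<kappa>_in by (force simp: image_iff)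
    have out: "\<phi> ` X \<inter> \<iota> ` ?Z \<subseteq> \<iota> ` emb ` Vset n"
    proof
      fix y assume y: "y \<in> \<phi> ` X \<inter> \<iota> ` ?Z"
      then obtain x where x: "x \<in> X" "y = \<phi> x" by blast
      then have "x \<in> \<kappa> ` Vset n" using \<phi>_out y by blast
      then show "y \<in> \<iota> ` emb ` Vset n" using x \<phi>_\<kappa> by blast
    qed
    have comp: "component ?H y \<subseteq> \<iota> ` ?Z" if "y \<in> \<iota> ` ?Z" for y
    proof
      fix z assume "z \<in> component ?H y"
      then obtain s where "conn ?H y z s" by (auto simp: component_def)
      then show "z \<in> \<iota> ` ?Z" using that by (rule conn_closed) (use glued_edges_in in blast)
    qed
    have "{K \<in> component ?H ` ?Y. K \<inter> \<phi> ` X = {}} = {K \<in> component ?H ` (\<iota> ` ?Z). K \<inter> \<iota> ` emb ` Vset n = {}}"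
    proof (intro equalityI subsetI)
      fix K assume "K \<in> {K \<in> component ?H ` ?Y. K \<inter> \<phi> ` X = {}}"
      then obtain y where y: "y \<in> ?Y" "K = component ?H y" "K \<inter> \<phi> ` X = {}" by blast
      then have "y \<in> \<iota> ` ?Z" using component_refl[of y ?H] by blast
      then show "K \<in> {K \<in> component ?H ` (\<iota> ` ?Z). K \<inter> \<iota> ` emb ` Vset n = {}}" using y emb by blast
    next
      fix K assume "K \<in> {K \<in> component ?H ` (\<iota> ` ?Z). K \<inter> \<iota> ` emb ` Vset n = {}}"
      then obtain y where y: "y \<in> \<iota> ` ?Z" "K = component ?H y" "K \<inter> \<iota> ` emb ` Vset n = {}" by blast
      then have "K \<inter> \<phi> ` X = {}" using comp[OF y(1)] out by blast
      then show "K \<in> {K \<in> component ?H ` ?Y. K \<inter> \<phi> ` X = {}}" using y by blast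
    qed
    then show ?thesis by (simp only: loop_prod_def)
  qed
  also have "\<dots> = loop_prod (glue_graph n F F') ?Z (emb ` Vset n)"
  proof (rule loop_prod_equiv)
    show "emb ` Vset n \<subseteq> ?Z" using emb_image by blast
    show "\<exists>x\<in>?Z. \<exists>s. conn ?H y (\<iota> x) s" if "y \<in> \<iota> ` ?Z" for y
      using that conn_refl[of ?H y] by blast
    show "u \<in> ?Z \<and> v \<in> ?Z" if "(u, v, g) \<in> glue_graph n F F'" for u v g
      using glue_graph_in[OF F F' that] .
  qed (use conn_map_edges[OF inj_\<iota>] finite_factor_Vset in simp_all)
  finally show ?thesis by (simp add: loop_factor_eq)
qed

end

section \<open>Cyclicity of the trace\<close>

text \<open>Unlike in \<open>glue_graph\<close> the outer levels are glued too, which makes the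
  construction symmetric in the two factors.\<close>

definition cyclic_graph :: "nat \<Rightarrow> tangle \<Rightarrow> tangle \<Rightarrow> ((factor \<times> vertex) \<times> (factor \<times> vertex) \<times> int) set" where
  "cyclic_graph n F F' = {(x, mate2 F F' x, wt2 F F' x) | x. snd x \<in> Vset n} \<union>
     {(x, flip2 x, 0) | x. snd x \<in> Vset n}"

lemma flip2_emb: "x \<in> Vset n \<Longrightarrow> flip2 (emb x) = emb (flipv x)"
  by (auto simp: flip2_def emb_def flipv_def Vset_def)

lemma cyclic_graph_eq:
  "cyclic_graph n F F' = glue_graph n F F' \<union> map_edges emb {(x, flipv x, 0) | x. x \<in> Vset n}"
proof -
  have "map_edges emb {(x, flipv x, 0) | x. x \<in> Vset n} = {(emb x, flip2 (emb x), 0) | x. x \<in> Vset n}"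
    unfolding map_edges_def by (force simp: flip2_emb)
  also have "\<dots> = {(y, flip2 y, 0) | y. y \<in> emb ` Vset n}" by blast
  also have "\<dots> = {(y, flip2 y, 0) | y. y \<in> UNIV \<times> Vset n - interior n}" unfolding emb_image ..
  finally show ?thesis
    unfolding cyclic_graph_def glue_graph_def by (auto simp: interior_def mem_Times_iff)
qed

text \<open>Taken as surroundings, the closing edges of the product refine
  \<open>closure_graph\<close> to the cyclic gluing, whose loops are those split off by the product
  together with those of the closure.\<close>

lemma trace_star:
  assumes F: "F \<in> arrow_tangles n" and F': "F' \<in> arrow_tangles n"
  shows "loop_factor F F' * tangle_trace (tangle_star F F') = loop_prod (cyclic_graph n F F') (UNIV \<times> Vset n) {}"
proof -
  let ?D = "{(x, flipv x, 0) | x. x \<in> Vset n} :: (vertex \<times> vertex \<times> int) set"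
  interpret star_context n F F' id id emb "Vset n" ?D
    by unfold_locales
      (use F F' finite_Vset in \<open>auto simp: inj_on_def emb_def split: if_splits intro: flipv_in\<close>)
  interpret C: tangle_closure n "tangle_star F F'" by unfold_locales (rule star_in)
  have id: "map_edges id G = G" for G :: "('d \<times> 'd \<times> int) set"
    unfolding map_edges_def by force
  have Y: "id ` (UNIV \<times> Vset n) \<union> emb ` Vset n = UNIV \<times> Vset n"
    unfolding emb_image by auto
  show ?thesis
    using loop_prod_context[of "{}"] unfolding Y id cyclic_graph_eq C.tangle_trace_eq closure_graph_def by simp
qed

text \<open>Exchanging the names of the factors is an isomorphism of cyclic gluings.\<close>

lemma trace_star_commute:
  assumes F: "F \<in> arrow_tangles n" and F': "F' \<in> arrow_tangles n"
  shows "loop_factor F F' * tangle_trace (tangle_star F F') = loop_factor F' F * tangle_trace (tangle_star F' F)"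
proof -
  define \<sigma> where "\<sigma> x = (other (fst x), snd x)" for x :: "factor \<times> vertex"
  have \<sigma>\<sigma>: "\<sigma> (\<sigma> x) = x" for x by (simp add: \<sigma>_def)
  have edge: "(\<sigma> u, \<sigma> v, g) \<in> cyclic_graph n B A" if "(u, v, g) \<in> cyclic_graph n A B" for u v g A B
  proof -
    have "pick B A (other t) = pick A B t" for t by (cases t) auto
    then have "mate2 B A (\<sigma> x) = \<sigma> (mate2 A B x)" "wt2 B A (\<sigma> x) = wt2 A B x" "flip2 (\<sigma> x) = \<sigma> (flip2 x)"
      "snd (\<sigma> x) = snd x" for x
      by (simp_all add: mate2_def wt2_def flip2_def \<sigma>_def)
    then show ?thesis using that unfolding cyclic_graph_def by (smt (verit) UnE UnI1 UnI2 mem_Collect_eq prod.inject)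
  qed
  have "loop_prod (cyclic_graph n F' F) (UNIV \<times> Vset n) (\<sigma> ` {}) = loop_prod (cyclic_graph n F F') (UNIV \<times> Vset n) {}"
  proof (rule loop_prod_equiv)
    show "conn (cyclic_graph n F F') x x' s \<longleftrightarrow> conn (cyclic_graph n F' F) (\<sigma> x) (\<sigma> x') s" for x x' s
    proof (rule conn_retract[where \<psi> = \<sigma> and \<delta> = "\<lambda>_. 0"])
      show "conn (cyclic_graph n F' F) (\<sigma> u) (\<sigma> v) g" if "(u, v, g) \<in> cyclic_graph n F F'" for u v g
        using edge[OF that] by (rule conn_edge)
      show "conn (cyclic_graph n F F') (\<sigma> u) (\<sigma> v) (g + 0 - 0)" if "(u, v, g) \<in> cyclic_graph n F' F" for u v g
        using conn_edge[OF edge[OF that]] by simp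
    qed (simp_all add: \<sigma>\<sigma>)
    show "\<sigma> ` (UNIV \<times> Vset n) \<subseteq> UNIV \<times> Vset n" by (auto simp: \<sigma>_def)
    show "\<exists>x\<in>UNIV \<times> Vset n. \<exists>s. conn (cyclic_graph n F' F) y (\<sigma> x) s" if "y \<in> UNIV \<times> Vset n" for y
      using that conn_refl by (intro bexI[of _ "\<sigma> y"] exI[of _ 0]) (auto simp: \<sigma>\<sigma>, auto simp: \<sigma>_def)
    have "pick F F' t \<in> arrow_tangles n" for t using F F' by (cases t) auto
    from mate_in[OF this] have "mate (pick F F' t) x \<in> Vset n" if "x \<in> Vset n" for t x using that .
    then show "u \<in> UNIV \<times> Vset n \<and> v \<in> UNIV \<times> Vset n" if "(u, v, g) \<in> cyclic_graph n F F'" for u v g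
      using that flipv_in unfolding cyclic_graph_def
      by (auto simp: mate2_def flip2_def mem_Times_iff)
  qed (use finite_factor_Vset in auto)
  then show ?thesis using trace_star[OF F F'] trace_star[OF F' F] by simp
qed

section \<open>Associativity\<close>

lemma glue_graph_pieces:
  "glue_graph n F F' = map_edges (Pair First) (tangle_graph n F) \<union> map_edges (Pair Second) (tangle_graph n F') \<union>
     {((First, 1, k), (Second, 0, k), 0) | k. 1 \<le> k \<and> k \<le> n} \<union> {((Second, 0, k), (First, 1, k), 0) | k. 1 \<le> k \<and> k \<le> n}"
proof -
  have "{(x, mate2 F F' x, wt2 F F' x) | x. snd x \<in> Vset n} =
      map_edges (Pair First) (tangle_graph n F) \<union> map_edges (Pair Second) (tangle_graph n F')" (is "?L = ?R1 \<union> ?R2")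
  proof (intro equalityI subsetI)
    fix e assume "e \<in> ?L"
    then obtain t x where "e = ((t, x), mate2 F F' (t, x), wt2 F F' (t, x))" "x \<in> Vset n" by auto
    then show "e \<in> ?R1 \<union> ?R2"
      by (cases t) (auto simp: mate2_def wt2_def mem_tangle_graph intro!: map_edgesI)
  next
    fix e assume "e \<in> ?R1 \<union> ?R2"
    then obtain t x where "x \<in> Vset n" "e = ((t, x), mate2 F F' (t, x), wt2 F F' (t, x))"
      unfolding map_edges_def tangle_graph_def by (force simp: mate2_def wt2_def)
    then show "e \<in> ?L" by force
  qed
  moreover have "interior n = (\<lambda>k. (First, 1, k)) ` {1..n} \<union> (\<lambda>k. (Second, 0, k)) ` {1..n}" (is "_ = ?I")
  proof (intro equalityI subsetI)
    fix x assume "x \<in> interior n"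
    then show "x \<in> ?I" by (cases x; cases "fst x") (auto simp: interior_def Vset_def)
  qed (auto simp: interior_def Vset_def)
  then have "{(x, flip2 x, 0 :: int) | x. x \<in> interior n} =
      {((First, 1, k), (Second, 0, k), 0) | k. 1 \<le> k \<and> k \<le> n} \<union> {((Second, 0, k), (First, 1, k), 0) | k. 1 \<le> k \<and> k \<le> n}"
    by (auto simp: flip2_def flipv_def)
  ultimately show ?thesis unfolding glue_graph_def by (simp only: Un_assoc)
qed

lemma map_edges_Un: "map_edges \<phi> (G \<union> H) = map_edges \<phi> G \<union> map_edges \<phi> H"
  unfolding map_edges_def by (rule image_Un)

lemma map_edges_comp: "map_edges \<phi> (map_edges \<psi> G) = map_edges (\<lambda>x. \<phi> (\<psi> x)) G"
  unfolding map_edges_def image_image by (rule image_cong) auto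

lemma map_edges_Collect:
  "map_edges \<phi> {(f k, g k, c) | k. P k} = {(\<phi> (f k), \<phi> (g k), c) | k. P k}"
  unfolding map_edges_def by force

text \<open>Three tangles glued in a row, without brackets; both ways of multiplying them refine to
  this graph.\<close>

definition triple_graph :: "nat \<Rightarrow> tangle \<Rightarrow> tangle \<Rightarrow> tangle \<Rightarrow> ((nat \<times> vertex) \<times> (nat \<times> vertex) \<times> int) set" where
  "triple_graph n F F' F'' = map_edges (Pair 0) (tangle_graph n F) \<union> map_edges (Pair 1) (tangle_graph n F') \<union>
     map_edges (Pair 2) (tangle_graph n F'') \<union>
     ({((0, 1, k), (1, 0, k), 0) | k. 1 \<le> k \<and> k \<le> n} \<union> {((1, 0, k), (0, 1, k), 0) | k. 1 \<le> k \<and> k \<le> n}) \<union>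
     ({((1, 1, k), (2, 0, k), 0) | k. 1 \<le> k \<and> k \<le> n} \<union> {((2, 0, k), (1, 1, k), 0) | k. 1 \<le> k \<and> k \<le> n})"

text \<open>One walk per vertex suffices, since in the graph of a single tangle nothing but the mate
  can be reached from \<open>x\<close> besides \<open>x\<close> itself.\<close>

lemma tangle_eqI_conn:
  assumes F: "F \<in> arrow_tangles n" and G: "G \<in> arrow_tangles n"
    and "\<And>x. x \<in> Vset n \<Longrightarrow> conn (tangle_graph n F) x (mate G x) (wt G x)"
  shows "F = G"
proof (rule tangle_eqI[OF F G])
  fix x assume x: "x \<in> Vset n"
  then show "mate F x = mate G x \<and> wt F x = wt G x"
    using assms(3)[OF x] conn_tangle_graph[OF F x] mate_neq[OF G x] by auto
qed

context
  fixes n :: nat and F F' F'' :: tangle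
  assumes F: "F \<in> arrow_tangles n" and F': "F' \<in> arrow_tangles n" and F'': "F'' \<in> arrow_tangles n"
begin

definition ends :: "vertex \<Rightarrow> nat \<times> vertex" where
  "ends x = (if fst x = 0 then 0 else 2, x)"

text \<open>The surroundings of the inner product are the third tangle and its gluing.
  \<open>\<phi>\<close> sends the second factor of the coarse picture to copy 2 and resolves the
  first one into copies 0 and 1.\<close>

lemma star_left:
  shows "x \<in> Vset n \<Longrightarrow> y \<in> Vset n \<Longrightarrow>
      conn (tangle_graph n (tangle_star (tangle_star F F') F'')) x y s \<longleftrightarrow>
      conn (triple_graph n F F' F'') (ends x) (ends y) s"
    and "loop_factor F F' * loop_factor (tangle_star F F') F'' =
      loop_prod (triple_graph n F F' F'') ({0, 1, 2} \<times> Vset n) (ends ` Vset n)"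
proof -
  let ?A = "tangle_star F F'"
  define \<iota> :: "factor \<times> vertex \<Rightarrow> nat \<times> vertex" where "\<iota> p = (if fst p = First then 0 else 1, snd p)" for p
  define \<phi> :: "factor \<times> vertex \<Rightarrow> nat \<times> vertex" where
    "\<phi> p = (if fst p = First then \<iota> (emb (snd p)) else (2, snd p))" for p
  define D where "D = map_edges (Pair Second) (tangle_graph n F'') \<union>
     {((First, 1, k), (Second, 0, k), 0) | k. 1 \<le> k \<and> k \<le> n} \<union> {((Second, 0, k), (First, 1, k), 0 :: int) | k. 1 \<le> k \<and> k \<le> n}"
  interpret A: tangle_pair n F F' using F F' by unfold_locales
  interpret AB: tangle_pair n ?A F'' using A.star_in F'' by unfold_locales
  interpret star_context n F F' \<iota> "Pair First" \<phi> "UNIV \<times> Vset n" D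
  proof
    show "inj \<iota>"
      by (rule injI) (auto simp: \<iota>_def prod_eq_iff split: if_splits, (metis factor.exhaust)+)
    show "inj_on \<phi> (UNIV \<times> Vset n)"
      by (rule inj_onI) (auto simp: \<phi>_def \<iota>_def emb_def split: if_splits, (metis factor.exhaust)+)
    show "\<phi> x \<notin> \<iota> ` (UNIV \<times> Vset n)" if "x \<in> UNIV \<times> Vset n" "x \<notin> Pair First ` Vset n" for x
    proof -
      have "fst x \<noteq> First" using that by (cases x) auto
      then show ?thesis by (auto simp: \<phi>_def \<iota>_def split: if_splits)
    qed
    show "u \<in> UNIV \<times> Vset n \<and> v \<in> UNIV \<times> Vset n" if "(u, v, g) \<in> D" for u v g
    proof -
      have "(u, v, g) \<in> glue_graph n ?A F''" using that unfolding D_def glue_graph_pieces by blast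
      then show ?thesis by (rule glue_graph_in[OF A.star_in F''])
    qed
  qed (auto simp: \<phi>_def finite_factor_Vset intro: injI)
  have G: "glue_graph n ?A F'' = map_edges (Pair First) (tangle_graph n ?A) \<union> D"
    unfolding glue_graph_pieces D_def by (simp only: Un_assoc)
  have T: "map_edges \<iota> (glue_graph n F F') \<union> map_edges \<phi> D = triple_graph n F F' F''"
    unfolding glue_graph_pieces D_def map_edges_Un map_edges_comp map_edges_Collect triple_graph_def
    by (simp add: \<phi>_def \<iota>_def emb_def) (simp only: Un_ac)
  have Y: "\<iota> ` (UNIV \<times> Vset n) \<union> \<phi> ` (UNIV \<times> Vset n) = {0, 1, 2} \<times> Vset n"
  proof (intro equalityI subsetI)
    fix y :: "nat \<times> vertex" assume "y \<in> {0, 1, 2} \<times> Vset n"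
    then obtain v where v: "v \<in> Vset n" "y = (0, v) \<or> y = (1, v) \<or> y = (2, v)" by auto
    moreover have "(0, v) = \<iota> (First, v)" "(1, v) = \<iota> (Second, v)" "(2, v) = \<phi> (Second, v)"
      by (simp_all add: \<iota>_def \<phi>_def)
    ultimately show "y \<in> \<iota> ` (UNIV \<times> Vset n) \<union> \<phi> ` (UNIV \<times> Vset n)"
      by (metis Un_iff UNIV_I image_eqI SigmaI)
  qed (auto simp: \<phi>_def \<iota>_def emb_def split: if_splits)
  have ends: "\<phi> (emb x) = ends x" if "x \<in> Vset n" for x
    using that by (auto simp: \<phi>_def \<iota>_def emb_def ends_def)
  have emb_in: "emb x \<in> UNIV \<times> Vset n" if "x \<in> Vset n" for x
    using that by (simp add: emb_def)
  show "conn (tangle_graph n (tangle_star ?A F'')) x y s \<longleftrightarrow> conn (triple_graph n F F' F'') (ends x) (ends y) s"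
    if "x \<in> Vset n" "y \<in> Vset n"
    using AB.conn_star[OF that] conn_context[OF emb_in emb_in, OF that] that by (simp add: ends flip: G T)
  have "\<phi> ` emb ` Vset n = ends ` Vset n" using ends by (simp add: image_image)
  then show "loop_factor F F' * loop_factor ?A F'' =
      loop_prod (triple_graph n F F' F'') ({0, 1, 2} \<times> Vset n) (ends ` Vset n)"
    using loop_prod_context[OF image_subsetI[of "Vset n" emb, OF emb_in]] unfolding T Y G[symmetric] AB.loop_factor_eq by simp
qed

text \<open>The mirror image: now the first tangle forms the surroundings, and the second factor is
  resolved into copies 1 and 2.\<close>

lemma star_right:
  shows "x \<in> Vset n \<Longrightarrow> y \<in> Vset n \<Longrightarrow>
      conn (tangle_graph n (tangle_star F (tangle_star F' F''))) x y s \<longleftrightarrow>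
      conn (triple_graph n F F' F'') (ends x) (ends y) s"
    and "loop_factor F' F'' * loop_factor F (tangle_star F' F'') =
      loop_prod (triple_graph n F F' F'') ({0, 1, 2} \<times> Vset n) (ends ` Vset n)"
proof -
  let ?A = "tangle_star F' F''"
  define \<iota> :: "factor \<times> vertex \<Rightarrow> nat \<times> vertex" where "\<iota> p = (if fst p = First then 1 else 2, snd p)" for p
  define \<phi> :: "factor \<times> vertex \<Rightarrow> nat \<times> vertex" where
    "\<phi> p = (if fst p = First then (0, snd p) else \<iota> (emb (snd p)))" for p
  define D where "D = map_edges (Pair First) (tangle_graph n F) \<union>
     {((First, 1, k), (Second, 0, k), 0) | k. 1 \<le> k \<and> k \<le> n} \<union> {((Second, 0, k), (First, 1, k), 0 :: int) | k. 1 \<le> k \<and> k \<le> n}"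
  interpret A: tangle_pair n F' F'' using F' F'' by unfold_locales
  interpret AB: tangle_pair n F ?A using A.star_in F by unfold_locales
  interpret star_context n F' F'' \<iota> "Pair Second" \<phi> "UNIV \<times> Vset n" D
  proof
    show "inj \<iota>"
      by (rule injI) (auto simp: \<iota>_def prod_eq_iff split: if_splits, (metis factor.exhaust)+)
    show "inj_on \<phi> (UNIV \<times> Vset n)"
      by (rule inj_onI) (auto simp: \<phi>_def \<iota>_def emb_def split: if_splits, (metis factor.exhaust)+)
    show "\<phi> x \<notin> \<iota> ` (UNIV \<times> Vset n)" if "x \<in> UNIV \<times> Vset n" "x \<notin> Pair Second ` Vset n" for x
    proof -
      have "fst x = First" using that by (cases x; cases "fst x") auto
      then show ?thesis by (auto simp: \<phi>_def \<iota>_def split: if_splits)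
    qed
    show "u \<in> UNIV \<times> Vset n \<and> v \<in> UNIV \<times> Vset n" if "(u, v, g) \<in> D" for u v g
    proof -
      have "(u, v, g) \<in> glue_graph n F ?A" using that unfolding D_def glue_graph_pieces by blast
      then show ?thesis by (rule glue_graph_in[OF F A.star_in])
    qed
  qed (auto simp: \<phi>_def finite_factor_Vset intro: injI)
  have G: "glue_graph n F ?A = map_edges (Pair Second) (tangle_graph n ?A) \<union> D"
    unfolding glue_graph_pieces D_def by (simp only: Un_ac)
  have T: "map_edges \<iota> (glue_graph n F' F'') \<union> map_edges \<phi> D = triple_graph n F F' F''"
    unfolding glue_graph_pieces D_def map_edges_Un map_edges_comp map_edges_Collect triple_graph_def
    by (simp add: \<phi>_def \<iota>_def emb_def) (simp only: Un_ac)
  have Y: "\<iota> ` (UNIV \<times> Vset n) \<union> \<phi> ` (UNIV \<times> Vset n) = {0, 1, 2} \<times> Vset n"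
  proof (intro equalityI subsetI)
    fix y :: "nat \<times> vertex" assume "y \<in> {0, 1, 2} \<times> Vset n"
    then obtain v where v: "v \<in> Vset n" "y = (0, v) \<or> y = (1, v) \<or> y = (2, v)" by auto
    moreover have "(1, v) = \<iota> (First, v)" "(2, v) = \<iota> (Second, v)" "(0, v) = \<phi> (First, v)"
      by (simp_all add: \<iota>_def \<phi>_def)
    ultimately show "y \<in> \<iota> ` (UNIV \<times> Vset n) \<union> \<phi> ` (UNIV \<times> Vset n)"
      by (metis Un_iff UNIV_I image_eqI SigmaI)
  qed (auto simp: \<phi>_def \<iota>_def emb_def split: if_splits)
  have ends: "\<phi> (emb x) = ends x" if "x \<in> Vset n" for x
    using that by (auto simp: \<phi>_def \<iota>_def emb_def ends_def)
  have emb_in: "emb x \<in> UNIV \<times> Vset n" if "x \<in> Vset n" for x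
    using that by (simp add: emb_def)
  show "conn (tangle_graph n (tangle_star F ?A)) x y s \<longleftrightarrow> conn (triple_graph n F F' F'') (ends x) (ends y) s"
    if "x \<in> Vset n" "y \<in> Vset n"
    using AB.conn_star[OF that] conn_context[OF emb_in emb_in, OF that] that by (simp add: ends flip: G T)
  have "\<phi> ` emb ` Vset n = ends ` Vset n" using ends by (simp add: image_image)
  then show "loop_factor F' F'' * loop_factor F ?A =
      loop_prod (triple_graph n F F' F'') ({0, 1, 2} \<times> Vset n) (ends ` Vset n)"
    using loop_prod_context[OF image_subsetI[of "Vset n" emb, OF emb_in]] unfolding T Y G[symmetric] AB.loop_factor_eq by simp
qed

end

lemma star_in_arrow: "F \<in> arrow_tangles n \<Longrightarrow> F' \<in> arrow_tangles n \<Longrightarrow> tangle_star F F' \<in> arrow_tangles n"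
  using tangle_pair.star_in by (simp add: tangle_pair_def)

lemma star_assoc:
  assumes "F \<in> arrow_tangles n" "F' \<in> arrow_tangles n" "F'' \<in> arrow_tangles n"
  shows "tangle_star (tangle_star F F') F'' = tangle_star F (tangle_star F' F'')"
    and "loop_factor F F' * loop_factor (tangle_star F F') F'' = loop_factor F' F'' * loop_factor F (tangle_star F' F'')"
proof -
  let ?R = "tangle_star F (tangle_star F' F'')"
  have R: "?R \<in> arrow_tangles n" using assms star_in_arrow by blast
  show "tangle_star (tangle_star F F') F'' = ?R"
  proof (rule tangle_eqI_conn[OF _ R])
    show "conn (tangle_graph n (tangle_star (tangle_star F F') F'')) x (mate ?R x) (wt ?R x)" if "x \<in> Vset n" for x
      unfolding star_left(1)[OF assms that mate_in[OF R that]]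
      unfolding star_right(1)[OF assms that mate_in[OF R that], symmetric]
      by (simp add: conn_tangle_graph[OF R that])
  qed (use assms star_in_arrow in blast)
  show "loop_factor F F' * loop_factor (tangle_star F F') F'' = loop_factor F' F'' * loop_factor F (tangle_star F' F'')"
    using star_left(2)[OF assms] star_right(2)[OF assms] by simp
qed

section \<open>Products with elementary tangles\<close>

text \<open>Reduces equality of tangles to case distinctions on explicit formulas; off
  \<open>Vset n\<close> the functions \<open>m\<close> and \<open>w\<close> are arbitrary.\<close>

definition represents :: "nat \<Rightarrow> tangle \<Rightarrow> (vertex \<Rightarrow> vertex) \<Rightarrow> (vertex \<Rightarrow> int) \<Rightarrow> bool" where
  "represents n F m w \<longleftrightarrow> F \<in> arrow_tangles n \<and> (\<forall>x\<in>Vset n. mate F x = m x \<and> wt F x = w x)"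

lemma represents_refl: "F \<in> arrow_tangles n \<Longrightarrow> represents n F (mate F) (wt F)"
  by (simp add: represents_def)

lemma represents_eq:
  assumes "represents n F m w" "represents n G m' w'"
    and "\<And>x. x \<in> Vset n \<Longrightarrow> m x = m' x \<and> w x = w' x"
  shows "F = G"
  using assms by (intro tangle_eqI[of F n G]) (auto simp: represents_def)

lemma glue_First: "x \<in> Vset n \<Longrightarrow> conn (glue_graph n F F') (First, x) (First, mate F x) (wt F x)"
  by (rule conn_edge) (simp add: glue_graph_pieces mem_tangle_graph map_edgesI)

lemma glue_Second: "x \<in> Vset n \<Longrightarrow> conn (glue_graph n F F') (Second, x) (Second, mate F' x) (wt F' x)"
  by (rule conn_edge) (simp add: glue_graph_pieces mem_tangle_graph map_edgesI)

lemma glue_flip: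
  assumes "1 \<le> k" "k \<le> n"
  shows "conn (glue_graph n F F') (First, 1, k) (Second, 0, k) 0" "conn (glue_graph n F F') (Second, 0, k) (First, 1, k) 0"
  using assms by (auto simp: glue_graph_pieces intro!: conn_edge)

lemma emb_simps [simp]: "emb (0, k) = (First, 0, k)" "emb (Suc 0, k) = (Second, 1, k)"
  by (simp_all add: emb_def)

lemma star_mateI:
  assumes "F \<in> arrow_tangles n" "F' \<in> arrow_tangles n" "x \<in> Vset n" "y \<in> Vset n" "y \<noteq> x"
    and "conn (glue_graph n F F') (emb x) (emb y) s"
  shows "mate (tangle_star F F') x = y \<and> wt (tangle_star F F') x = s"
proof -
  interpret tangle_pair n F F' using assms by unfold_locales
  show ?thesis
    using conn_star[OF assms(3,4), of s] assms(5,6) conn_tangle_graph[OF star_in assms(3)] by auto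
qed

text \<open>\<open>P\<close> marks enough ends to touch every strand of \<open>G\<close>; a strand
  seen only from its other end is handled by reversing the walk.\<close>

lemma star_eqI:
  assumes F: "F \<in> arrow_tangles n" and F': "F' \<in> arrow_tangles n" and G: "G \<in> arrow_tangles n"
    and top: "\<And>x. x \<in> Vset n \<Longrightarrow> P x \<Longrightarrow> conn (glue_graph n F F') (emb x) (emb (mate G x)) (wt G x)"
    and P: "\<And>x. x \<in> Vset n \<Longrightarrow> P x \<or> P (mate G x)"
  shows "tangle_star F F' = G"
proof (rule tangle_eqI[OF star_in_arrow[OF F F'] G])
  fix x assume x: "x \<in> Vset n"
  have "conn (glue_graph n F F') (emb x) (emb (mate G x)) (wt G x)"
  proof (cases "P x")
    case False
    then have "conn (glue_graph n F F') (emb (mate G x)) (emb x) (- wt G x)"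
      using top[OF mate_in[OF G x]] P[OF x] mate_mate[OF G x] wt_mate[OF G x] by simp
    from conn_sym[OF this] show ?thesis by simp
  qed (use top x in simp)
  then show "mate (tangle_star F F') x = mate G x \<and> wt (tangle_star F F') x = wt G x"
    using star_mateI[OF F F' x mate_in[OF G x] mate_neq[OF G x]] by blast
qed

text \<open>Each glued pair contains one point at level 1 of the first factor, so loops are excluded
  once all of these are joined to free ends.\<close>

lemma loop_factor_eq_1:
  assumes F: "F \<in> arrow_tangles n" and F': "F' \<in> arrow_tangles n"
    and conn: "\<And>k. 1 \<le> k \<Longrightarrow> k \<le> n \<Longrightarrow> \<exists>b\<in>Vset n. \<exists>s. conn (glue_graph n F F') (emb b) (First, 1, k) s"
  shows "loop_factor F F' = 1"
proof -
  interpret tangle_pair n F F' using F F' by unfold_locales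
  show ?thesis
    unfolding loop_factor_eq
  proof (rule loop_prod_eq_1)
    fix y :: "factor \<times> vertex" assume y: "y \<in> UNIV \<times> Vset n"
    show "\<exists>b\<in>emb ` Vset n. \<exists>s. conn (glue_graph n F F') y b s"
    proof (cases "y \<in> interior n")
      case False
      then have "y \<in> emb ` Vset n" using y emb_image by blast
      then show ?thesis using conn_refl[of "glue_graph n F F'" y] by blast
    next
      case True
      define k where "k = snd (snd y)"
      have k: "1 \<le> k" "k \<le> n" using True by (auto simp: interior_def Vset_def k_def)
      have "y = (First, 1, k) \<or> y = (Second, 0, k)"
        using True by (cases y; cases "fst y") (auto simp: interior_def Vset_def k_def)
      then have t: "conn (glue_graph n F F') y (First, 1, k) 0"
        using glue_flip(2)[OF k, of F F'] conn_refl[of "glue_graph n F F'" y] by auto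
      obtain b s where b: "b \<in> Vset n" "conn (glue_graph n F F') (emb b) (First, 1, k) s"
        using conn[OF k] by blast
      show ?thesis using conn_trans[OF conn_sym[OF b(2)] t] b(1) by blast
    qed
  qed
qed

section \<open>Multiplication by permutation tangles\<close>

definition mperm :: "(nat \<Rightarrow> nat) \<Rightarrow> vertex \<Rightarrow> vertex" where
  "mperm \<pi> x = (1 - fst x, \<pi> (snd x))"

definition twist :: "nat \<Rightarrow> (nat \<Rightarrow> nat) \<Rightarrow> vertex \<Rightarrow> vertex" where
  "twist a \<pi> x = (if fst x = a then (a, \<pi> (snd x)) else x)"

text \<open>\<open>mperm\<close> applies \<open>\<pi>\<close> on both levels, where a general
  permutation would use its inverse on one of them. The cases that occur are the identity and
  adjacent transpositions.\<close>

definition invol :: "nat \<Rightarrow> (nat \<Rightarrow> nat) \<Rightarrow> bool" where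
  "invol n \<pi> \<longleftrightarrow> (\<forall>k. 1 \<le> k \<and> k \<le> n \<longrightarrow> 1 \<le> \<pi> k \<and> \<pi> k \<le> n \<and> \<pi> (\<pi> k) = k)"

context
  fixes n :: nat and P F :: tangle and \<pi> :: "nat \<Rightarrow> nat" and m :: "vertex \<Rightarrow> vertex" and w :: "vertex \<Rightarrow> int"
  assumes P: "represents n P (mperm \<pi>) (\<lambda>_. 0)" and \<pi>: "invol n \<pi>" and F: "represents n F m w"
begin

lemma twist_in: "x \<in> Vset n \<Longrightarrow> twist a \<pi> x \<in> Vset n"
  and twist_twist: "x \<in> Vset n \<Longrightarrow> twist a \<pi> (twist a \<pi> x) = x"
  using \<pi> by (cases x; auto simp: twist_def invol_def mem_Vset)+

lemma P_in: "P \<in> arrow_tangles n" and F_in: "F \<in> arrow_tangles n"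
  using P F by (auto simp: represents_def)

lemma m_props: "x \<in> Vset n \<Longrightarrow> m x \<in> Vset n" "x \<in> Vset n \<Longrightarrow> m x \<noteq> x"
  using F mate_in[OF F_in, of x] mate_neq[OF F_in, of x] by (auto simp: represents_def)

text \<open>Strands of gain 0 can be slid away: multiplying by the permutation tangle only renames
  the ends on one level. \<open>\<tau>\<close> tells which factor is \<open>F\<close>, so that left
  and right multiplication share the argument.\<close>

lemma twisted_star:
  assumes A: "A \<in> arrow_tangles n" and B: "B \<in> arrow_tangles n" and F_eq: "pick A B \<tau> = F"
    and slide: "\<And>x. x \<in> Vset n \<Longrightarrow> conn (glue_graph n A B) (emb x) (\<tau>, twist a \<pi> x) 0"
  shows "represents n (tangle_star A B) (\<lambda>x. twist a \<pi> (m (twist a \<pi> x))) (\<lambda>x. w (twist a \<pi> x))"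
proof -
  let ?t = "twist a \<pi>" and ?G = "glue_graph n A B"
  have conn: "conn ?G (emb x) (emb (?t (m (?t x)))) (w (?t x))" if x: "x \<in> Vset n" for x
  proof -
    have tx: "?t x \<in> Vset n" and mtx: "m (?t x) \<in> Vset n" using x twist_in m_props by auto
    have 1: "conn ?G (\<tau>, ?t x) (\<tau>, m (?t x)) (w (?t x))"
      using glue_First[OF tx, of A B] glue_Second[OF tx, of A B] F tx F_eq
      by (cases \<tau>) (auto simp: represents_def)
    have 2: "conn ?G (\<tau>, m (?t x)) (emb (?t (m (?t x)))) 0"
      using conn_sym[OF slide[OF twist_in[OF mtx]], of a] twist_twist[OF mtx, of a] by simp
    from conn_trans[OF 2 conn_trans[OF 1 slide[OF x]]] show ?thesis by simp
  qed
  have neq: "?t (m (?t x)) \<noteq> x" if x: "x \<in> Vset n" for x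
    using m_props(2)[OF twist_in[OF x]] twist_twist m_props(1)[OF twist_in[OF x]] by metis
  show ?thesis
    unfolding represents_def
  proof (intro conjI ballI)
    show "tangle_star A B \<in> arrow_tangles n" by (rule star_in_arrow[OF A B])
    fix x assume x: "x \<in> Vset n"
    from star_mateI[OF A B x twist_in[OF m_props(1)[OF twist_in[OF x]]] neq[OF x] conn[OF x]]
    show "mate (tangle_star A B) x = ?t (m (?t x))" "wt (tangle_star A B) x = w (?t x)" by auto
  qed
qed

lemma perm_star_left:
  "represents n (tangle_star P F) (\<lambda>x. twist 0 \<pi> (m (twist 0 \<pi> x))) (\<lambda>x. w (twist 0 \<pi> x))"
  "loop_factor P F = 1"
proof -
  let ?G = "glue_graph n P F"
  have vert: "conn ?G (First, 0, k) (First, 1, \<pi> k) 0" if "1 \<le> k" "k \<le> n" for k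
    using glue_First[of "(0, k)" n P F] P that by (auto simp: represents_def mperm_def mem_Vset)
  have "conn ?G (emb x) (Second, twist 0 \<pi> x) 0" if x: "x \<in> Vset n" for x
  proof (cases "fst x = 0")
    case True
    then obtain k where k: "x = (0, k)" "1 \<le> k" "k \<le> n" using x by (cases x) (auto simp: mem_Vset)
    then have "1 \<le> \<pi> k" "\<pi> k \<le> n" using \<pi> by (auto simp: invol_def)
    from conn_trans[OF glue_flip(1)[OF this] vert[OF k(2,3)]] show ?thesis by (simp add: k twist_def)
  next
    case False
    then show ?thesis using conn_refl by (simp add: emb_def twist_def)
  qed
  from twisted_star[OF P_in F_in _ this]
  show "represents n (tangle_star P F) (\<lambda>x. twist 0 \<pi> (m (twist 0 \<pi> x))) (\<lambda>x. w (twist 0 \<pi> x))" by simp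
  show "loop_factor P F = 1"
  proof (rule loop_factor_eq_1[OF P_in F_in])
    fix k assume k: "1 \<le> k" "k \<le> n"
    then have k': "1 \<le> \<pi> k" "\<pi> k \<le> n" "\<pi> (\<pi> k) = k" using \<pi> by (auto simp: invol_def)
    then show "\<exists>b\<in>Vset n. \<exists>s. conn ?G (emb b) (First, 1, k) s"
      using vert[OF k'(1,2)] by (intro bexI[of _ "(0, \<pi> k)"] exI[of _ 0]) (auto simp: mem_Vset)
  qed
qed

lemma perm_star_right:
  "represents n (tangle_star F P) (\<lambda>x. twist 1 \<pi> (m (twist 1 \<pi> x))) (\<lambda>x. w (twist 1 \<pi> x))"
  "loop_factor F P = 1"
proof -
  let ?G = "glue_graph n F P"
  have vert: "conn ?G (Second, 1, k) (Second, 0, \<pi> k) 0" if "1 \<le> k" "k \<le> n" for k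
    using glue_Second[of "(1, k)" n F P] P that by (auto simp: represents_def mperm_def mem_Vset)
  have "conn ?G (emb x) (First, twist 1 \<pi> x) 0" if x: "x \<in> Vset n" for x
  proof (cases "fst x = 0")
    case False
    then obtain k where k: "x = (1, k)" "1 \<le> k" "k \<le> n" using x by (cases x) (auto simp: mem_Vset)
    then have "1 \<le> \<pi> k" "\<pi> k \<le> n" using \<pi> by (auto simp: invol_def)
    from conn_trans[OF glue_flip(2)[OF this] vert[OF k(2,3)]] show ?thesis by (simp add: k twist_def)
  next
    case True
    then show ?thesis using conn_refl by (simp add: emb_def twist_def)
  qed
  from twisted_star[OF F_in P_in _ this]
  show "represents n (tangle_star F P) (\<lambda>x. twist 1 \<pi> (m (twist 1 \<pi> x))) (\<lambda>x. w (twist 1 \<pi> x))" by simp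
  show "loop_factor F P = 1"
  proof (rule loop_factor_eq_1[OF F_in P_in])
    fix k assume k: "1 \<le> k" "k \<le> n"
    then have k': "1 \<le> \<pi> k" "\<pi> k \<le> n" "\<pi> (\<pi> k) = k" using \<pi> by (auto simp: invol_def)
    have "conn ?G (Second, 1, \<pi> k) (First, 1, k) 0"
      using conn_trans[OF glue_flip(2)[OF k] vert[OF k'(1,2), unfolded k'(3)]] by simp
    then show "\<exists>b\<in>Vset n. \<exists>s. conn ?G (emb b) (First, 1, k) s"
      using k' by (intro bexI[of _ "(1, \<pi> k)"] exI[of _ 0]) (auto simp: mem_Vset)
  qed
qed

end

section \<open>Explicit forms of the generators\<close>

definition adj :: "nat \<Rightarrow> nat \<Rightarrow> nat" where
  "adj i k = (if k = i then Suc i else if k = Suc i then i else k)"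

definition mcup :: "nat \<Rightarrow> vertex \<Rightarrow> vertex" where
  "mcup i x = (if snd x = i \<or> snd x = Suc i then (fst x, adj i (snd x)) else (1 - fst x, snd x))"

text \<open>The formula is the same on both levels: on level 1 the vertex order is reversed, but so
  is the sign \<open>vsgn\<close>.\<close>

definition wcup :: "nat \<Rightarrow> vertex \<Rightarrow> int" where
  "wcup i x = (if snd x = i then 1 else if snd x = Suc i then - 1 else 0)"

lemma invol_id: "invol n id"
  by (simp add: invol_def)

lemma invol_adj: "1 \<le> i \<Longrightarrow> i < n \<Longrightarrow> invol n (adj i)"
  by (auto simp: invol_def adj_def)

lemma mem_through: "through k = {(0, k), mperm id (0, k)}" "through k = {(1, k), mperm id (1, k)}"
  by (auto simp: through_def mperm_def)

lemma represents_one: "represents n (tangle_one n) (mperm id) (\<lambda>_. 0)"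
proof -
  let ?F = "tangle_one n"
  have E: "fst ?F = {{x, mperm id x} | x. x \<in> Vset n}"
  proof (intro equalityI subsetI)
    fix e assume "e \<in> fst ?F"
    then obtain k where "e = through k" "1 \<le> k" "k \<le> n" by (auto simp: tangle_one_def)
    then show "e \<in> {{x, mperm id x} | x. x \<in> Vset n}"
      using mem_through(1)[of k] mem_Vset[of 0 k n] by blast
  next
    fix e assume "e \<in> {{x, mperm id x} | x. x \<in> Vset n}"
    then obtain a k where "e = {(a, k), mperm id (a, k)}" "(a, k) \<in> Vset n" by auto
    then have "e = through k" "1 \<le> k" "k \<le> n" by (auto simp: mem_Vset mperm_def through_def)
    then show "e \<in> fst ?F" by (auto simp: tangle_one_def)
  qed
  have lab: "snd ?F {x, mperm id x} = vsgn x * 0" if "x \<in> Vset n" for x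
  proof -
    have "{x, mperm id x} \<in> fst ?F" unfolding E using that by blast
    then show ?thesis by (simp add: tangle_one_def)
  qed
  note I = tangleI[of n "mperm id" "\<lambda>_. 0" ?F, OF _ _ _ _ _ E _ lab]
  have "?F \<in> arrow_tangles n" "\<And>x. x \<in> Vset n \<Longrightarrow> mate ?F x = mperm id x" "\<And>x. x \<in> Vset n \<Longrightarrow> wt ?F x = 0"
    by (rule I; auto simp: mperm_def mem_Vset tangle_one_def)+
  then show ?thesis by (simp add: represents_def)
qed

lemma represents_w:
  assumes i: "1 \<le> i" "i < n"
  shows "represents n (w_tangle n i) (mperm (adj i)) (\<lambda>_. 0)"
proof -
  let ?F = "w_tangle n i"
  have fst: "fst ?F = {{(0, i), (1, i + 1)}, {(0, i + 1), (1, i)}} \<union> through ` ({1..n} - {i, i + 1})"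
    by (simp add: w_tangle_def Let_def)
  have E: "fst ?F = {{x, mperm (adj i) x} | x. x \<in> Vset n}"
  proof (intro equalityI subsetI)
    fix e assume "e \<in> fst ?F"
    then consider "e = {(0, i), (1, i + 1)}" | "e = {(0, i + 1), (1, i)}"
      | k where "e = through k" "k \<in> {1..n} - {i, i + 1}"
      unfolding fst by blast
    then have "\<exists>k. e = {(0, k), mperm (adj i) (0, k)} \<and> (0, k) \<in> Vset n"
    proof cases
      case 1
      then show ?thesis using i by (intro exI[of _ i]) (simp add: mperm_def adj_def mem_Vset)
    next
      case 2
      then show ?thesis using i by (intro exI[of _ "i + 1"]) (simp add: mperm_def adj_def mem_Vset)
    next
      case (3 k)
      then show ?thesis by (intro exI[of _ k]) (simp add: mperm_def adj_def mem_Vset through_def)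
    qed
    then show "e \<in> {{x, mperm (adj i) x} | x. x \<in> Vset n}" by blast
  next
    fix e assume "e \<in> {{x, mperm (adj i) x} | x. x \<in> Vset n}"
    then obtain a k where "e = {(a, k), mperm (adj i) (a, k)}" "(a, k) \<in> Vset n" by auto
    then show "e \<in> fst ?F" unfolding fst
      by (cases "k = i"; cases "k = Suc i"; auto simp: mem_Vset mperm_def adj_def through_def insert_commute)
  qed
  have lab: "snd ?F {x, mperm (adj i) x} = vsgn x * 0" if "x \<in> Vset n" for x
  proof -
    have "{x, mperm (adj i) x} \<in> fst ?F" unfolding E using that by blast
    then show ?thesis by (simp add: w_tangle_def Let_def)
  qed
  note I = tangleI[of n "mperm (adj i)" "\<lambda>_. 0" ?F, OF _ _ _ _ _ E _ lab]
  have "?F \<in> arrow_tangles n" "\<And>x. x \<in> Vset n \<Longrightarrow> mate ?F x = mperm (adj i) x" "\<And>x. x \<in> Vset n \<Longrightarrow> wt ?F x = 0"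
    by (rule I; use i in \<open>auto simp: mperm_def mem_Vset w_tangle_def Let_def adj_def split: if_splits\<close>)+
  then show ?thesis by (simp add: represents_def)
qed

lemma represents_F:
  assumes i: "1 \<le> i" "i < n"
  shows "represents n (F_tangle n i) (mcup i) (wcup i)"
proof -
  let ?F = "F_tangle n i"
  let ?H = "{{(0, i), (0, i + 1)}, {(1, i), (1, i + 1)}} :: vertex set set"
  have fst: "fst ?F = ?H \<union> through ` ({1..n} - {i, i + 1})"
    by (simp add: F_tangle_def Let_def)
  have E: "fst ?F = {{x, mcup i x} | x. x \<in> Vset n}"
  proof (intro equalityI subsetI)
    fix e assume "e \<in> fst ?F"
    then consider "e = {(0, i), (0, i + 1)}" | "e = {(1, i), (1, i + 1)}"
      | k where "e = through k" "k \<in> {1..n} - {i, i + 1}"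
      unfolding fst by blast
    then have "\<exists>x. e = {x, mcup i x} \<and> x \<in> Vset n"
    proof cases
      case 1
      then show ?thesis using i by (intro exI[of _ "(0, i)"]) (simp add: mcup_def adj_def mem_Vset)
    next
      case 2
      then show ?thesis using i by (intro exI[of _ "(1, i)"]) (simp add: mcup_def adj_def mem_Vset)
    next
      case (3 k)
      then show ?thesis by (intro exI[of _ "(0, k)"]) (simp add: mcup_def adj_def mem_Vset through_def)
    qed
    then show "e \<in> {{x, mcup i x} | x. x \<in> Vset n}" by blast
  next
    fix e assume "e \<in> {{x, mcup i x} | x. x \<in> Vset n}"
    then obtain a k where "e = {(a, k), mcup i (a, k)}" "(a, k) \<in> Vset n" by auto
    then show "e \<in> fst ?F" unfolding fst
      by (cases "k = i"; cases "k = Suc i"; auto simp: mem_Vset mcup_def adj_def through_def insert_commute)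
  qed
  have lab: "snd ?F {x, mcup i x} = vsgn x * wcup i x" if x: "x \<in> Vset n" "vless x (mcup i x)" for x
  proof -
    have "{x, mcup i x} \<in> fst ?F" unfolding E using x by blast
    then have *: "snd ?F {x, mcup i x} = (if {x, mcup i x} \<in> ?H then 1 else 0)"
      by (simp add: F_tangle_def Let_def)
    obtain a k where ak: "x = (a, k)" by (cases x)
    show ?thesis unfolding * using x unfolding ak
      by (cases "k = i"; cases "k = Suc i")
        (auto simp: mcup_def wcup_def adj_def vless_def vsgn_def mem_Vset doubleton_eq_iff)
  qed
  note I = tangleI[of n "mcup i" "wcup i" ?F, OF _ _ _ _ _ E _ lab]
  have "?F \<in> arrow_tangles n" "\<And>x. x \<in> Vset n \<Longrightarrow> mate ?F x = mcup i x" "\<And>x. x \<in> Vset n \<Longrightarrow> wt ?F x = wcup i x"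
    by (rule I; use i in \<open>auto simp: mcup_def wcup_def mem_Vset F_tangle_def Let_def adj_def split: if_splits\<close>)+
  then show ?thesis by (simp add: represents_def)
qed

lemma representsD:
  assumes "represents n F m w"
  shows "F \<in> arrow_tangles n" "x \<in> Vset n \<Longrightarrow> mate F x = m x" "x \<in> Vset n \<Longrightarrow> wt F x = w x"
  using assms by (auto simp: represents_def)

lemma twist_id: "twist a id x = x"
  by (cases x) (simp add: twist_def)

lemma one_star_left:
  assumes "F \<in> arrow_tangles n"
  shows "tangle_star (tangle_one n) F = F" "loop_factor (tangle_one n) F = 1"
proof -
  note P = perm_star_left[OF represents_one invol_id represents_refl[OF assms]]
  show "tangle_star (tangle_one n) F = F"
    by (rule represents_eq[OF P(1) represents_refl[OF assms]]) (simp add: twist_id)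
  show "loop_factor (tangle_one n) F = 1" by (rule P(2))
qed

lemma one_star_right:
  assumes "F \<in> arrow_tangles n"
  shows "tangle_star F (tangle_one n) = F" "loop_factor F (tangle_one n) = 1"
proof -
  note P = perm_star_right[OF represents_one invol_id represents_refl[OF assms]]
  show "tangle_star F (tangle_one n) = F"
    by (rule represents_eq[OF P(1) represents_refl[OF assms]]) (simp add: twist_id)
  show "loop_factor F (tangle_one n) = 1" by (rule P(2))
qed

lemmas vertex_simps = twist_def mperm_def mcup_def wcup_def adj_def mem_Vset

lemma w_star_w:
  assumes "1 \<le> i" "i < n"
  shows "tangle_star (w_tangle n i) (w_tangle n i) = tangle_one n"
proof -
  note w = represents_w[OF assms]
  show ?thesis
    by (rule represents_eq[OF perm_star_left(1)[OF w invol_adj[OF assms] w] represents_one])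
      (auto simp: vertex_simps)
qed

lemma w_braid:
  assumes "1 \<le> i" "Suc i < n"
  shows "tangle_star (w_tangle n i) (tangle_star (w_tangle n (Suc i)) (w_tangle n i)) =
    tangle_star (w_tangle n (Suc i)) (tangle_star (w_tangle n i) (w_tangle n (Suc i)))"
proof -
  note a = represents_w[of i n] invol_adj[of i n]
  note b = represents_w[of "Suc i" n] invol_adj[of "Suc i" n]
  have 1: "represents n (tangle_star (w_tangle n i) (tangle_star (w_tangle n (Suc i)) (w_tangle n i)))
      (\<lambda>x. twist 0 (adj i) (twist 0 (adj (Suc i)) (mperm (adj i) (twist 0 (adj (Suc i)) (twist 0 (adj i) x)))))
      (\<lambda>x. 0)"
    using perm_star_left(1)[OF a perm_star_left(1)[OF b a(1)]] assms by simp
  have 2: "represents n (tangle_star (w_tangle n (Suc i)) (tangle_star (w_tangle n i) (w_tangle n (Suc i))))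
      (\<lambda>x. twist 0 (adj (Suc i)) (twist 0 (adj i) (mperm (adj (Suc i)) (twist 0 (adj i) (twist 0 (adj (Suc i)) x)))))
      (\<lambda>x. 0)"
    using perm_star_left(1)[OF b perm_star_left(1)[OF a b(1)]] assms by simp
  show ?thesis
    by (rule represents_eq[OF 1 2]) (auto simp: vertex_simps)
qed

text \<open>The conjugating permutation carries \<open>Suc i\<close> and \<open>Suc (Suc i)\<close>
  to \<open>i\<close> and \<open>Suc i\<close> in this order, so the arrows keep their direction and
  the labels stay 1.\<close>

lemma F_conjugate:
  assumes "1 \<le> i" "Suc i < n"
  shows "tangle_star (w_tangle n (Suc i)) (tangle_star (w_tangle n i)
    (tangle_star (tangle_star (F_tangle n (Suc i)) (w_tangle n i)) (w_tangle n (Suc i)))) = F_tangle n i"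
proof -
  have i: "i < n" "1 \<le> Suc i" using assms by auto
  note a = represents_w[OF assms(1) i(1)] invol_adj[OF assms(1) i(1)]
  note b = represents_w[OF i(2) assms(2)] invol_adj[OF i(2) assms(2)]
  note R = perm_star_left(1)[OF b perm_star_left(1)[OF a perm_star_right(1)[OF b perm_star_right(1)[OF a represents_F[OF i(2) assms(2)]]]]]
  show ?thesis
  proof (rule represents_eq[OF R represents_F[OF assms(1) i(1)]])
    fix x assume "x \<in> Vset n"
    then obtain a k where "x = (a, k)" "a = 0 \<or> a = 1" by (cases x) (auto simp: mem_Vset)
    then show "twist 0 (adj (Suc i)) (twist 0 (adj i) (twist 1 (adj (Suc i)) (twist 1 (adj i) (mcup (Suc i)
        (twist 1 (adj i) (twist 1 (adj (Suc i)) (twist 0 (adj i) (twist 0 (adj (Suc i)) x)))))))) = mcup i x \<and>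
      wcup (Suc i) (twist 1 (adj i) (twist 1 (adj (Suc i)) (twist 0 (adj i) (twist 0 (adj (Suc i)) x)))) = wcup i x"
      by (elim disjE; cases "k = i"; cases "k = Suc i"; cases "k = Suc (Suc i)"; simp add: vertex_simps)
  qed
qed

text \<open>Covers \<open>F_tangle\<close> with sign 1 and its conjugate by the crossing at the same
  place with sign -1. The latter appears in move (d), and the trace computed below treats all signs
  alike.\<close>

definition cupcap :: "nat \<Rightarrow> nat \<Rightarrow> int \<Rightarrow> tangle \<Rightarrow> bool" where
  "cupcap n i \<epsilon> G \<longleftrightarrow> represents n G (mcup i) (\<lambda>x. \<epsilon> * wcup i x)"

lemma cupcap_F: "1 \<le> i \<Longrightarrow> i < n \<Longrightarrow> cupcap n i 1 (F_tangle n i)"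
  using represents_F by (simp add: cupcap_def)

lemma cupcap_wFw:
  assumes "1 \<le> i" "i < n"
  shows "cupcap n i (- 1) (tangle_star (w_tangle n i) (tangle_star (F_tangle n i) (w_tangle n i)))"
proof -
  note w = represents_w[OF assms] invol_adj[OF assms]
  note R = perm_star_left(1)[OF w perm_star_right(1)[OF w represents_F[OF assms]]]
  show ?thesis
    unfolding cupcap_def represents_def
    using R by (auto simp: represents_def) (auto simp: vertex_simps)
qed

section \<open>Products of two cup and cap tangles\<close>

lemma glue_path:
  assumes "conn (glue_graph n F F') p (First, 1, k) s" "1 \<le> k" "k \<le> n"
  shows "conn (glue_graph n F F') p (Second, mate F' (0, k)) (s + wt F' (0, k))"
  using conn_trans[OF glue_Second conn_trans[OF glue_flip(1)[OF assms(2,3)] assms(1)]] assms(2,3)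
  by (simp add: mem_Vset)

lemma glue_path':
  assumes "conn (glue_graph n F F') p (Second, 0, k) s" "1 \<le> k" "k \<le> n"
  shows "conn (glue_graph n F F') p (First, mate F (1, k)) (s + wt F (1, k))"
  using conn_trans[OF glue_First conn_trans[OF glue_flip(2)[OF assms(2,3)] assms(1)]] assms(2,3)
  by (simp add: mem_Vset)

lemma mem_map_edges: "(u, v, g) \<in> map_edges \<phi> G \<longleftrightarrow> (\<exists>x y. (x, y, g) \<in> G \<and> u = \<phi> x \<and> v = \<phi> y)"
  unfolding map_edges_def by force

lemma glue_edge_cases [consumes 3]:
  assumes "(u, v, g) \<in> glue_graph n F F'" "represents n F m w" "represents n F' m' w'"
  obtains (fst) a k where "a = 0 \<or> a = 1" "1 \<le> k" "k \<le> n" "u = (First, a, k)" "v = (First, m (a, k))" "g = w (a, k)"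
    | (snd) a k where "a = 0 \<or> a = 1" "1 \<le> k" "k \<le> n" "u = (Second, a, k)" "v = (Second, m' (a, k))" "g = w' (a, k)"
    | (flip1) k where "1 \<le> k" "k \<le> n" "u = (First, 1, k)" "v = (Second, 0, k)" "g = 0"
    | (flip2) k where "1 \<le> k" "k \<le> n" "u = (Second, 0, k)" "v = (First, 1, k)" "g = 0"
proof -
  consider x where "x \<in> Vset n" "u = (First, x)" "v = (First, m x)" "g = w x"
    | x where "x \<in> Vset n" "u = (Second, x)" "v = (Second, m' x)" "g = w' x"
    | k where "1 \<le> k" "k \<le> n" "u = (First, 1, k)" "v = (Second, 0, k)" "g = 0"
    | k where "1 \<le> k" "k \<le> n" "u = (Second, 0, k)" "v = (First, 1, k)" "g = 0"
  proof -
    consider "(u, v, g) \<in> map_edges (Pair First) (tangle_graph n F)"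
      | "(u, v, g) \<in> map_edges (Pair Second) (tangle_graph n F')"
      | "(u, v, g) \<in> {((First, 1, k), (Second, 0, k), 0) | k. 1 \<le> k \<and> k \<le> n}"
      | "(u, v, g) \<in> {((Second, 0, k), (First, 1, k), 0) | k. 1 \<le> k \<and> k \<le> n}"
      using assms(1) unfolding glue_graph_pieces by (elim UnE)
    then show thesis
    proof cases
      case 1
      then obtain x where "x \<in> Vset n" "u = (First, x)" "v = (First, mate F x)" "g = wt F x"
        by (auto simp: mem_map_edges mem_tangle_graph)
      then show ?thesis using that(1)[of x] representsD(2,3)[OF assms(2)] by simp
    next
      case 2
      then obtain x where "x \<in> Vset n" "u = (Second, x)" "v = (Second, mate F' x)" "g = wt F' x"
        by (auto simp: mem_map_edges mem_tangle_graph)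
      then show ?thesis using that(2)[of x] representsD(2,3)[OF assms(3)] by simp
    next
      case 3
      then show ?thesis using that(3) by blast
    next
      case 4
      then show ?thesis using that(4) by blast
    qed
  qed
  then show thesis
  proof cases
    case (1 x)
    then show ?thesis using fst[of "fst x" "snd x"] by (cases x) (auto simp: mem_Vset)
  next
    case (2 x)
    then show ?thesis using snd[of "fst x" "snd x"] by (cases x) (auto simp: mem_Vset)
  qed (use flip1 flip2 in blast)+
qed

text \<open>If all gains are differences of a potential, closed walks have gain 0; in this way a
  holonomy is shown to vanish.\<close>

lemma conn_potential:
  assumes "conn G x y s" "\<And>u v g. (u, v, g) \<in> G \<Longrightarrow> g = \<delta> v - \<delta> u"
  shows "s = \<delta> y - \<delta> x"
  using assms(1)
proof (induction rule: conn.induct)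
  case (conn_fwd x y s z g)
  then show ?case using assms(2)[OF conn_fwd.hyps(2)] by simp
next
  case (conn_bwd x y s z g)
  then show ?case using assms(2)[OF conn_bwd.hyps(2)] by simp
qed simp

text \<open>The level 1 strand of the first factor at \<open>i\<close> and the level 0 strand of the
  second close up to a loop. Its two arrows are passed in opposite directions, so the gain is 0 and
  the loop has value z_0.\<close>

lemma F_star_F:
  assumes "1 \<le> i" "i < n"
  shows "tangle_star (F_tangle n i) (F_tangle n i) = F_tangle n i"
    and "loop_factor (F_tangle n i) (F_tangle n i) = zvar 0"
proof -
  let ?F = "F_tangle n i"
  let ?G = "glue_graph n ?F ?F"
  note R = represents_F[OF assms]
  note r = representsD[OF R]
  show "tangle_star ?F ?F = ?F"
  \<comment> \<open>Through strands are followed from level 0 only, the strands at \<open>i\<close>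
    and \<open>Suc i\<close> on both levels.\<close>
  proof (rule star_eqI[OF r(1) r(1) r(1), where P = "\<lambda>x. fst x = 0 \<or> snd x = i \<or> snd x = Suc i"])
    fix x assume x: "x \<in> Vset n" "fst x = 0 \<or> snd x = i \<or> snd x = Suc i"
    obtain a k where ak: "x = (a, k)" "a = 0 \<or> a = 1" "1 \<le> k" "k \<le> n" using x by (cases x) (auto simp: mem_Vset)
    consider "a = 0" "k = i \<or> k = Suc i" | "a = 1" "k = i \<or> k = Suc i" | "a = 0" "k \<noteq> i" "k \<noteq> Suc i"
      using x ak by auto
    then show "conn ?G (emb x) (emb (mate ?F x)) (wt ?F x)"
    proof cases
      case 1
      then show ?thesis using glue_First[OF x(1), of ?F ?F] x ak by (auto simp: r vertex_simps)
    next
      case 2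
      then show ?thesis using glue_Second[OF x(1), of ?F ?F] x ak by (auto simp: r vertex_simps)
    next
      case 3
      have "conn ?G (First, 0, k) (First, 1, k) 0"
        using glue_First[OF x(1), of ?F ?F] 3 ak x(1) by (simp add: r vertex_simps)
      from glue_path[OF this ak(3,4)] show ?thesis
        using 3 ak x(1) by (simp add: r vertex_simps)
    qed
  next
    show "(fst x = 0 \<or> snd x = i \<or> snd x = Suc i) \<or>
        (fst (mate ?F x) = 0 \<or> snd (mate ?F x) = i \<or> snd (mate ?F x) = Suc i)" if "x \<in> Vset n" for x
      using that by (cases x) (auto simp: r vertex_simps)
  qed
  interpret tangle_pair n ?F ?F using r(1) by unfold_locales
  let ?x = "(First, 1, i)"
  let ?K = "{(First, 1, i), (First, 1, Suc i), (Second, 0, i), (Second, 0, Suc i)} :: (factor \<times> vertex) set"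
  have V: "(a, i) \<in> Vset n" "(a, Suc i) \<in> Vset n" if "a = 0 \<or> a = 1" for a
    using that assms by (auto simp: mem_Vset)
  have sub: "y \<in> ?K" if "conn ?G ?x y s" for y s
  proof (rule conn_closed[OF that])
    fix u v g assume "(u, v, g) \<in> ?G"
    from this R R show "u \<in> ?K \<longleftrightarrow> v \<in> ?K"
    proof (cases rule: glue_edge_cases)
      case (fst a k)
      then show ?thesis by (cases "k = i"; cases "k = Suc i") (auto simp: vertex_simps)
    next
      case (snd a k)
      then show ?thesis by (cases "k = i"; cases "k = Suc i") (auto simp: vertex_simps)
    qed simp_all
  qed simp
  have pot: "s = 0" if "conn ?G ?x ?x s" for s
  proof -
    \<comment> \<open>Passing from \<open>i\<close> to \<open>Suc i\<close> has gain 1 in both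
      factors, while all other edges have gain 0 and keep the index at that place.\<close>
    define \<delta> :: "factor \<times> vertex \<Rightarrow> int" where "\<delta> y = (if snd (snd y) = i then - 1 else 0)" for y
    have "s = \<delta> ?x - \<delta> ?x"
    proof (rule conn_potential[OF that])
      fix u v g assume "(u, v, g) \<in> ?G"
      from this R R show "g = \<delta> v - \<delta> u"
      proof (cases rule: glue_edge_cases)
        case (fst a k)
        then show ?thesis by (cases "k = i"; cases "k = Suc i") (simp_all add: \<delta>_def vertex_simps)
      next
        case (snd a k)
        then show ?thesis by (cases "k = i"; cases "k = Suc i") (simp_all add: \<delta>_def vertex_simps)
      qed (simp_all add: \<delta>_def)
    qed
    then show ?thesis by simp
  qed
  have c1: "conn ?G ?x (First, 1, Suc i) 1"
    using glue_First[OF V(1)[of 1], of ?F ?F] V(1)[of 1] by (simp add: r vertex_simps)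
  have "\<exists>s. conn ?G ?x y s" if "y \<in> ?K" for y
  proof -
    have "conn ?G ?x (Second, 0, i) 0" "conn ?G ?x (Second, 0, Suc i) (1 + 0)"
      using glue_flip(1)[of i n] conn_trans[OF glue_flip(1)[of "Suc i" n] c1] assms by auto
    then show ?thesis using that c1 conn_refl[of ?G ?x] by blast
  qed
  then have K: "component ?G ?x = ?K" using sub unfolding component_def by blast
  have "{K \<in> component ?G ` (UNIV \<times> Vset n). K \<inter> emb ` Vset n = {}} = {?K}"
  proof (intro equalityI subsetI)
    fix L assume "L \<in> {K \<in> component ?G ` (UNIV \<times> Vset n). K \<inter> emb ` Vset n = {}}"
    then obtain y where y: "snd y \<in> Vset n" "L = component ?G y" "L \<inter> emb ` Vset n = {}" by auto
    have "y \<in> L" unfolding y(2) by (rule component_refl)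
    then have int: "y \<in> interior n" using y emb_image[of n] by (auto simp: mem_Times_iff)
    define k where "k = snd (snd y)"
    have k: "1 \<le> k" "k \<le> n" using int by (auto simp: interior_def Vset_def k_def)
    have yk: "y = (First, 1, k) \<or> y = (Second, 0, k)"
      using int by (cases y; cases "fst y") (auto simp: interior_def Vset_def k_def)
    have "k = i \<or> k = Suc i"
    proof (rule ccontr)
      assume nk: "\<not> (k = i \<or> k = Suc i)"
      have "conn ?G (First, 1, k) (emb (0, k)) 0"
        using glue_First[of "(1, k)" n ?F ?F] nk k by (simp add: r vertex_simps)
      then have "\<exists>s. conn ?G y (emb (0, k)) s"
        using yk conn_trans[OF _ glue_flip(2)[OF k, of ?F ?F], of "emb (0, k)" 0] by auto
      then have "emb (0, k) \<in> L" using y(2) by (simp add: component_def)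
      moreover have "emb (0, k) \<in> emb ` Vset n" using k mem_Vset by blast
      ultimately show False using y(3) by blast
    qed
    then have "y \<in> ?K" using yk by auto
    then have "y \<in> component ?G ?x" using K by simp
    from component_eqI[OF this] show "L \<in> {?K}" using y(2) K by simp
  next
    fix L assume "L \<in> {?K}"
    moreover have "?K \<inter> emb ` Vset n = {}" by (auto simp: emb_def split: if_splits)
    ultimately show "L \<in> {K \<in> component ?G ` (UNIV \<times> Vset n). K \<inter> emb ` Vset n = {}}"
      using K V(1)[of 1] by (auto simp: image_iff intro!: bexI[of _ ?x])
  qed
  moreover have "holonomy ?G ?K = 0"
  proof -
    have "{s. conn ?G ?x ?x s} = {0}" using pot conn_refl[of ?G ?x] by blast
    then show ?thesis using holonomy_component[of ?G ?x] K by simp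
  qed
  ultimately show "loop_factor ?F ?F = zvar 0"
    unfolding loop_factor_eq loop_prod_def by (simp add: loop_val_def)
qed

text \<open>Strand \<open>j\<close> passes through \<open>w\<close> to a cap and a cup with opposite signs of traversal, so that it
  straightens to a strand with label \<open>0\<close>; \<open>e\<close> and \<open>e'\<close> are the ends of the cup that it meets.\<close>

lemma F_w_F_aux:
  fixes \<gamma> :: int
  assumes p: "1 \<le> p" "p < n" and q: "1 \<le> q" "q < n" and j: "1 \<le> j" "j \<le> n"
    and cases: "q = Suc p \<and> j = Suc (Suc p) \<and> e = p \<and> e' = Suc p \<and> \<gamma> = - 1 \<or>
      p = Suc q \<and> j = q \<and> e = Suc p \<and> e' = p \<and> \<gamma> = 1"
  shows "tangle_star (F_tangle n p) (tangle_star (w_tangle n q) (F_tangle n p)) = F_tangle n p"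
    and "loop_factor (F_tangle n p) (tangle_star (w_tangle n q) (F_tangle n p)) = 1"
proof -
  let ?F = "F_tangle n p" and ?K = "tangle_star (w_tangle n q) (F_tangle n p)"
  let ?G = "glue_graph n ?F ?K"
  note r = representsD[OF represents_F[OF p]]
  note k = representsD[OF perm_star_left(1)[OF represents_w[OF q] invol_adj[OF q] represents_F[OF p]]]
  have e: "1 \<le> e" "e \<le> n" "1 \<le> e'" "e' \<le> n" and ee: "{e, e'} = {p, Suc p}" and jp: "j \<noteq> p" "j \<noteq> Suc p"
    using p cases by auto
  have V: "(a, j) \<in> Vset n" "(a, e) \<in> Vset n" "(a, e') \<in> Vset n" if "a = 0 \<or> a = 1" for a
    using that j e by (auto simp: mem_Vset)
  have K: "mate ?K (0, j) = (0, e)" "wt ?K (0, j) = \<gamma>" "mate ?K (0, e') = (1, j)" "wt ?K (0, e') = 0"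
    using V[of 0] cases by (auto simp: k twist_def mcup_def wcup_def adj_def)
  have Fe: "mate ?F (1, e) = (1, e')" "wt ?F (1, e) = - \<gamma>"
    using V[of 1] cases by (auto simp: r mcup_def wcup_def adj_def)
  have vert: "conn ?G (First, 0, l) (First, 1, l) 0" if "1 \<le> l" "l \<le> n" "l \<noteq> p" "l \<noteq> Suc p" for l
    using glue_First[of "(0, l)" n ?F ?K] that by (simp add: r mcup_def wcup_def mem_Vset)
  \<comment> \<open>The walk runs down strand \<open>j\<close> of the first factor, then from
    \<open>j\<close> to \<open>e\<close> in the second with gain \<open>\<gamma>\<close>, back from
    \<open>e\<close> to \<open>e'\<close> in the first with gain \<open>- \<gamma>\<close>, and from
    \<open>e'\<close> out to \<open>j\<close> in the second.\<close>
  note c1 = vert[OF j jp]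
  have c2: "conn ?G (First, 0, j) (Second, 0, e) \<gamma>"
    using glue_path[OF c1 j] by (simp add: K)
  have c3: "conn ?G (First, 0, j) (First, 1, e') 0"
    using glue_path'[OF c2 e(1,2)] unfolding Fe by simp
  have c4: "conn ?G (First, 0, j) (Second, 1, j) 0"
    using glue_path[OF c3 e(3,4)] by (simp add: K)
  have c5: "conn ?G (First, 0, j) (First, 1, e) \<gamma>"
    using conn_trans[OF glue_flip(2)[OF e(1,2)] c2] by simp
  show "tangle_star ?F ?K = ?F"
  proof (rule star_eqI[OF r(1) k(1) r(1), where P = "\<lambda>x. fst x = 0 \<or> snd x = p \<or> snd x = Suc p"])
    fix x assume x: "x \<in> Vset n" "fst x = 0 \<or> snd x = p \<or> snd x = Suc p"
    obtain a l where al: "x = (a, l)" "a = 0 \<or> a = 1" "1 \<le> l" "l \<le> n" using x by (cases x) (auto simp: mem_Vset)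
    consider "a = 0" "l = p \<or> l = Suc p" | "a = 1" "l = p \<or> l = Suc p" | "a = 0" "l = j"
      | "a = 0" "l \<noteq> p" "l \<noteq> Suc p" "l \<noteq> j"
      using x al by auto
    then show "conn ?G (emb x) (emb (mate ?F x)) (wt ?F x)"
    proof cases
      case 1
      then show ?thesis using glue_First[OF x(1), of ?F ?K] x al by (auto simp: r mcup_def wcup_def adj_def)
    next
      case 2
      then show ?thesis using glue_Second[OF x(1), of ?F ?K] x al
        by (auto simp: r k twist_def mcup_def wcup_def adj_def)
    next
      case 3
      then show ?thesis using c4 x(1) al jp by (simp add: r mcup_def wcup_def)
    next
      case 4
      then have "adj q l = l" using cases by (auto simp: adj_def)
      then have "mate ?K x = (1, l)" "wt ?K x = 0"
        using 4 al x(1) by (simp_all add: k twist_def mcup_def wcup_def)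
      then show ?thesis using glue_path[OF vert[OF al(3,4) 4(2,3)] al(3,4)] 4 al x(1)
        by (simp add: r mcup_def wcup_def)
    qed
  next
    show "(fst x = 0 \<or> snd x = p \<or> snd x = Suc p) \<or>
        (fst (mate ?F x) = 0 \<or> snd (mate ?F x) = p \<or> snd (mate ?F x) = Suc p)" if "x \<in> Vset n" for x
      using that by (cases x) (auto simp: r vertex_simps)
  qed
  show "loop_factor ?F ?K = 1"
  proof (rule loop_factor_eq_1[OF r(1) k(1)])
    fix l assume l: "1 \<le> l" "l \<le> n"
    consider "l = e" | "l = e'" | "l \<noteq> p" "l \<noteq> Suc p" using ee by blast
    then show "\<exists>b\<in>Vset n. \<exists>s. conn ?G (emb b) (First, 1, l) s"
    proof cases
      case 1
      then show ?thesis using c5 V[of 0] by (intro bexI[of _ "(0, j)"] exI[of _ \<gamma>]) auto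
    next
      case 2
      then show ?thesis using c3 V[of 0] by (intro bexI[of _ "(0, j)"] exI[of _ 0]) auto
    next
      case 3
      then show ?thesis using vert[OF l] l by (intro bexI[of _ "(0, l)"] exI[of _ 0]) (auto simp: mem_Vset)
    qed
  qed
qed

lemmas F_w_Suc_F = F_w_F_aux[where p = p and q = "Suc p" and j = "Suc (Suc p)" and e = p and e' = "Suc p" and \<gamma> = "- 1" for p]
lemmas F_Suc_w_F_Suc = F_w_F_aux[where p = "Suc q" and q = q and j = q and e = "Suc (Suc q)" and e' = "Suc q" and \<gamma> = 1 for q]

section \<open>Adding a strand\<close>

lemma represents_incl:
  assumes F: "F \<in> arrow_tangles n"
  shows "represents (Suc n) (tangle_incl n F) (\<lambda>x. if snd x = Suc n then (1 - fst x, Suc n) else mate F x)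
    (\<lambda>x. if snd x = Suc n then 0 else wt F x)"
proof -
  let ?F = "tangle_incl n F"
  let ?m = "\<lambda>x. if snd x = Suc n then (1 - fst x, Suc n) else mate F x"
  let ?w = "\<lambda>x. if snd x = Suc n then 0 else wt F x"
  have V: "x \<in> Vset (Suc n) \<longleftrightarrow> x \<in> Vset n \<or> x = (0, Suc n) \<or> x = (1, Suc n)" for x
    by (cases x) (auto simp: mem_Vset)
  have lt: "snd x \<noteq> Suc n" if "x \<in> Vset n" for x using that by (auto simp: Vset_def)
  have new: "through (Suc n) \<notin> fst F"
    using tangle_edge_in(1)[OF F, of "(0, Suc n)" "(1, Suc n)"] by (auto simp: through_def mem_Vset)
  have E: "fst ?F = {{x, ?m x} | x. x \<in> Vset (Suc n)}"
  proof -
    have "{{x, ?m x} | x. x \<in> Vset (Suc n)} = {{x, mate F x} | x. x \<in> Vset n} \<union> {through (Suc n)}"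
    proof (intro equalityI subsetI)
      fix e assume "e \<in> {{x, ?m x} | x. x \<in> Vset (Suc n)}"
      then obtain x where x: "e = {x, ?m x}" "x \<in> Vset (Suc n)" by blast
      show "e \<in> {{x, mate F x} | x. x \<in> Vset n} \<union> {through (Suc n)}"
      proof (cases "x \<in> Vset n")
        case True
        then have "e = {x, mate F x}" using x lt by simp
        then show ?thesis using True by blast
      next
        case False
        then show ?thesis using x V by (auto simp: through_def)
      qed
    next
      fix e assume "e \<in> {{x, mate F x} | x. x \<in> Vset n} \<union> {through (Suc n)}"
      then have "\<exists>x. e = {x, ?m x} \<and> x \<in> Vset (Suc n)"
      proof (elim UnE)
        assume "e \<in> {{x, mate F x} | x. x \<in> Vset n}"
        then obtain x where "e = {x, mate F x}" "x \<in> Vset n" by blast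
        then show ?thesis using lt[of x] V by (intro exI[of _ x]) simp
      qed (intro exI[of _ "(0, Suc n)"], simp add: through_def V)
      then show "e \<in> {{x, ?m x} | x. x \<in> Vset (Suc n)}" by blast
    qed
    then show ?thesis using tangle_edges[OF F] by (simp add: tangle_incl_def)
  qed
  have ext: "snd ?F \<in> extensional (fst ?F)"
    using arrow_tanglesD(3)[OF F] by (auto simp: tangle_incl_def extensional_def)
  have lab: "snd ?F {x, ?m x} = vsgn x * ?w x" if x: "x \<in> Vset (Suc n)" "vless x (?m x)" for x
  proof (cases "x \<in> Vset n")
    case True
    have "{x, mate F x} \<noteq> through (Suc n)" using mate_edge[OF F True] new by auto
    then have "snd ?F {x, ?m x} = snd F {x, mate F x}" using lt[OF True] by (simp add: tangle_incl_def)
    moreover have "vless x (mate F x)" using x lt[OF True] by simp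
    ultimately show ?thesis using lt[OF True] by (simp add: wt_def osgn_def)
  next
    case False
    then have "{x, ?m x} = through (Suc n)" "snd x = Suc n" using x V by (auto simp: through_def)
    then show ?thesis by (simp add: tangle_incl_def)
  qed
  have props: "?m x \<in> Vset (Suc n) \<and> ?m (?m x) = x \<and> ?m x \<noteq> x \<and> ?w (?m x) = - ?w x \<and> (even (?w x) \<longleftrightarrow> fst x \<noteq> fst (?m x))"
    if "x \<in> Vset (Suc n)" for x
  proof (cases "x \<in> Vset n")
    case True
    then show ?thesis
      using lt[OF True] lt[OF mate_in[OF F True]] mate_in[OF F True] mate_mate[OF F True] mate_neq[OF F True]
        wt_mate[OF F True] even_wt[OF F True] V by simp
  next
    case False
    then show ?thesis using that V by auto
  qed
  note I = tangleI[of "Suc n" ?m ?w ?F, OF _ _ _ _ _ E ext lab]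
  have "?F \<in> arrow_tangles (Suc n)" by (rule I(1)) (use props in blast)+
  moreover have "mate ?F x = ?m x" if "x \<in> Vset (Suc n)" for x by (rule I(2)) (use props that in blast)+
  moreover have "wt ?F x = ?w x" if "x \<in> Vset (Suc n)" for x by (rule I(3)) (use props that in blast)+
  ultimately show ?thesis unfolding represents_def by blast
qed

lemma incl_in: "F \<in> arrow_tangles n \<Longrightarrow> tangle_incl n F \<in> arrow_tangles (Suc n)"
  using represents_incl representsD(1) by blast

context
  fixes n i :: nat and F :: tangle
  assumes F: "F \<in> arrow_tangles n" and i: "1 \<le> i" "i < n"
begin

lemma incl_star_w: "tangle_star (tangle_incl n F) (w_tangle (Suc n) i) = tangle_incl n (tangle_star F (w_tangle n i))"
proof -
  have i': "i < Suc n" using i by simp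
  note 1 = perm_star_right(1)[OF represents_w[OF i] invol_adj[OF i] represents_refl[OF F]]
  note 2 = perm_star_right(1)[OF represents_w[OF i(1) i'] invol_adj[OF i(1) i'] represents_incl[OF F]]
  note r = representsD[OF 1]
  show ?thesis
  proof (rule represents_eq[OF 2 represents_incl[OF r(1)]], goal_cases)
    case (1 x)
    show ?case
    proof (cases "snd x = Suc n")
      case True
      then show ?thesis using i by (auto simp: twist_def adj_def)
    next
      case False
      then have x: "x \<in> Vset n" using 1 by (cases x) (auto simp: mem_Vset)
      then have "twist 1 (adj i) x \<in> Vset n" using i by (cases x) (auto simp: vertex_simps)
      then have "snd (twist 1 (adj i) x) \<noteq> Suc n" by (auto simp: Vset_def)
      then show ?thesis using x False by (simp add: r)
    qed
  qed
qed

lemma w_star_incl: "tangle_star (w_tangle (Suc n) i) (tangle_incl n F) = tangle_incl n (tangle_star (w_tangle n i) F)"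
proof -
  have i': "i < Suc n" using i by simp
  note 1 = perm_star_left(1)[OF represents_w[OF i] invol_adj[OF i] represents_refl[OF F]]
  note 2 = perm_star_left(1)[OF represents_w[OF i(1) i'] invol_adj[OF i(1) i'] represents_incl[OF F]]
  note r = representsD[OF 1]
  show ?thesis
  proof (rule represents_eq[OF 2 represents_incl[OF r(1)]], goal_cases)
    case (1 x)
    show ?case
    proof (cases "snd x = Suc n")
      case True
      then show ?thesis using i by (auto simp: twist_def adj_def)
    next
      case False
      then have x: "x \<in> Vset n" using 1 by (cases x) (auto simp: mem_Vset)
      then have "twist 0 (adj i) x \<in> Vset n" using i by (cases x) (auto simp: vertex_simps)
      then have "snd (twist 0 (adj i) x) \<noteq> Suc n" by (auto simp: Vset_def)
      then show ?thesis using x False by (simp add: r)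
    qed
  qed
qed

end

section \<open>Traces of an included tangle and its products\<close>

lemma mem_closure_graph:
  "(u, v, g) \<in> closure_graph n F \<longleftrightarrow> u \<in> Vset n \<and> (v = mate F u \<and> g = wt F u \<or> v = flipv u \<and> g = 0)"
proof -
  have "(u, v, g) \<in> {(x, flipv x, 0) | x. x \<in> Vset n} \<longleftrightarrow> u \<in> Vset n \<and> v = flipv u \<and> g = 0" by blast
  then show ?thesis unfolding closure_graph_def Un_iff mem_tangle_graph by blast
qed

lemma closure_graph_in:
  "F \<in> arrow_tangles n \<Longrightarrow> (u, v, g) \<in> closure_graph n F \<Longrightarrow> u \<in> Vset n \<and> v \<in> Vset n"
  using mate_in[of F n u] flipv_in[of u n] by (auto simp: mem_closure_graph)

lemma tangle_trace_closure:
  "F \<in> arrow_tangles n \<Longrightarrow> tangle_trace F = loop_prod (closure_graph n F) (Vset n) {}"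
  using tangle_closure.tangle_trace_eq by (simp add: tangle_closure_def)

lemma Vset_Suc: "x \<in> Vset (Suc n) \<longleftrightarrow> x \<in> Vset n \<or> x = (0, Suc n) \<or> x = (1, Suc n)"
  by (cases x) (auto simp: mem_Vset)

lemma Vset_lt: "x \<in> Vset n \<Longrightarrow> snd x \<noteq> Suc n"
  by (auto simp: Vset_def)

text \<open>Closing the new strand produces a separate loop with label 0, whence the factor z_0; all
  other components are unchanged.\<close>

lemma trace_incl:
  assumes F: "F \<in> arrow_tangles n"
  shows "tangle_trace (tangle_incl n F) = zvar 0 * tangle_trace F"
proof -
  let ?I = "tangle_incl n F"
  let ?G = "closure_graph n F" and ?H = "closure_graph (Suc n) (tangle_incl n F)"
  let ?K = "{(0, Suc n), (1, Suc n)} :: vertex set"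
  note r = representsD[OF represents_incl[OF F]]
  have old: "mate ?I x = mate F x" "wt ?I x = wt F x" if "x \<in> Vset n" for x
    using r(2,3)[of x] Vset_Suc Vset_lt[OF that] that by auto
  have new: "mate ?I x = flipv x" "wt ?I x = 0" if "x \<in> ?K" for x
    using r(2,3)[of x] Vset_Suc that by (auto simp: flipv_def)
  have edge: "(u, v, g) \<in> ?H \<longleftrightarrow> (u, v, g) \<in> ?G \<or> u \<in> ?K \<and> v = flipv u \<and> g = 0" for u v g
    using old new Vset_Suc unfolding mem_closure_graph by (metis insert_iff empty_iff)
  have K: "u \<in> ?K \<Longrightarrow> flipv u \<in> ?K" "u \<in> Vset n \<Longrightarrow> u \<notin> ?K" for u
    by (auto simp: flipv_def mem_Vset)
  have iff: "conn ?G x x' s \<longleftrightarrow> conn ?H x x' s" if x: "x \<in> Vset n" for x x' s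
  proof
    show "conn ?G x x' s \<Longrightarrow> conn ?H x x' s" by (erule conn_mono) (use edge in auto)
    assume "conn ?H x x' s"
    then have "conn ?G x x' s \<and> x' \<in> Vset n"
      using x
    proof (induction rule: conn.induct)
      case (conn_fwd x y s z g)
      then have "(y, z, g) \<in> ?G" using edge[of y z g] K by blast
      then show ?case using conn_fwd closure_graph_in[OF F, of y z g] conn.conn_fwd[of ?G x y s z g] by blast
    next
      case (conn_bwd x y s z g)
      then have "(z, y, g) \<in> ?G" using edge[of z y g] K by blast
      then show ?case using conn_bwd closure_graph_in[OF F, of z y g] conn.conn_bwd[of ?G x y s z g] by blast
    qed (simp add: conn_refl)
    then show "conn ?G x x' s" by simp
  qed
  have loop: "y \<in> ?K \<and> s = 0" if "conn ?H x y s" "x \<in> ?K" for x y s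
    using that
  proof (induction rule: conn.induct)
    case (conn_fwd x y s z g)
    then have "z = flipv y \<and> g = 0" using edge[of y z g] K closure_graph_in[OF F, of y z g] by blast
    then show ?case using conn_fwd K by simp
  next
    case (conn_bwd x y s z g)
    then have "z \<in> ?K \<and> g = 0" using edge[of z y g] K closure_graph_in[OF F, of z y g] by blast
    then show ?case using conn_bwd by simp
  qed simp
  have comp: "component ?H x = ?K" if "x \<in> ?K" for x
  proof -
    have "conn ?H x (flipv x) 0" using edge[of x "flipv x" 0] that by (intro conn_edge) simp
    moreover have "?K = {x, flipv x}" using that by (auto simp: flipv_def)
    ultimately have "?K \<subseteq> component ?H x" using conn_refl[of ?H x] unfolding component_def by auto
    moreover have "component ?H x \<subseteq> ?K"
    proof
      fix y assume "y \<in> component ?H x"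
      then obtain s where "conn ?H x y s" unfolding component_def by blast
      then show "y \<in> ?K" using loop that by blast
    qed
    ultimately show ?thesis by (rule equalityI[rotated])
  qed
  have "loop_prod ?H (Vset (Suc n)) (id ` {}) = loop_prod ?H (Vset (Suc n)) (id ` Vset n) * loop_prod ?G (Vset n) {}"
    by (rule loop_prod_full) (use iff Vset_Suc finite_Vset closure_graph_in[OF F] in auto)
  moreover have "loop_prod ?H (Vset (Suc n)) (id ` Vset n) = zvar 0"
  proof -
    have "{L \<in> component ?H ` Vset (Suc n). L \<inter> id ` Vset n = {}} = {?K}"
    proof (intro equalityI subsetI)
      fix L assume "L \<in> {L \<in> component ?H ` Vset (Suc n). L \<inter> id ` Vset n = {}}"
      then obtain x where x: "x \<in> Vset (Suc n)" "L = component ?H x" "L \<inter> Vset n = {}" by auto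
      then have "x \<in> ?K" using component_refl[of x ?H] Vset_Suc by blast
      then show "L \<in> {?K}" using comp x by simp
    next
      fix L assume "L \<in> {?K}"
      then have L: "L = ?K" by simp
      have "L \<in> component ?H ` Vset (Suc n)"
        using comp[of "(0, Suc n)"] Vset_Suc[of "(0, Suc n)" n] L by (intro image_eqI[of _ _ "(0, Suc n)"]) auto
      moreover have "L \<inter> id ` Vset n = {}" unfolding L by (auto simp: mem_Vset)
      ultimately show "L \<in> {L \<in> component ?H ` Vset (Suc n). L \<inter> id ` Vset n = {}}" by simp
    qed
    moreover have "holonomy ?H ?K = 0"
    proof -
      have "{s. conn ?H (0, Suc n) (0, Suc n) s} = {0}"
        using loop[of "(0, Suc n)" "(0, Suc n)"] conn_refl[of ?H "(0, Suc n)"] by blast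
      then show ?thesis using holonomy_component[of ?H "(0, Suc n)"] comp[of "(0, Suc n)"] by simp
    qed
    ultimately show ?thesis unfolding loop_prod_def by (simp add: loop_val_def)
  qed
  ultimately show ?thesis
    using tangle_trace_closure[OF F] tangle_trace_closure[OF incl_in[OF F]] by simp
qed

lemma cyclic_First: "x \<in> Vset n \<Longrightarrow> conn (cyclic_graph n F G) (First, x) (First, mate F x) (wt F x)"
  and cyclic_Second: "x \<in> Vset n \<Longrightarrow> conn (cyclic_graph n F G) (Second, x) (Second, mate G x) (wt G x)"
  and cyclic_flip: "x \<in> Vset n \<Longrightarrow> conn (cyclic_graph n F G) (t, x) (other t, flipv x) 0"
proof -
  assume x: "x \<in> Vset n"
  have 1: "(y, mate2 F G y, wt2 F G y) \<in> cyclic_graph n F G" "(y, flip2 y, 0) \<in> cyclic_graph n F G"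
    if "snd y \<in> Vset n" for y
    using that unfolding cyclic_graph_def by blast+
  show "conn (cyclic_graph n F G) (First, x) (First, mate F x) (wt F x)"
    using conn_edge[OF 1(1)[of "(First, x)"]] x by (simp add: mate2_def wt2_def)
  show "conn (cyclic_graph n F G) (Second, x) (Second, mate G x) (wt G x)"
    using conn_edge[OF 1(1)[of "(Second, x)"]] x by (simp add: mate2_def wt2_def)
  show "conn (cyclic_graph n F G) (t, x) (other t, flipv x) 0"
    using conn_edge[OF 1(2)[of "(t, x)"]] x by (simp add: flip2_def)
qed

text \<open>If the closure of \<open>G\<close> only joins the last strand of the inclusion to strand \<open>n\<close> without changing
  gains, then \<open>\<psi>\<close> retracts the closed graph of \<open>tangle_incl n F\<close> and \<open>G\<close> to that of \<open>F\<close>; the potential \<open>\<epsilon>\<close>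
  is the label of the cup and cap of \<open>G\<close>.\<close>

lemma trace_incl_star:
  assumes F: "F \<in> arrow_tangles n" and G: "G \<in> arrow_tangles (Suc n)" and n: "1 \<le> n"
    and vert: "\<And>a k. a = 0 \<or> a = 1 \<Longrightarrow> 1 \<le> k \<Longrightarrow> k < n \<Longrightarrow> mate G (a, k) = (1 - a, k) \<and> wt G (a, k) = 0"
    and lab: "\<And>a. a = 0 \<or> a = 1 \<Longrightarrow> snd (mate G (a, n)) = Suc n \<and> wt G (a, n) = \<epsilon>"
      "\<And>a. a = 0 \<or> a = 1 \<Longrightarrow> snd (mate G (a, Suc n)) = n \<and> wt G (a, Suc n) = - \<epsilon>"
    and path: "conn (cyclic_graph (Suc n) (tangle_incl n F) G) (First, 0, n) (First, 1, n) 0"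
  shows "loop_factor (tangle_incl n F) G * tangle_trace (tangle_star (tangle_incl n F) G) = tangle_trace F"
proof -
  let ?I = "tangle_incl n F"
  let ?C = "closure_graph n F" and ?H = "cyclic_graph (Suc n) ?I G"
  note r = representsD[OF represents_incl[OF F]]
  have old: "mate ?I x = mate F x" "wt ?I x = wt F x" if "x \<in> Vset n" for x
    using r(2,3)[of x] Vset_Suc Vset_lt[OF that] that by auto
  have V: "x \<in> Vset (Suc n)" if "x \<in> Vset n" for x using that Vset_Suc by simp
  \<comment> \<open>Both ends of the last strand, in either factor, go to \<open>(1, n)\<close>; by
    \<open>n0\<close> this vertex and \<open>(0, n)\<close> are joined with gain 0. The remaining
    points of the second factor go to the vertices they are glued to.\<close>
  define \<psi> :: "factor \<times> vertex \<Rightarrow> vertex" where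
    "\<psi> y = (if snd (snd y) = Suc n then (1, n) else if fst y = First then snd y else flipv (snd y))" for y
  \<comment> \<open>The shift by \<open>- \<epsilon>\<close> makes the strands of \<open>G\<close>
    between the indices \<open>n\<close> and \<open>Suc n\<close> gain-free after
    retraction.\<close>
  define \<delta> :: "factor \<times> vertex \<Rightarrow> int" where "\<delta> y = (if snd (snd y) = Suc n then - \<epsilon> else 0)" for y
  have flip: "conn ?C x (flipv x) 0" if "x \<in> Vset n" for x
    using that by (intro conn_edge) (simp add: mem_closure_graph)
  have n0: "conn ?C (a, n) (b, n) 0" if "a = 0 \<or> a = 1" "b = 0 \<or> b = 1" for a b
    using flip[of "(a, n)"] that n conn_refl[of ?C "(a, n)"] by (auto simp: mem_Vset flipv_def)
  have iff: "conn ?C x x' s \<longleftrightarrow> conn ?H (First, x) (First, x') s" if x: "x \<in> Vset n" "x' \<in> Vset n" for x x' s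
  proof (rule conn_retract[where \<psi> = \<psi> and \<delta> = \<delta> and \<phi> = "Pair First"])
    fix u v g assume "(u, v, g) \<in> ?C"
    then consider "u \<in> Vset n" "v = mate F u" "g = wt F u" | "u \<in> Vset n" "v = flipv u" "g = 0"
      by (auto simp: mem_closure_graph)
    then show "conn ?H (First, u) (First, v) g"
    proof cases
      case 1
      then show ?thesis using cyclic_First[OF V[OF 1(1)], of ?I G] by (simp add: old)
    next
      case 2
      obtain a k where u: "u = (a, k)" "a = 0 \<or> a = 1" "1 \<le> k" "k \<le> n" using 2(1) by (cases u) (auto simp: mem_Vset)
      show ?thesis
      proof (cases "k = n")
        case True
        then show ?thesis using path conn_sym[OF path] u 2 by (auto simp: flipv_def)
      next
        case False
        have a: "flipv u \<in> Vset (Suc n)" using V[OF flipv_in[OF 2(1)]] .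
        have b: "mate G (flipv u) = u" "wt G (flipv u) = 0"
          using vert[of "1 - a" k] u False by (auto simp: flipv_def)
        from conn_trans[OF cyclic_flip[OF V[OF 2(1)], of ?I G Second] conn_trans[OF cyclic_Second[OF a, of ?I G]
            cyclic_flip[OF V[OF 2(1)], of ?I G First, simplified], unfolded b]]
        show ?thesis using 2 by simp
      qed
    qed
  next
    fix u v g assume "(u, v, g) \<in> ?H"
    then consider x where "x \<in> Vset (Suc n)" "u = (First, x)" "v = (First, mate ?I x)" "g = wt ?I x"
      | x where "x \<in> Vset (Suc n)" "u = (Second, x)" "v = (Second, mate G x)" "g = wt G x"
      | t x where "x \<in> Vset (Suc n)" "u = (t, x)" "v = (other t, flipv x)" "g = 0"
    proof -
      assume e: "(u, v, g) \<in> ?H" and that: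
        "\<And>x. x \<in> Vset (Suc n) \<Longrightarrow> u = (First, x) \<Longrightarrow> v = (First, mate ?I x) \<Longrightarrow> g = wt ?I x \<Longrightarrow> thesis"
        "\<And>x. x \<in> Vset (Suc n) \<Longrightarrow> u = (Second, x) \<Longrightarrow> v = (Second, mate G x) \<Longrightarrow> g = wt G x \<Longrightarrow> thesis"
        "\<And>x t. x \<in> Vset (Suc n) \<Longrightarrow> u = (t, x) \<Longrightarrow> v = (other t, flipv x) \<Longrightarrow> g = 0 \<Longrightarrow> thesis"
      obtain t x where u: "u = (t, x)" by (cases u)
      from e have "x \<in> Vset (Suc n)" "v = mate2 ?I G u \<and> g = wt2 ?I G u \<or> v = flip2 u \<and> g = 0"
        unfolding cyclic_graph_def u by auto
      then show thesis using that[of x] u by (cases t) (auto simp: mate2_def wt2_def flip2_def)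
    qed
    then show "conn ?C (\<psi> u) (\<psi> v) (g + \<delta> v - \<delta> u)"
    proof cases
      case (1 x)
      show ?thesis
      proof (cases "x \<in> Vset n")
        case True
        then have "\<psi> u = x" "\<psi> v = mate F x" "g = wt F x" "\<delta> u = 0" "\<delta> v = 0"
          using 1 old Vset_lt[OF True] Vset_lt[OF mate_in[OF F True]] by (auto simp: \<psi>_def \<delta>_def)
        then show ?thesis using True by (auto simp: mem_closure_graph intro: conn_edge)
      next
        case False
        then have "x = (0, Suc n) \<or> x = (1, Suc n)" using 1 Vset_Suc by blast
        then have "snd x = Suc n" "mate ?I x = (1 - fst x, Suc n)" "wt ?I x = 0"
          using r(2,3)[OF 1(1)] by auto
        then show ?thesis using 1 conn_refl[of ?C "(1, n)"] by (simp add: \<psi>_def \<delta>_def)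
      qed
    next
      case (2 x)
      obtain a k where x: "x = (a, k)" "a = 0 \<or> a = 1" "1 \<le> k" "k \<le> Suc n"
        using 2(1) by (cases x) (auto simp: mem_Vset)
      have m: "mate G x \<in> Vset (Suc n)" using mate_in[OF G 2(1)] .
      obtain b l where b: "mate G x = (b, l)" "b = 0 \<or> b = 1" using m by (cases "mate G x") (auto simp: mem_Vset)
      have b01: "1 - b = 0 \<or> 1 - b = 1" "1 - a = 0 \<or> 1 - a = 1" by auto
      consider "k < n" | "k = n" | "k = Suc n" using x by linarith
      then show ?thesis
      proof cases
        case 1
        then have "(1 - a, k) \<in> Vset n" using x by (auto simp: mem_Vset)
        from flip[OF this] show ?thesis
          using vert[OF x(2,3) 1] 1 2 x by (auto simp: \<psi>_def \<delta>_def flipv_def)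
      next
        case 3: 2
        then show ?thesis
          using lab(1)[OF x(2)] 2 x b n0[OF b01(2), of 1] by (simp add: \<psi>_def \<delta>_def flipv_def)
      next
        case 3
        then show ?thesis
          using lab(2)[OF x(2)] 2 x b n0[of 1, OF _ b01(1)] by (simp add: \<psi>_def \<delta>_def flipv_def)
      qed
    next
      case (3 t x)
      show ?thesis
      proof (cases "snd x = Suc n")
        case True
        then show ?thesis using 3 conn_refl[of ?C "(1, n)"] by (simp add: \<psi>_def \<delta>_def flipv_def)
      next
        case False
        then have x: "x \<in> Vset n" using 3(1) Vset_Suc by auto
        have "\<psi> u = \<psi> v" "\<delta> u = 0" "\<delta> v = 0"
          using 3 False flipv_flipv[OF x] by (cases t; auto simp: \<psi>_def \<delta>_def; simp add: flipv_def)+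
        then show ?thesis using 3 conn_refl[of ?C "\<psi> u"] by simp
      qed
    qed
  qed (use x Vset_lt in \<open>auto simp: \<psi>_def \<delta>_def\<close>)
  \<comment> \<open>This and the next two facts join every point of the cyclic gluing to an old
    vertex in the first factor, so no component escapes the comparison.\<close>
  have near: "\<exists>x\<in>Vset n. \<exists>s. conn ?H (t, v) (First, x) s" if v: "v \<in> Vset n" for t v
  proof (cases t)
    case First
    then show ?thesis using v conn_refl[of ?H "(First, v)"] by blast
  next
    case Second
    then show ?thesis using cyclic_flip[OF V[OF v], of ?I G Second] flipv_in[OF v] by auto
  qed
  have near2: "\<exists>x\<in>Vset n. \<exists>s. conn ?H (Second, v) (First, x) s" if v: "v = (0, Suc n) \<or> v = (1, Suc n)" for v
  proof -
    have vV: "v \<in> Vset (Suc n)" using v Vset_Suc by blast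
    have "snd (mate G v) = n" using lab(2)[of "fst v"] v by auto
    then have "mate G v \<noteq> (0, Suc n)" "mate G v \<noteq> (1, Suc n)" by (metis n_not_Suc_n snd_conv)+
    then have "mate G v \<in> Vset n" using mate_in[OF G vV] Vset_Suc[of "mate G v" n] by blast
    then obtain x s where "x \<in> Vset n" "conn ?H (Second, mate G v) (First, x) s" using near by blast
    then show ?thesis using conn_trans[OF _ cyclic_Second[OF vV, of ?I G], of "(First, x)" s] by blast
  qed
  have surj: "\<exists>x\<in>Vset n. \<exists>s. conn ?H y (First, x) s" if y: "y \<in> UNIV \<times> Vset (Suc n)" for y
  proof -
    obtain t v where tv: "y = (t, v)" "v \<in> Vset (Suc n)" using y by auto
    show ?thesis
    proof (cases "v \<in> Vset n")
      case True
      then show ?thesis using near tv by blast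
    next
      case False
      then have v: "v = (0, Suc n) \<or> v = (1, Suc n)" using tv Vset_Suc by blast
      show ?thesis
      proof (cases t)
        case First
        have "flipv v = (0, Suc n) \<or> flipv v = (1, Suc n)" using v by (auto simp: flipv_def)
        from near2[OF this] obtain x s where "x \<in> Vset n" "conn ?H (Second, flipv v) (First, x) s" by blast
        then show ?thesis using conn_trans[OF _ cyclic_flip[OF tv(2), of ?I G First], of "(First, x)" s] tv First
          by auto
      next
        case Second
        then show ?thesis using near2[OF v] tv by simp
      qed
    qed
  qed
  have "loop_prod ?H (UNIV \<times> Vset (Suc n)) (Pair First ` {}) = loop_prod ?C (Vset n) {}"
    by (rule loop_prod_equiv) (use iff surj V finite_factor_Vset closure_graph_in[OF F] in auto)
  then show ?thesis
    using trace_star[OF incl_in[OF F] G] tangle_trace_closure[OF F] by simp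
qed

lemma trace_incl_w:
  assumes F: "F \<in> arrow_tangles n" and n: "1 \<le> n"
  shows "tangle_trace (tangle_star (tangle_incl n F) (w_tangle (Suc n) n)) = tangle_trace F"
proof -
  let ?I = "tangle_incl n F" and ?w = "w_tangle (Suc n) n"
  let ?H = "cyclic_graph (Suc n) ?I ?w"
  note w = represents_w[OF n lessI]
  note r = representsD[OF w] and q = representsD[OF represents_incl[OF F]]
  have V: "(a, n) \<in> Vset (Suc n)" "(a, Suc n) \<in> Vset (Suc n)" if "a = 0 \<or> a = 1" for a
    using that n by (auto simp: mem_Vset)
  \<comment> \<open>The detour through the crossing uses both of its strands and, between them, the
    new strand; all gains are 0.\<close>
  have 1: "conn ?H (First, 0, n) (Second, 1, n) 0" "conn ?H (Second, 1, n) (Second, 0, Suc n) 0"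
    "conn ?H (Second, 0, Suc n) (First, 1, Suc n) 0" "conn ?H (First, 1, Suc n) (First, 0, Suc n) 0"
    "conn ?H (First, 0, Suc n) (Second, 1, Suc n) 0" "conn ?H (Second, 1, Suc n) (Second, 0, n) 0"
    "conn ?H (Second, 0, n) (First, 1, n) 0"
    using cyclic_flip[OF V(1)[of 0], of ?I ?w First] cyclic_Second[OF V(1)[of 1], of ?I ?w]
      cyclic_flip[OF V(2)[of 0], of ?I ?w Second] cyclic_First[OF V(2)[of 1], of ?I ?w]
      cyclic_flip[OF V(2)[of 0], of ?I ?w First] cyclic_Second[OF V(2)[of 1], of ?I ?w]
      cyclic_flip[OF V(1)[of 0], of ?I ?w Second]
    by (simp_all add: flipv_def r q V mperm_def adj_def)
  have path: "conn ?H (First, 0, n) (First, 1, n) 0"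
    using conn_trans[OF 1(7) conn_trans[OF 1(6) conn_trans[OF 1(5) conn_trans[OF 1(4)
        conn_trans[OF 1(3) conn_trans[OF 1(2) 1(1)]]]]]] by simp
  have "loop_factor ?I ?w * tangle_trace (tangle_star ?I ?w) = tangle_trace F"
    by (rule trace_incl_star[OF F r(1) n _ _ _ path, where \<epsilon> = 0])
      (use n in \<open>auto simp: r mem_Vset mperm_def adj_def\<close>)
  moreover have "loop_factor ?I ?w = 1"
    by (rule perm_star_right(2)[OF w invol_adj[OF n lessI] represents_refl[OF incl_in[OF F]]])
  ultimately show ?thesis by simp
qed

lemma trace_incl_cupcap:
  assumes F: "F \<in> arrow_tangles n" and n: "1 \<le> n" and G: "cupcap (Suc n) n \<epsilon> G"
  shows "loop_factor (tangle_incl n F) G * tangle_trace (tangle_star (tangle_incl n F) G) = tangle_trace F"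
proof -
  let ?I = "tangle_incl n F"
  let ?H = "cyclic_graph (Suc n) ?I G"
  note r = representsD[OF G[unfolded cupcap_def]] and q = representsD[OF represents_incl[OF F]]
  have V: "(a, n) \<in> Vset (Suc n)" "(a, Suc n) \<in> Vset (Suc n)" if "a = 0 \<or> a = 1" for a
    using that n by (auto simp: mem_Vset)
  \<comment> \<open>The detour takes the level 1 strand of \<open>G\<close> from \<open>n\<close> to
    \<open>Suc n\<close> and the level 0 strand back, so \<open>\<epsilon>\<close> cancels whatever
    its value.\<close>
  have 1: "conn ?H (First, 0, n) (Second, 1, n) 0" "conn ?H (Second, 1, n) (Second, 1, Suc n) \<epsilon>"
    "conn ?H (Second, 1, Suc n) (First, 0, Suc n) 0" "conn ?H (First, 0, Suc n) (First, 1, Suc n) 0"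
    "conn ?H (First, 1, Suc n) (Second, 0, Suc n) 0" "conn ?H (Second, 0, Suc n) (Second, 0, n) (- \<epsilon>)"
    "conn ?H (Second, 0, n) (First, 1, n) 0"
    using cyclic_flip[OF V(1)[of 0], of ?I G First] cyclic_Second[OF V(1)[of 1], of ?I G]
      cyclic_flip[OF V(2)[of 1], of ?I G Second] cyclic_First[OF V(2)[of 0], of ?I G]
      cyclic_flip[OF V(2)[of 1], of ?I G First] cyclic_Second[OF V(2)[of 0], of ?I G]
      cyclic_flip[OF V(1)[of 0], of ?I G Second]
    by (simp_all add: flipv_def r q V mcup_def wcup_def adj_def)
  have path: "conn ?H (First, 0, n) (First, 1, n) 0"
    using conn_trans[OF 1(7) conn_trans[OF 1(6) conn_trans[OF 1(5) conn_trans[OF 1(4)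
        conn_trans[OF 1(3) conn_trans[OF 1(2) 1(1)]]]]]] by simp
  show ?thesis
    by (rule trace_incl_star[OF F r(1) n _ _ _ path, where \<epsilon> = \<epsilon>])
      (use n in \<open>auto simp: r mem_Vset mcup_def wcup_def adj_def\<close>)
qed

section \<open>Linear extension\<close>

abbreviation coeff :: "atl \<Rightarrow> tangle \<Rightarrow> Ra" where
  "coeff \<equiv> Poly_Mapping.lookup"

abbreviation basis :: "tangle \<Rightarrow> Ra \<Rightarrow> atl" where
  "basis \<equiv> Poly_Mapping.single"

abbreviation supp :: "atl \<Rightarrow> tangle set" where
  "supp \<equiv> Poly_Mapping.keys"

definition amult :: "atl \<Rightarrow> atl \<Rightarrow> atl" where
  "amult x y = (\<Sum>F\<in>supp x. \<Sum>F'\<in>supp y. basis (tangle_star F F') (coeff x F * coeff y F' * loop_factor F F'))"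

definition smul :: "Ra \<Rightarrow> atl \<Rightarrow> atl" where
  "smul c = Poly_Mapping.map ((*) c)"

definition tr :: "atl \<Rightarrow> Ra" where
  "tr x = (\<Sum>F\<in>supp x. coeff x F * tangle_trace F)"

lemma ATL_simps [simp]:
  "mult (ATL n) = amult" "one (ATL n) = basis (tangle_one n) 1" "add (ATL n) = (+)" "smult (ATL n) = smul"
  by (auto simp: ATL_def amult_def smul_def fun_eq_iff)

lemma carrier_ATL: "x \<in> carrier (ATL n) \<longleftrightarrow> supp x \<subseteq> arrow_tangles n"
  by (simp add: ATL_def)

lemma coeff_smul: "coeff (smul c x) F = c * coeff x F"
  by (simp add: smul_def Poly_Mapping.map.rep_eq when_def)

lemma smul_basis [simp]: "smul c (basis F d) = basis F (c * d)"
  by (rule poly_mapping_eqI) (simp add: coeff_smul lookup_single when_def)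

lemma smul_add: "smul c (x + y) = smul c x + smul c y"
  by (rule poly_mapping_eqI) (simp add: coeff_smul lookup_add distrib_left)

lemma smul_smul: "smul c (smul d x) = smul (c * d) x"
  by (rule poly_mapping_eqI) (simp add: coeff_smul mult.assoc)

lemma smul_zero: "smul c 0 = 0"
  by (rule poly_mapping_eqI) (simp add: coeff_smul)

lemma basis_in: "F \<in> arrow_tangles n \<Longrightarrow> basis F c \<in> carrier (ATL n)"
  by (simp add: carrier_ATL)

lemma zero_in: "0 \<in> carrier (ATL n)"
  by (simp add: carrier_ATL)

lemma add_in: "x \<in> carrier (ATL n) \<Longrightarrow> y \<in> carrier (ATL n) \<Longrightarrow> x + y \<in> carrier (ATL n)"
  using Poly_Mapping.keys_add[of x y] by (auto simp: carrier_ATL)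

lemma supp_smul: "supp (smul c x) \<subseteq> supp x"
  by (auto simp: Poly_Mapping.in_keys_iff coeff_smul)

lemma smul_in: "x \<in> carrier (ATL n) \<Longrightarrow> smul c x \<in> carrier (ATL n)"
  using supp_smul[of c x] by (auto simp: carrier_ATL)

lemma atl_decomp: "x = (\<Sum>F\<in>supp x. basis F (coeff x F))"
  by (rule poly_mapping_eqI)
    (simp add: lookup_sum lookup_single when_def Poly_Mapping.in_keys_iff)

text \<open>Carries identities that are additive in an element over from scaled basis tangles;
  multilinear statements are proved by nesting it.\<close>

lemma atl_induct [consumes 1, case_names zero basis add]:
  assumes "x \<in> carrier (ATL n)" and "P 0"
    and "\<And>F c. F \<in> arrow_tangles n \<Longrightarrow> P (basis F c)"
    and "\<And>x y. x \<in> carrier (ATL n) \<Longrightarrow> y \<in> carrier (ATL n) \<Longrightarrow> P x \<Longrightarrow> P y \<Longrightarrow> P (x + y)"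
  shows "P x"
proof -
  have "P (\<Sum>F\<in>S. basis F (coeff x F)) \<and> (\<Sum>F\<in>S. basis F (coeff x F)) \<in> carrier (ATL n)"
    if "finite S" "S \<subseteq> arrow_tangles n" for S
    using that
  proof (induction S)
    case (insert F S)
    then show ?case using assms(3,4) basis_in add_in by simp
  qed (simp add: assms(2) zero_in)
  then have "P (\<Sum>F\<in>supp x. basis F (coeff x F))" using assms(1) by (simp add: carrier_ATL)
  then show ?thesis using atl_decomp[of x] by simp
qed

text \<open>Cancellation may shrink supports, so bilinearity is proved with sums over a common
  finite set that contains them all.\<close>

lemma amult_superset:
  assumes "finite A" "supp x \<subseteq> A" "finite B" "supp y \<subseteq> B"
  shows "amult x y = (\<Sum>F\<in>A. \<Sum>F'\<in>B. basis (tangle_star F F') (coeff x F * coeff y F' * loop_factor F F'))"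
proof -
  have "(\<Sum>F'\<in>supp y. basis (tangle_star F F') (coeff x F * coeff y F' * loop_factor F F')) =
      (\<Sum>F'\<in>B. basis (tangle_star F F') (coeff x F * coeff y F' * loop_factor F F'))" for F
    by (rule sum.mono_neutral_left) (use assms in \<open>auto simp: Poly_Mapping.in_keys_iff\<close>)
  then have "amult x y = (\<Sum>F\<in>supp x. \<Sum>F'\<in>B. basis (tangle_star F F') (coeff x F * coeff y F' * loop_factor F F'))"
    by (simp add: amult_def)
  also have "\<dots> = (\<Sum>F\<in>A. \<Sum>F'\<in>B. basis (tangle_star F F') (coeff x F * coeff y F' * loop_factor F F'))"
    by (rule sum.mono_neutral_left) (use assms in \<open>auto simp: Poly_Mapping.in_keys_iff\<close>)
  finally show ?thesis .
qed

lemma amult_add_left: "amult (x + x') y = amult x y + amult x' y"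
proof -
  let ?A = "supp x \<union> supp x'"
  have "supp (x + x') \<subseteq> ?A" by (rule Poly_Mapping.keys_add)
  then show ?thesis
    by (simp add: amult_superset[of ?A _ "supp y"] lookup_add distrib_right single_add sum.distrib)
qed

lemma amult_add_right: "amult x (y + y') = amult x y + amult x y'"
proof -
  let ?A = "supp y \<union> supp y'"
  have "supp (y + y') \<subseteq> ?A" by (rule Poly_Mapping.keys_add)
  then show ?thesis
    by (simp add: amult_superset[of "supp x" _ ?A] lookup_add distrib_right distrib_left single_add sum.distrib)
qed

lemma smul_sum: "smul c (\<Sum>i\<in>S. f i) = (\<Sum>i\<in>S. smul c (f i))"
  by (induction S rule: infinite_finite_induct) (auto simp: smul_zero smul_add)

lemma amult_smul_left: "amult (smul c x) y = smul c (amult x y)"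
  by (simp add: amult_superset[OF _ supp_smul _ order_refl] coeff_smul)
    (simp add: amult_def smul_sum mult.assoc)

lemma amult_smul_right: "amult x (smul c y) = smul c (amult x y)"
  by (simp add: amult_superset[OF _ order_refl _ supp_smul] coeff_smul)
    (simp add: amult_def smul_sum mult.left_commute mult.assoc)

lemma amult_zero [simp]: "amult 0 y = 0" "amult x 0 = 0"
  by (simp_all add: amult_def)

lemma amult_basis: "amult (basis F c) (basis F' d) = basis (tangle_star F F') (c * d * loop_factor F F')"
  by (simp add: amult_superset[of "{F}" _ "{F'}"] split: if_splits)

lemma amult_in:
  assumes "x \<in> carrier (ATL n)" "y \<in> carrier (ATL n)"
  shows "amult x y \<in> carrier (ATL n)"
  using assms
proof (induction rule: atl_induct)
  case (basis F c)
  show ?case using basis(2,1)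
    by (induction rule: atl_induct) (auto simp: zero_in amult_basis amult_add_right intro: basis_in star_in_arrow add_in)
qed (auto simp: zero_in amult_add_left intro: add_in)

lemma amult_assoc:
  assumes "x \<in> carrier (ATL n)" "y \<in> carrier (ATL n)" "z \<in> carrier (ATL n)"
  shows "amult (amult x y) z = amult x (amult y z)"
  using assms
proof (induction rule: atl_induct)
  case (basis F c)
  note F = basis(1)
  show ?case using basis(2,3)
  proof (induction rule: atl_induct)
    case (basis F' d)
    note F' = basis(1)
    show ?case using basis(2)
    proof (induction rule: atl_induct)
      case (basis F'' e)
      note s = star_assoc[OF F F' basis]
      have "loop_factor F F' * loop_factor (tangle_star F F') F'' * (c * d * e) =
          loop_factor F' F'' * loop_factor F (tangle_star F' F'') * (c * d * e)" using s(2) by simp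
      then show ?case by (simp add: amult_basis s(1) ac_simps)
    qed (auto simp: amult_add_right)
  qed (auto simp: amult_add_left amult_add_right)
qed (auto simp: amult_add_left)

lemma tangle_one_in: "tangle_one n \<in> arrow_tangles n"
  using representsD(1)[OF represents_one] .

lemma amult_one:
  assumes "x \<in> carrier (ATL n)"
  shows "amult (basis (tangle_one n) 1) x = x" "amult x (basis (tangle_one n) 1) = x"
  using assms
  by (induction rule: atl_induct)
    (auto simp: amult_basis one_star_left one_star_right amult_add_left amult_add_right)

lemma monoid_ATL: "monoid (ATL n)"
  by (rule monoidI) (auto intro: amult_in amult_assoc basis_in tangle_one_in simp: amult_one)

lemma tr_superset: "finite A \<Longrightarrow> supp x \<subseteq> A \<Longrightarrow> tr x = (\<Sum>F\<in>A. coeff x F * tangle_trace F)"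
  unfolding tr_def by (rule sum.mono_neutral_left) (auto simp: Poly_Mapping.in_keys_iff)

lemma tr_add: "tr (x + y) = tr x + tr y"
proof -
  let ?A = "supp x \<union> supp y"
  have "supp (x + y) \<subseteq> ?A" by (rule Poly_Mapping.keys_add)
  then show ?thesis by (simp add: tr_superset[of ?A] lookup_add distrib_right sum.distrib)
qed

lemma tr_zero [simp]: "tr 0 = 0"
  by (simp add: tr_def)

lemma tr_smul: "tr (smul c x) = c * tr x"
  by (simp add: tr_superset[OF _ supp_smul] coeff_smul) (simp add: tr_def sum_distrib_left mult.assoc)

lemma tr_basis: "tr (basis F c) = c * tangle_trace F"
  by (simp add: tr_superset[of "{F}"] split: if_splits)

lemma ATL_trace_eq: "x \<in> carrier (ATL n) \<Longrightarrow> ATL_trace n x = tr x"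
  by (simp add: ATL_trace_def tr_def)

lemma tr_commute:
  assumes "x \<in> carrier (ATL n)" "y \<in> carrier (ATL n)"
  shows "tr (amult x y) = tr (amult y x)"
  using assms
proof (induction rule: atl_induct)
  case (basis F c)
  note F = basis(1)
  show ?case using basis(2)
  proof (induction rule: atl_induct)
    case (basis F' d)
    have "loop_factor F F' * tangle_trace (tangle_star F F') * (c * d) =
        loop_factor F' F * tangle_trace (tangle_star F' F) * (c * d)"
      using trace_star_commute[OF F basis] by simp
    then show ?case by (simp add: amult_basis tr_basis ac_simps)
  qed (auto simp: amult_add_left amult_add_right tr_add)
qed (auto simp: amult_add_left amult_add_right tr_add)

lemma incl_superset:
  "finite A \<Longrightarrow> supp x \<subseteq> A \<Longrightarrow> incl n x = (\<Sum>F\<in>A. basis (tangle_incl n F) (coeff x F))"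
  unfolding incl_def by (rule sum.mono_neutral_left) (auto simp: Poly_Mapping.in_keys_iff)

lemma incl_add: "incl n (x + y) = incl n x + incl n y"
proof -
  let ?A = "supp x \<union> supp y"
  have "supp (x + y) \<subseteq> ?A" by (rule Poly_Mapping.keys_add)
  then show ?thesis by (simp add: incl_superset[of ?A] lookup_add single_add sum.distrib)
qed

lemma incl_zero [simp]: "incl n 0 = 0"
  by (simp add: incl_def)

lemma incl_basis: "incl n (basis F c) = basis (tangle_incl n F) c"
  by (simp add: incl_superset[of "{F}"] split: if_splits)

lemma incl_in_carrier:
  assumes "x \<in> carrier (ATL n)"
  shows "incl n x \<in> carrier (ATL (Suc n))"
  using assms by (induction rule: atl_induct) (auto simp: zero_in incl_basis incl_add intro: basis_in incl_in add_in)

lemma tr_incl: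
  assumes "x \<in> carrier (ATL n)"
  shows "tr (incl n x) = zvar 0 * tr x"
  using assms
  by (induction rule: atl_induct) (auto simp: incl_basis incl_add tr_basis tr_add trace_incl algebra_simps)

lemma w_in: "1 \<le> i \<Longrightarrow> i < n \<Longrightarrow> gen_w n i \<in> carrier (ATL n)"
  using representsD(1)[OF represents_w] by (simp add: gen_w_def carrier_ATL)

lemma F_in_carrier: "1 \<le> i \<Longrightarrow> i < n \<Longrightarrow> gen_F n i \<in> carrier (ATL n)"
  using representsD(1)[OF represents_F] by (simp add: gen_F_def carrier_ATL)

lemma tr_incl_w:
  assumes "x \<in> carrier (ATL n)" "1 \<le> n"
  shows "tr (amult (incl n x) (gen_w (Suc n) n)) = tr x"
  using assms
proof (induction rule: atl_induct)
  case (basis F c)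
  have "loop_factor (tangle_incl n F) (w_tangle (Suc n) n) = 1"
    using perm_star_right(2)[OF represents_w invol_adj represents_refl[OF incl_in[OF basis(1)]]] basis(2) by simp
  then show ?case using trace_incl_w[OF basis] by (simp add: gen_w_def incl_basis amult_basis tr_basis)
qed (auto simp: incl_add amult_add_left tr_add)

lemma tr_incl_cupcap:
  assumes "x \<in> carrier (ATL n)" "1 \<le> n" "cupcap (Suc n) n \<epsilon> G"
  shows "tr (amult (incl n x) (basis G 1)) = tr x"
  using assms
proof (induction rule: atl_induct)
  case (basis F c)
  then show ?case
    using trace_incl_cupcap[OF basis] by (simp add: incl_basis amult_basis tr_basis mult.assoc)
qed (auto simp: incl_add amult_add_left tr_add)

text \<open>Under the trace this lets a crossing pass to the other side of an included element and
  be absorbed into the smaller algebra.\<close>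

lemma incl_amult_w:
  assumes "x \<in> carrier (ATL n)" "1 \<le> i" "i < n"
  shows "amult (incl n x) (gen_w (Suc n) i) = incl n (amult x (gen_w n i))"
    and "amult (gen_w (Suc n) i) (incl n x) = incl n (amult (gen_w n i) x)"
proof -
  have i: "i < Suc n" using assms by simp
  note w = represents_w[OF assms(2,3)] invol_adj[OF assms(2,3)]
  note w' = represents_w[OF assms(2) i] invol_adj[OF assms(2) i]
  show "amult (incl n x) (gen_w (Suc n) i) = incl n (amult x (gen_w n i))"
    using assms(1)
  proof (induction rule: atl_induct)
    case (basis F c)
    then show ?case
      using perm_star_right(2)[OF w represents_refl] perm_star_right(2)[OF w' represents_refl[OF incl_in]]
        incl_star_w[OF _ assms(2,3)]
      by (simp add: gen_w_def incl_basis amult_basis)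
  qed (auto simp: incl_add amult_add_left)
  show "amult (gen_w (Suc n) i) (incl n x) = incl n (amult (gen_w n i) x)"
    using assms(1)
  proof (induction rule: atl_induct)
    case (basis F c)
    then show ?case
      using perm_star_left(2)[OF w represents_refl] perm_star_left(2)[OF w' represents_refl[OF incl_in]]
        w_star_incl[OF _ assms(2,3)]
      by (simp add: gen_w_def incl_basis amult_basis)
  qed (auto simp: incl_add amult_add_right)
qed

section \<open>Relations between the generators\<close>

lemma Apow_mult: "Apow a * Apow b = Apow (a + b)"
  by (simp add: Apow_def Poly_Mapping.mult_single)

lemma Apow_0: "Apow 0 = 1"
  by (simp add: Apow_def flip: Poly_Mapping.single_one zero_prod_def)

lemma zvar_0: "zvar 0 = - Apow 2 - Apow (- 2)"
  by (simp add: zvar_def)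

context
  fixes n i :: nat
  assumes i: "1 \<le> i" "i < n"
begin

lemma gen_S_eq: "gen_S n i = smul (- Apow (- 2)) (basis (tangle_one n) 1) + smul (- Apow (- 4)) (gen_F n i)"
  by (simp add: gen_S_def)

lemma gen_S_in: "gen_S n i \<in> carrier (ATL n)"
  unfolding gen_S_eq using i by (intro add_in smul_in basis_in tangle_one_in F_in_carrier)

lemma gen_F_sq: "amult (gen_F n i) (gen_F n i) = smul (zvar 0) (gen_F n i)"
  using F_star_F[OF i] by (simp add: gen_F_def amult_basis)

lemma gen_w_sq: "amult (gen_w n i) (gen_w n i) = basis (tangle_one n) 1"
proof -
  note w = represents_w[OF i] invol_adj[OF i]
  show ?thesis
    using w_star_w[OF i] perm_star_left(2)[OF w w(1)] by (simp add: gen_w_def amult_basis)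
qed

text \<open>The inverse is S with A replaced by its inverse: in the product the coefficient of F is
  A^2 + A^-2 + z_0 = 0.\<close>

lemma gen_S_inv_eq:
  "inv\<^bsub>ATL n\<^esub> (gen_S n i) = smul (- Apow 2) (basis (tangle_one n) 1) + smul (- Apow 4) (gen_F n i)" (is "_ = ?Y")
proof -
  interpret monoid "ATL n" by (rule monoid_ATL)
  let ?o = "basis (tangle_one n) 1" and ?F = "gen_F n i"
  have o: "?o \<in> carrier (ATL n)" and F: "?F \<in> carrier (ATL n)"
    using i by (auto intro: basis_in tangle_one_in F_in_carrier)
  have Y: "?Y \<in> carrier (ATL n)" using o F by (intro add_in smul_in)
  have expand: "amult (smul a ?o + smul b ?F) (smul c ?o + smul d ?F) =
      smul (a * c) ?o + smul (a * d + b * c + b * d * zvar 0) ?F" for a b c d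
    by (rule poly_mapping_eqI)
      (simp add: amult_add_left amult_add_right amult_smul_left amult_smul_right amult_one o F gen_F_sq
        smul_smul lookup_add coeff_smul algebra_simps del: smul_basis)
  have zero: "smul 0 ?F = 0" by (rule poly_mapping_eqI) (simp add: coeff_smul)
  have 1: "amult (gen_S n i) ?Y = ?o" "amult ?Y (gen_S n i) = ?o"
    unfolding gen_S_eq expand
    by (simp_all add: Apow_mult Apow_0 zvar_0 algebra_simps zero)
  show ?thesis using inv_unique'[OF gen_S_in Y] 1 by simp
qed

lemma gen_S_inv_in: "inv\<^bsub>ATL n\<^esub> (gen_S n i) \<in> carrier (ATL n)"
  unfolding gen_S_inv_eq using i by (intro add_in smul_in basis_in tangle_one_in F_in_carrier)

end

text \<open>The four words of move (d) with \<open>b\<close>, \<open>a\<close>, \<open>f\<close>,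
  \<open>g\<close> in the roles of w_n, w_{n-1}, F_n, F_{n-1}. Replacing \<open>g\<close> by a
  conjugate of \<open>f\<close> leaves pure rewriting: the braid relation is oriented from
  \<open>b a b\<close> to \<open>a b a\<close>, and squares of \<open>a\<close> and \<open>b\<close>
  disappear. In the last word the two occurrences of \<open>g\<close> are first merged into
  one.\<close>

lemma (in monoid) braid_words:
  assumes cl: "P \<in> carrier G" "a \<in> carrier G" "b \<in> carrier G" "f \<in> carrier G"
    and aa: "a \<otimes> a = \<one>" and bb: "b \<otimes> b = \<one>" and aba: "a \<otimes> (b \<otimes> a) = b \<otimes> (a \<otimes> b)"
    and g: "g = b \<otimes> (a \<otimes> (f \<otimes> a \<otimes> b))" and gbg: "g \<otimes> (b \<otimes> g) = g"
  defines "q \<equiv> b \<otimes> (f \<otimes> b)"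
  shows "P \<otimes> b \<otimes> a \<otimes> b \<otimes> a \<otimes> b = P \<otimes> a"
    and "P \<otimes> b \<otimes> a \<otimes> b \<otimes> g \<otimes> a \<otimes> b = P \<otimes> q \<otimes> a"
    and "P \<otimes> b \<otimes> a \<otimes> g \<otimes> b \<otimes> a \<otimes> b = P \<otimes> a \<otimes> q"
    and "P \<otimes> b \<otimes> a \<otimes> g \<otimes> b \<otimes> g \<otimes> a \<otimes> b = P \<otimes> a \<otimes> q \<otimes> a"
proof -
  have gc: "g \<in> carrier G" unfolding g using cl by simp
  have aa': "a \<otimes> (a \<otimes> x) = x" and bb': "b \<otimes> (b \<otimes> x) = x"
    and bab': "b \<otimes> (a \<otimes> (b \<otimes> x)) = a \<otimes> (b \<otimes> (a \<otimes> x))" if "x \<in> carrier G" for x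
    using that cl aa bb aba by (simp_all flip: m_assoc)
  have gbg': "g \<otimes> (b \<otimes> (g \<otimes> x)) = g \<otimes> x" if "x \<in> carrier G" for x
    using that cl gc gbg by (simp flip: m_assoc)
  note rules = m_assoc cl aa bb aa' bb' aba[symmetric] bab'
  show "P \<otimes> b \<otimes> a \<otimes> b \<otimes> a \<otimes> b = P \<otimes> a"
    by (simp add: rules)
  show "P \<otimes> b \<otimes> a \<otimes> b \<otimes> g \<otimes> a \<otimes> b = P \<otimes> q \<otimes> a"
    unfolding g q_def by (simp add: rules)
  show "P \<otimes> b \<otimes> a \<otimes> g \<otimes> b \<otimes> a \<otimes> b = P \<otimes> a \<otimes> q"
    unfolding g q_def by (simp add: rules)
  have "P \<otimes> b \<otimes> a \<otimes> g \<otimes> b \<otimes> g \<otimes> a \<otimes> b = P \<otimes> b \<otimes> a \<otimes> g \<otimes> a \<otimes> b"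
    using gbg' cl gc by (simp add: m_assoc)
  also have "\<dots> = P \<otimes> a \<otimes> q \<otimes> a"
    unfolding g q_def by (simp add: rules)
  finally show "P \<otimes> b \<otimes> a \<otimes> g \<otimes> b \<otimes> g \<otimes> a \<otimes> b = P \<otimes> a \<otimes> q \<otimes> a" .
qed

lemma gen_w_braid:
  assumes i: "1 \<le> i" "Suc i < n"
  shows "amult (gen_w n i) (amult (gen_w n (Suc i)) (gen_w n i)) =
    amult (gen_w n (Suc i)) (amult (gen_w n i) (gen_w n (Suc i)))"
proof -
  have i': "i < n" "1 \<le> Suc i" using i by auto
  note a = represents_w[OF i(1) i'(1)] invol_adj[OF i(1) i'(1)]
  note b = represents_w[OF i'(2) i(2)] invol_adj[OF i'(2) i(2)]
  note ab = perm_star_left[OF a b(1)] and ba = perm_star_left[OF b a(1)]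
  show ?thesis
    using w_braid[OF i] ab(2) ba(2) perm_star_left(2)[OF a ba(1)] perm_star_left(2)[OF b ab(1)]
    by (simp add: gen_w_def amult_basis)
qed

lemma gen_F_conjugate:
  assumes i: "1 \<le> i" "Suc i < n"
  shows "gen_F n i = amult (gen_w n (Suc i)) (amult (gen_w n i)
    (amult (amult (gen_F n (Suc i)) (gen_w n i)) (gen_w n (Suc i))))"
proof -
  have i': "i < n" "1 \<le> Suc i" using i by auto
  note a = represents_w[OF i(1) i'(1)] invol_adj[OF i(1) i'(1)]
  note b = represents_w[OF i'(2) i(2)] invol_adj[OF i'(2) i(2)]
  note 1 = perm_star_right[OF a represents_F[OF i'(2) i(2)]]
  note 2 = perm_star_right[OF b 1(1)]
  note 3 = perm_star_left[OF a 2(1)]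
  note 4 = perm_star_left[OF b 3(1)]
  show ?thesis
    using F_conjugate[OF i] 1(2) 2(2) 3(2) 4(2) by (simp add: gen_w_def gen_F_def amult_basis)
qed

lemma gen_FwF:
  assumes i: "1 \<le> i" "Suc i < n"
  shows "amult (gen_F n i) (amult (gen_w n (Suc i)) (gen_F n i)) = gen_F n i"
    and "amult (gen_F n (Suc i)) (amult (gen_w n i) (gen_F n (Suc i))) = gen_F n (Suc i)"
proof -
  have i': "i < n" "1 \<le> Suc i" using i by auto
  note a = represents_w[OF i(1) i'(1)] invol_adj[OF i(1) i'(1)]
  note b = represents_w[OF i'(2) i(2)] invol_adj[OF i'(2) i(2)]
  show "amult (gen_F n i) (amult (gen_w n (Suc i)) (gen_F n i)) = gen_F n i"
    using F_w_Suc_F[of i n] i perm_star_left(2)[OF b represents_F[OF i(1) i'(1)]]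
    by (simp add: gen_w_def gen_F_def amult_basis)
  show "amult (gen_F n (Suc i)) (amult (gen_w n i) (gen_F n (Suc i))) = gen_F n (Suc i)"
    using F_Suc_w_F_Suc[of i n] i perm_star_left(2)[OF a represents_F[OF i'(2) i(2)]]
    by (simp add: gen_w_def gen_F_def amult_basis)
qed

section \<open>The Markov moves\<close>

context
  fixes n :: nat and x :: atl
  assumes n: "1 \<le> n" and x: "x \<in> carrier (ATL n)"
begin

lemma tr_incl_F: "tr (amult (incl n x) (gen_F (Suc n) n)) = tr x"
  unfolding gen_F_def by (rule tr_incl_cupcap[OF x n cupcap_F[OF n lessI]])

lemma incl_one: "amult (incl n x) (basis (tangle_one (Suc n)) 1) = incl n x"
  by (rule amult_one(2)[OF incl_in_carrier[OF x]])

text \<open>Since - A^-2 z_0 = 1 + A^-4, the surplus A^-4 is removed by the term with F. The inverse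
  behaves likewise with A replaced by its inverse.\<close>

lemma tr_incl_S: "tr (amult (incl n x) (gen_S (Suc n) n)) = tr x"
proof -
  have "tr (amult (incl n x) (gen_S (Suc n) n)) = - Apow (- 2) * (zvar 0 * tr x) + - Apow (- 4) * tr x"
    unfolding gen_S_eq[OF n lessI] amult_add_right amult_smul_right incl_one tr_add tr_smul tr_incl_F
      tr_incl[OF x] ..
  also have "\<dots> = (Apow (- 2) * Apow 2) * tr x + (Apow (- 2) * Apow (- 2)) * tr x - Apow (- 4) * tr x"
    by (simp add: zvar_0 algebra_simps)
  finally show ?thesis by (simp add: Apow_mult Apow_0)
qed

lemma tr_incl_S_inv: "tr (amult (incl n x) (gen_S_inv (Suc n) n)) = tr x"
proof -
  have "tr (amult (incl n x) (gen_S_inv (Suc n) n)) = - Apow 2 * (zvar 0 * tr x) + - Apow 4 * tr x"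
    unfolding gen_S_inv_eq[OF n lessI] amult_add_right amult_smul_right incl_one tr_add tr_smul tr_incl_F
      tr_incl[OF x] ..
  also have "\<dots> = (Apow 2 * Apow 2) * tr x + (Apow 2 * Apow (- 2)) * tr x - Apow 4 * tr x"
    by (simp add: zvar_0 algebra_simps)
  finally show ?thesis by (simp add: Apow_mult Apow_0)
qed

end

text \<open>The index is shifted: \<open>n\<close> stands for n - 1 in moves (c) and (d). Thus
  \<open>a\<close> and \<open>b\<close> are w_{n-1} and w_n in the larger algebra, and
  \<open>a'\<close> is w_{n-1} in the smaller one.\<close>

context
  fixes n :: nat and x a b f g a' P u q :: atl
  assumes n: "1 \<le> n" and x: "x \<in> carrier (ATL (Suc n))"
    and a: "a = gen_w (Suc (Suc n)) n" and b: "b = gen_w (Suc (Suc n)) (Suc n)"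
    and f: "f = gen_F (Suc (Suc n)) (Suc n)" and g: "g = gen_F (Suc (Suc n)) n"
    and a': "a' = gen_w (Suc n) n" and P: "P = incl (Suc n) x"
    and u: "u = basis (tangle_one (Suc (Suc n))) 1" and q: "q = amult b (amult f b)"
begin

lemma gens_in:
  "a \<in> carrier (ATL (Suc (Suc n)))" "b \<in> carrier (ATL (Suc (Suc n)))" "f \<in> carrier (ATL (Suc (Suc n)))"
  "g \<in> carrier (ATL (Suc (Suc n)))" "P \<in> carrier (ATL (Suc (Suc n)))" "a' \<in> carrier (ATL (Suc n))"
  "u \<in> carrier (ATL (Suc (Suc n)))"
  unfolding a b f g a' P u using n by (auto intro: w_in F_in_carrier incl_in_carrier x basis_in tangle_one_in)

lemma q_in: "q \<in> carrier (ATL (Suc (Suc n)))"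
  unfolding q using gens_in amult_in by auto

lemma P_a: "amult P a = incl (Suc n) (amult x a')" and a_P: "amult a P = incl (Suc n) (amult a' x)"
  unfolding P a a' using incl_amult_w[OF x n lessI] by auto

lemma xa_in: "amult x a' \<in> carrier (ATL (Suc n))" and ax_in: "amult a' x \<in> carrier (ATL (Suc n))"
  using amult_in x gens_in(6) by auto

lemma tr_incl_f: "y \<in> carrier (ATL (Suc n)) \<Longrightarrow> tr (amult (incl (Suc n) y) f) = tr y"
  unfolding f by (rule tr_incl_F) auto

lemma tr_P_a: "tr (amult P a) = zvar 0 * tr (amult x a')"
  unfolding P_a by (rule tr_incl[OF xa_in])

text \<open>\<open>q\<close> is \<open>f\<close> with its arrows reversed, and the trace against a
  cup and cap does not depend on that sign.\<close>

lemma tr_incl_q: "y \<in> carrier (ATL (Suc n)) \<Longrightarrow> tr (amult (incl (Suc n) y) q) = tr y"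
proof -
  assume y: "y \<in> carrier (ATL (Suc n))"
  have sn: "1 \<le> Suc n" by simp
  note w = represents_w[OF sn lessI] invol_adj[OF sn lessI]
  note 1 = perm_star_right[OF w represents_F[OF sn lessI]]
  have "q = basis (tangle_star (w_tangle (Suc (Suc n)) (Suc n))
      (tangle_star (F_tangle (Suc (Suc n)) (Suc n)) (w_tangle (Suc (Suc n)) (Suc n)))) 1"
    using 1(2) perm_star_left(2)[OF w 1(1)] by (simp add: q b f gen_w_def gen_F_def amult_basis)
  then show ?thesis using tr_incl_cupcap[OF y sn cupcap_wFw[OF sn lessI]] by simp
qed

text \<open>The expansion is P a + A^-2 P a f + A^2 P f a + P f a f. With t the trace of
  \<open>amult x a'\<close> the first three traces are z_0 t, t and t, which cancel; the last word
  is \<open>P f\<close> by straightening.\<close>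

lemma markov_c:
  "tr (amult (amult (amult P (gen_S_inv (Suc (Suc n)) (Suc n))) a) (gen_S (Suc (Suc n)) (Suc n))) = tr x"
proof -
  have sn: "1 \<le> Suc n" by simp
  have 2: "tr (amult (amult P a) f) = tr (amult x a')"
    unfolding P_a by (rule tr_incl_f[OF xa_in])
  \<comment> \<open>Cyclicity of the trace brings \<open>a\<close> next to \<open>P\<close>, where
    both come from the smaller algebra.\<close>
  have "tr (amult (amult P f) a) = tr (amult a (amult P f))"
    using tr_commute amult_in gens_in by blast
  also have "\<dots> = tr (amult (incl (Suc n) (amult a' x)) f)"
    using amult_assoc[OF gens_in(1,5,3)] a_P by simp
  also have "\<dots> = tr (amult x a')"
    using tr_incl_f[OF ax_in] tr_commute[OF gens_in(6) x] by simp
  finally have 3: "tr (amult (amult P f) a) = tr (amult x a')" .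
  have "amult (amult (amult P f) a) f = amult P (amult f (amult a f))"
    by (simp add: amult_assoc[of _ "Suc (Suc n)"] amult_in gens_in)
  then have 4: "tr (amult (amult (amult P f) a) f) = tr x"
    using gen_FwF(2)[OF n lessI] tr_incl_f[OF x] unfolding f a P by simp
  have one: "amult y u = y" if "y \<in> carrier (ATL (Suc (Suc n)))" for y
    unfolding u by (rule amult_one(2)[OF that])
  \<comment> \<open>The scalars stay symbolic while the product is expanded; the powers of A enter
    only afterwards.\<close>
  have "amult (amult (amult P (smul s u + smul t f)) a) (smul s' u + smul t' f) =
      smul (s * s') (amult P a) + smul (s * t') (amult (amult P a) f) + smul (t * s') (amult (amult P f) a) +
      smul (t * t') (amult (amult (amult P f) a) f)" for s t s' t'
  proof -
    have "amult P a \<in> carrier (ATL (Suc (Suc n)))" "amult (amult P f) a \<in> carrier (ATL (Suc (Suc n)))"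
      using gens_in amult_in by auto
    then show ?thesis
      by (simp add: amult_add_left amult_add_right amult_smul_left amult_smul_right smul_add smul_smul one gens_in
          mult.commute add.assoc del: smul_basis)
  qed
  then show ?thesis
    unfolding gen_S_inv_eq[OF sn lessI] unfolding gen_S_eq[OF sn lessI] f[symmetric] u[symmetric]
    by (simp add: tr_add tr_smul tr_P_a 2 3 4 Apow_mult Apow_0 zvar_0 algebra_simps del: smul_basis)
qed

text \<open>By \<open>braid_words\<close> the four terms become P a, P q a, P a q and P a q a, the
  pattern of \<open>markov_c\<close> with \<open>q\<close> in the place of \<open>f\<close>.\<close>

lemma markov_d:
  "tr (amult (amult (amult (amult (amult (amult (amult P b) a) (gen_S (Suc (Suc n)) n)) b)
     (gen_S_inv (Suc (Suc n)) n)) a) b) = tr x"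
proof -
  have n2: "n < Suc (Suc n)" "1 \<le> Suc n" by auto
  interpret monoid "ATL (Suc (Suc n))" by (rule monoid_ATL)
  have one: "amult y u = y" if "y \<in> carrier (ATL (Suc (Suc n)))" for y
    unfolding u by (rule amult_one(2)[OF that])
  have sq: "amult a a = u" "amult b b = u" "amult a' a' = basis (tangle_one (Suc n)) 1"
    unfolding a b a' u using gen_w_sq n by auto
  have "amult a (amult b a) = amult b (amult a b)" "g = amult b (amult a (amult (amult f a) b))"
    "amult g (amult b g) = g"
    unfolding a b f g using gen_w_braid[OF n lessI] gen_F_conjugate[OF n lessI] gen_FwF(1)[OF n lessI] by auto
  note words = braid_words[OF gens_in(5,1,2,3), unfolded ATL_simps u[symmetric], OF sq(1,2) this, folded q]
  have 2: "tr (amult (amult P q) a) = tr (amult x a')"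
  proof -
    have "tr (amult (amult P q) a) = tr (amult a (amult P q))"
      using tr_commute amult_in gens_in q_in by blast
    also have "\<dots> = tr (amult (incl (Suc n) (amult a' x)) q)"
      using amult_assoc[OF gens_in(1,5) q_in] a_P by simp
    also have "\<dots> = tr (amult x a')"
      using tr_incl_q[OF ax_in] tr_commute[OF gens_in(6) x] by simp
    finally show ?thesis .
  qed
  have 3: "tr (amult (amult P a) q) = tr (amult x a')"
    unfolding P_a by (rule tr_incl_q[OF xa_in])
  \<comment> \<open>The outer \<open>a\<close> is moved around to the front; once \<open>q\<close>
    is removed by the trace, the two copies of \<open>a'\<close> around \<open>x\<close> meet by
    cyclicity and cancel.\<close>
  have 4: "tr (amult (amult (amult P a) q) a) = tr x"
  proof -
    have "tr (amult (amult (amult P a) q) a) = tr (amult a (amult (incl (Suc n) (amult x a')) q))"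
      using tr_commute[OF amult_in[OF amult_in[OF gens_in(5,1)] q_in] gens_in(1)] P_a by simp
    also have "\<dots> = tr (amult (incl (Suc n) (amult a' (amult x a'))) q)"
      using amult_assoc[OF gens_in(1) incl_in_carrier[OF xa_in] q_in] incl_amult_w(2)[OF xa_in n lessI]
      by (simp add: a a')
    also have "\<dots> = tr (amult (amult x a') a')"
      using tr_incl_q[OF amult_in[OF gens_in(6) xa_in]] tr_commute[OF gens_in(6) xa_in] by simp
    also have "\<dots> = tr x"
      using amult_assoc[OF x gens_in(6) gens_in(6)] sq(3) amult_one(2)[OF x] by simp
    finally show ?thesis .
  qed
  have "amult (amult (amult (amult (amult (amult (amult P b) a) (smul s u + smul t g)) b) (smul s' u + smul t' g)) a) b =
      smul (s * s') (amult P a) + smul (s * t') (amult (amult P q) a) + smul (t * s') (amult (amult P a) q) +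
      smul (t * t') (amult (amult (amult P a) q) a)" for s t s' t'
  proof -
    have "amult (amult P b) a \<in> carrier (ATL (Suc (Suc n)))"
      "amult (amult (amult P b) a) b \<in> carrier (ATL (Suc (Suc n)))"
      "amult (amult (amult (amult P b) a) g) b \<in> carrier (ATL (Suc (Suc n)))"
      using gens_in amult_in by auto
    then show ?thesis
      by (simp add: amult_add_left amult_add_right amult_smul_left amult_smul_right smul_add smul_smul one
          words mult.commute add.assoc del: smul_basis)
  qed
  then show ?thesis
    unfolding gen_S_inv_eq[OF n n2(1)] unfolding gen_S_eq[OF n n2(1)] g[symmetric] u[symmetric]
    by (simp add: tr_add tr_smul tr_P_a 2 3 4 Apow_mult Apow_0 zvar_0 algebra_simps del: smul_basis)
qed

end

theorem theorem3p5:
  shows "markov_trace ATL_trace"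
  unfolding markov_trace_def
proof (intro conjI allI impI ballI)
  fix n :: nat
  show "linear_form n (ATL_trace n)"
    unfolding linear_form_def by (auto simp: ATL_trace_eq add_in smul_in tr_add tr_smul)
next
  fix n :: nat and x y assume "x \<in> carrier (ATL n)" "y \<in> carrier (ATL n)"
  then show "ATL_trace n (x \<otimes>\<^bsub>ATL n\<^esub> y) = ATL_trace n (y \<otimes>\<^bsub>ATL n\<^esub> x)"
    by (simp add: ATL_trace_eq amult_in tr_commute[of x n y])
next
  fix n :: nat and x assume n: "1 \<le> n" and x: "x \<in> carrier (ATL n)"
  note inc = incl_in_carrier[OF x]
  show "ATL_trace n x = ATL_trace (n + 1) (incl n x \<otimes>\<^bsub>ATL (n + 1)\<^esub> gen_S (n + 1) n)"
    using tr_incl_S[OF n x] by (simp add: ATL_trace_eq x amult_in[OF inc gen_S_in[OF n lessI]])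
  show "ATL_trace n x = ATL_trace (n + 1) (incl n x \<otimes>\<^bsub>ATL (n + 1)\<^esub> gen_S_inv (n + 1) n)"
    using tr_incl_S_inv[OF n x] by (simp add: ATL_trace_eq x amult_in[OF inc gen_S_inv_in[OF n lessI]])
  show "ATL_trace n x = ATL_trace (n + 1) (incl n x \<otimes>\<^bsub>ATL (n + 1)\<^esub> gen_w (n + 1) n)"
    using tr_incl_w[OF x n] by (simp add: ATL_trace_eq x amult_in[OF inc w_in[OF n lessI]])
next
  fix n :: nat and x assume "2 \<le> n" and x': "x \<in> carrier (ATL n)"
  then obtain k where k: "n = Suc k" "1 \<le> k" by (cases n) auto
  have x: "x \<in> carrier (ATL (Suc k))" using x' k by simp
  have k2: "k < Suc (Suc k)" "1 \<le> Suc k" by auto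
  \<comment> \<open>The letters of the preceding context were fixed by eight defining equations, and
    each \<open>refl\<close> instantiates one of them.\<close>
  note refls = refl refl refl refl refl refl refl refl
  note cl = gens_in[OF k(2) x refls] gen_S_in[OF k2(2) lessI] gen_S_inv_in[OF k2(2) lessI]
    gen_S_in[OF k(2) k2(1)] gen_S_inv_in[OF k(2) k2(1)]
  show "ATL_trace n x = ATL_trace (n + 1) (incl n x \<otimes>\<^bsub>ATL (n + 1)\<^esub> gen_S_inv (n + 1) n
      \<otimes>\<^bsub>ATL (n + 1)\<^esub> gen_w (n + 1) (n - 1) \<otimes>\<^bsub>ATL (n + 1)\<^esub> gen_S (n + 1) n)"
    using markov_c[OF k(2) x refls] unfolding k(1) by (simp add: ATL_trace_eq x amult_in cl)
  show "ATL_trace n x = ATL_trace (n + 1) (incl n x \<otimes>\<^bsub>ATL (n + 1)\<^esub> gen_w (n + 1) n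
      \<otimes>\<^bsub>ATL (n + 1)\<^esub> gen_w (n + 1) (n - 1) \<otimes>\<^bsub>ATL (n + 1)\<^esub> gen_S (n + 1) (n - 1)
      \<otimes>\<^bsub>ATL (n + 1)\<^esub> gen_w (n + 1) n \<otimes>\<^bsub>ATL (n + 1)\<^esub> gen_S_inv (n + 1) (n - 1)
      \<otimes>\<^bsub>ATL (n + 1)\<^esub> gen_w (n + 1) (n - 1) \<otimes>\<^bsub>ATL (n + 1)\<^esub> gen_w (n + 1) n)"
    using markov_d[OF k(2) x refls] unfolding k(1) by (simp add: ATL_trace_eq x amult_in cl)
qed

end
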